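(* The $F$-stable quasi-semi-simple $G$-conjugacy classes contained in $G\sigma$ are in bijection with the set $\bar{\mathfrak T}_{C,s}$.
   Context: $p$ is an odd prime, $q$ a power of $p$ with $q>n$, $k$ an algebraic closure of $\mathbb F_q$, $\mathfrak i\in k$ a square root of $-1$. $G=\mathrm{GL}_n(k)$ with Frobenius $F$ raising entries to the $q$-th power. $J_n$ is the antidiagonal matrix of ones; $\sigma(g)=\mathscr Jg^{-t}\mathscr J^{-1}$ ($g^{-t}$ the transpose-inverse) with $\mathscr J=J_n$ for $n$ odd and $\mathscr J=t_0J_n$, $t_0=\mathrm{diag}(1,\dots,1,-1,\dots,-1)$ ($n/2$ ones) for $n$ even. $\bar G=G\sqcup G\sigma$ is $G\rtimes\langle\sigma\rangle$ with $\sigma^2=1$, or for $n$ even possibly $G\rtimes\langle\sigma'\rangle$ with $\sigma'(g)=J_ng^{-t}J_n^{-1}$, $\sigma'^2=1$, in which case $\sigma$ denotes $t_0\sigma'$. $F$ acts on $\bar G$ fixing $\sigma$. An element of $\bar G$ is quasi-semi-simple if its conjugation action on $G$ stabilises a maximal torus and a Borel subgroup containing it. $\hat k$ is the quotient of $k^*$ by the group generated by $a\mapsto a^{-1}$ and $a\mapsto-a$; the class of $a$ is $\hat a=\{a,-a,a^{-1},-a^{-1}\}$. $F$ acts on $\hat k$ by $\hat a\mapsto\widehat{a^q}$. The sets $\{\hat1\}$ and $\{\hat{\mathfrak i}\}$ are single $F$-orbits. $\bar{\mathfrak T}_{C,s}$ is the set of data $n_+n_-(n_i,\hat\alpha_i)_{i\in\Lambda}$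 where: $\Lambda$ is a possibly empty finite set; $n_+,n_-\ge0$ are integers with $n_+\equiv n\pmod 2$; $n_i$ are positive integers; $\hat\alpha_i\subset\hat k$ are $F$-orbits, pairwise distinct, different from $\{\hat1\}$ and $\{\hat{\mathfrak i}\}$; and $n_++n_-+\sum_{i\in\Lambda}2n_i|\hat\alpha_i|=n$. Two such data are identified if they have the same $n_+$, $n_-$ and there is a bijection of the index sets matching the integers and the orbits. *)

theory Defs
  imports
    "Jordan_Normal_Form.Determinant"
    "HOL-Algebra.Solvable_Groups"
    "HOL-Analysis.Abstract_Topology"
    "HOL-Computational_Algebra.Polynomial"
begin

section \<open>The ground field\<close>

text \<open>\<open>'k\<close> is an algebraic closure of the field with \<open>q\<close> elements, \<open>q\<close> a power of the prime \<open>p\<close>.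
  Inside an algebraically closed field of characteristic \<open>p\<close>, the subfield with \<open>q\<close> elements is
  \<open>Fq q\<close>.\<close>

definition Fq :: "nat \<Rightarrow> 'k :: field set" where
  "Fq q = {x. x ^ q = x}"

definition algebraic_over :: "'k :: field set \<Rightarrow> 'k \<Rightarrow> bool" where
  "algebraic_over K x \<longleftrightarrow> (\<exists>P. P \<noteq> 0 \<and> (\<forall>i. poly.coeff P i \<in> K) \<and> poly P x = 0)"

definition algebraic_closure_of_Fq :: "nat \<Rightarrow> nat \<Rightarrow> 'k :: alg_closed_field itself \<Rightarrow> bool" where
  "algebraic_closure_of_Fq p q ty \<longleftrightarrow>
     prime p \<and> (\<exists>e>0. q = p ^ e) \<and> CHAR('k) = p \<and> (\<forall>x :: 'k. algebraic_over (Fq q) x)"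


section \<open>\<open>GL\<^sub>n\<close> as a linear algebraic group\<close>

definition GL :: "nat \<Rightarrow> 'k :: field mat monoid" where
  "GL n = units_of (ring_mat TYPE('k) n ())"

text \<open>The coordinate ring of \<open>GL\<^sub>n\<close>: polynomials in the entries and the inverse of the determinant.\<close>

inductive_set regular_funs :: "nat \<Rightarrow> ('k :: field mat \<Rightarrow> 'k) set" for n :: nat where
  const: "(\<lambda>_. c) \<in> regular_funs n"
| entry: "i < n \<Longrightarrow> j < n \<Longrightarrow> (\<lambda>g. g $$ (i, j)) \<in> regular_funs n"
| inv_det: "(\<lambda>g. inverse (det g)) \<in> regular_funs n"
| add: "f \<in> regular_funs n \<Longrightarrow> h \<in> regular_funs n \<Longrightarrow> (\<lambda>g. f g + h g) \<in> regular_funs n"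
| mult: "f \<in> regular_funs n \<Longrightarrow> h \<in> regular_funs n \<Longrightarrow> (\<lambda>g. f g * h g) \<in> regular_funs n"

definition zero_locus :: "nat \<Rightarrow> ('k :: field mat \<Rightarrow> 'k) set \<Rightarrow> 'k mat set" where
  "zero_locus n S = {g \<in> carrier (GL n). \<forall>f\<in>S. f g = 0}"

definition zariski_open :: "nat \<Rightarrow> 'k :: field mat set \<Rightarrow> bool" where
  "zariski_open n U \<longleftrightarrow> (\<exists>S \<subseteq> regular_funs n. U = carrier (GL n) - zero_locus n S)"

lemma istopology_zariski_open: "istopology (zariski_open n :: 'k :: field mat set \<Rightarrow> bool)"
  unfolding istopology_def
proof (intro conjI allI impI)
  fix U V :: "'k mat set"
  assume "zariski_open n U" "zariski_open n V"
  then obtain S T where S: "S \<subseteq> regular_funs n" "U = carrier (GL n) - zero_locus n S"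
    and T: "T \<subseteq> regular_funs n" "V = carrier (GL n) - zero_locus n T"
    unfolding zariski_open_def by auto
  let ?P = "{(\<lambda>g. f g * h g) | f h. f \<in> S \<and> h \<in> T}"
  have "?P \<subseteq> regular_funs n"
    using S(1) T(1) by (auto intro!: regular_funs.mult)
  moreover have "U \<inter> V = carrier (GL n) - zero_locus n ?P"
  proof (intro equalityI subsetI)
    fix g assume "g \<in> U \<inter> V"
    then obtain f h where "g \<in> carrier (GL n)" "f \<in> S" "f g \<noteq> 0" "h \<in> T" "h g \<noteq> 0"
      using S(2) T(2) unfolding zero_locus_def by auto
    moreover from this have "(\<lambda>g. f g * h g) \<in> ?P" by blast
    ultimately show "g \<in> carrier (GL n) - zero_locus n ?P"
      unfolding zero_locus_def by fastforce
  next
    fix g assume "g \<in> carrier (GL n) - zero_locus n ?P"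
    then show "g \<in> U \<inter> V"
      using S(2) T(2) unfolding zero_locus_def by auto
  qed
  ultimately show "zariski_open n (U \<inter> V)"
    unfolding zariski_open_def by blast
next
  fix \<K> :: "'k mat set set"
  assume "\<forall>K\<in>\<K>. zariski_open n K"
  then obtain S where S: "\<And>K. K \<in> \<K> \<Longrightarrow> S K \<subseteq> regular_funs n"
      "\<And>K. K \<in> \<K> \<Longrightarrow> K = carrier (GL n) - zero_locus n (S K)"
    unfolding zariski_open_def by metis
  have "(\<Union>K\<in>\<K>. carrier (GL n) - zero_locus n (S K)) = carrier (GL n) - zero_locus n (\<Union>(S ` \<K>))"
    unfolding zero_locus_def by auto
  moreover have "\<Union>\<K> = (\<Union>K\<in>\<K>. carrier (GL n) - zero_locus n (S K))"
    using S(2) by blast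
  moreover have "\<Union>(S ` \<K>) \<subseteq> regular_funs n"
    using S(1) by blast
  ultimately show "zariski_open n (\<Union>\<K>)"
    unfolding zariski_open_def by metis
qed

definition zariski :: "nat \<Rightarrow> 'k :: field mat topology" where
  "zariski n = topology (zariski_open n)"

definition closed_subgroup :: "nat \<Rightarrow> 'k :: field mat set \<Rightarrow> bool" where
  "closed_subgroup n H \<longleftrightarrow> subgroup H (GL n) \<and> closedin (zariski n) H"

text \<open>Regular functions on a closed subgroup are restrictions of regular functions on \<open>GL\<^sub>n\<close>.\<close>

definition alg_group_morphism ::
  "nat \<Rightarrow> 'k :: field mat set \<Rightarrow> nat \<Rightarrow> 'k mat set \<Rightarrow> ('k mat \<Rightarrow> 'k mat) \<Rightarrow> bool" where
  "alg_group_morphism n H m H' \<phi> \<longleftrightarrow>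
     \<phi> \<in> hom (GL n\<lparr>carrier := H\<rparr>) (GL m\<lparr>carrier := H'\<rparr>) \<and>
     (\<forall>i<m. \<forall>j<m. \<exists>f\<in>regular_funs n. \<forall>g\<in>H. \<phi> g $$ (i, j) = f g)"

definition alg_group_isomorphic ::
  "nat \<Rightarrow> 'k :: field mat set \<Rightarrow> nat \<Rightarrow> 'k mat set \<Rightarrow> bool" where
  "alg_group_isomorphic n H m H' \<longleftrightarrow>
     (\<exists>\<phi> \<psi>. alg_group_morphism n H m H' \<phi> \<and> alg_group_morphism m H' n H \<psi> \<and>
        (\<forall>g\<in>H. \<psi> (\<phi> g) = g) \<and> (\<forall>g\<in>H'. \<phi> (\<psi> g) = g))"

text \<open>\<open>diag_group r\<close> is the \<open>r\<close>-fold power of the multiplicative group.\<close>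

definition diag_group :: "nat \<Rightarrow> 'k :: field mat set" where
  "diag_group r = {g \<in> carrier (GL r). diagonal_mat g}"

definition torus :: "nat \<Rightarrow> 'k :: field mat set \<Rightarrow> bool" where
  "torus n T \<longleftrightarrow> closed_subgroup n T \<and> (\<exists>r. alg_group_isomorphic n T r (diag_group r))"

definition maximal_torus :: "nat \<Rightarrow> 'k :: field mat set \<Rightarrow> bool" where
  "maximal_torus n T \<longleftrightarrow> torus n T \<and> (\<forall>S. torus n S \<and> T \<subseteq> S \<longrightarrow> S = T)"

definition connected_solvable_subgroup :: "nat \<Rightarrow> 'k :: field mat set \<Rightarrow> bool" where
  "connected_solvable_subgroup n H \<longleftrightarrow>
     closed_subgroup n H \<and> connectedin (zariski n) H \<and> solvable (GL n\<lparr>carrier := H\<rparr>)"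

definition borel_subgroup :: "nat \<Rightarrow> 'k :: field mat set \<Rightarrow> bool" where
  "borel_subgroup n B \<longleftrightarrow> connected_solvable_subgroup n B \<and>
     (\<forall>H. connected_solvable_subgroup n H \<and> B \<subseteq> H \<longrightarrow> H = B)"


section \<open>The group \<open>G \<rtimes> \<langle>\<tau>\<rangle>\<close>\<close>

definition anti_id :: "nat \<Rightarrow> 'k :: field mat" where
  "anti_id n = mat n n (\<lambda>(i, j). if i + j + 1 = n then 1 else 0)"

definition t0 :: "nat \<Rightarrow> 'k :: field mat" where
  "t0 n = mat_diag n (\<lambda>i. if i < n div 2 then 1 else -1)"

definition script_J :: "nat \<Rightarrow> 'k :: field mat" where
  "script_J n = (if odd n then anti_id n else t0 n * anti_id n)"

definition twisted_inv_transpose :: "nat \<Rightarrow> 'k :: field mat \<Rightarrow> 'k mat \<Rightarrow> 'k mat" where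
  "twisted_inv_transpose n A g = A * transpose_mat (inv\<^bsub>GL n\<^esub> g) * inv\<^bsub>GL n\<^esub> A"

definition \<sigma>_aut :: "nat \<Rightarrow> 'k :: field mat \<Rightarrow> 'k mat" where
  "\<sigma>_aut n = twisted_inv_transpose n (script_J n)"

definition \<sigma>'_aut :: "nat \<Rightarrow> 'k :: field mat \<Rightarrow> 'k mat" where
  "\<sigma>'_aut n = twisted_inv_transpose n (anti_id n)"

text \<open>The semidirect product of \<open>GL\<^sub>n\<close> with the group of order two generated by an involutive
  automorphism \<open>\<tau>\<close>; the pair \<open>(g, b)\<close> stands for \<open>g \<tau>\<close> if \<open>b\<close> holds and for \<open>g\<close> otherwise.\<close>

definition Gbar :: "nat \<Rightarrow> ('k :: field mat \<Rightarrow> 'k mat) \<Rightarrow> ('k mat \<times> bool) monoid" where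
  "Gbar n \<tau> =
     \<lparr>carrier = carrier (GL n) \<times> UNIV,
      mult = (\<lambda>(g, b) (h, c). (g \<otimes>\<^bsub>GL n\<^esub> (if b then \<tau> h else h), b \<noteq> c)),
      one = (\<one>\<^bsub>GL n\<^esub>, False)\<rparr>"

definition emb :: "'k :: field mat \<Rightarrow> 'k mat \<times> bool" where
  "emb g = (g, False)"

text \<open>The two admissible choices of \<open>\<tau>\<close> together with the element of \<open>Gbar n \<tau>\<close> called \<open>\<sigma>\<close>:
  the generator of the second factor if \<open>\<tau> = \<sigma>\<close>, and \<open>t\<^sub>0\<sigma>'\<close> if \<open>n\<close> is even and \<open>\<tau> = \<sigma>'\<close>.\<close>

definition admissible_extension ::
  "nat \<Rightarrow> ('k :: field mat \<Rightarrow> 'k mat) \<Rightarrow> 'k mat \<times> bool \<Rightarrow> bool" where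
  "admissible_extension n \<tau> s \<longleftrightarrow>
     \<tau> = \<sigma>_aut n \<and> s = (1\<^sub>m n, True) \<or>
     even n \<and> \<tau> = \<sigma>'_aut n \<and> s = (t0 n, True)"

text \<open>In both cases this fixes \<open>\<sigma>\<close>, because \<open>t\<^sub>0\<close> has entries in the prime field.\<close>

definition Frob :: "nat \<Rightarrow> 'k :: field mat \<times> bool \<Rightarrow> 'k mat \<times> bool" where
  "Frob q x = (map_mat (\<lambda>a. a ^ q) (fst x), snd x)"

definition conj_by ::
  "nat \<Rightarrow> ('k :: field mat \<Rightarrow> 'k mat) \<Rightarrow> 'k mat \<times> bool \<Rightarrow> 'k mat \<times> bool \<Rightarrow> 'k mat \<times> bool" where
  "conj_by n \<tau> x y = x \<otimes>\<^bsub>Gbar n \<tau>\<^esub> y \<otimes>\<^bsub>Gbar n \<tau>\<^esub> inv\<^bsub>Gbar n \<tau>\<^esub> x"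

definition quasi_semisimple ::
  "nat \<Rightarrow> ('k :: field mat \<Rightarrow> 'k mat) \<Rightarrow> 'k mat \<times> bool \<Rightarrow> bool" where
  "quasi_semisimple n \<tau> x \<longleftrightarrow> x \<in> carrier (Gbar n \<tau>) \<and>
     (\<exists>T B. maximal_torus n T \<and> borel_subgroup n B \<and> T \<subseteq> B \<and>
        conj_by n \<tau> x ` (emb ` T) = emb ` T \<and> conj_by n \<tau> x ` (emb ` B) = emb ` B)"

definition G_class ::
  "nat \<Rightarrow> ('k :: field mat \<Rightarrow> 'k mat) \<Rightarrow> 'k mat \<times> bool \<Rightarrow> ('k mat \<times> bool) set" where
  "G_class n \<tau> x = {conj_by n \<tau> (emb h) x | h. h \<in> carrier (GL n)}"

definition G_coset ::
  "nat \<Rightarrow> ('k :: field mat \<Rightarrow> 'k mat) \<Rightarrow> 'k mat \<times> bool \<Rightarrow> ('k mat \<times> bool) set" where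
  "G_coset n \<tau> s = {emb g \<otimes>\<^bsub>Gbar n \<tau>\<^esub> s | g. g \<in> carrier (GL n)}"

definition stable_qss_classes ::
  "nat \<Rightarrow> nat \<Rightarrow> ('k :: field mat \<Rightarrow> 'k mat) \<Rightarrow> 'k mat \<times> bool \<Rightarrow> ('k mat \<times> bool) set set" where
  "stable_qss_classes n q \<tau> s =
     {C. (\<exists>x. quasi_semisimple n \<tau> x \<and> C = G_class n \<tau> x) \<and> C \<subseteq> G_coset n \<tau> s \<and> Frob q ` C = C}"


section \<open>The combinatorial data\<close>

definition hat :: "'k :: field \<Rightarrow> 'k set" where
  "hat a = {a, - a, inverse a, - inverse a}"

definition khat :: "'k :: field set set" where
  "khat = hat ` (- {0})"

text \<open>\<open>hat_frob q (hat a) = hat (a ^ q)\<close> for odd \<open>q\<close>.\<close>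

definition hat_frob :: "nat \<Rightarrow> 'k :: field set \<Rightarrow> 'k set" where
  "hat_frob q A = (\<lambda>a. a ^ q) ` A"

text \<open>Every element of \<open>khat\<close> has finite order under the Frobenius when the ground field is
  algebraic over a finite field, so the forward iterates already form the full orbit and the orbit
  is finite.\<close>

definition hat_orbits :: "nat \<Rightarrow> 'k :: field set set set" where
  "hat_orbits q = (\<lambda>A. {(hat_frob q ^^ m) A | m. True}) ` khat"

text \<open>A datum \<open>n\<^sub>+ n\<^sub>- (n\<^sub>i, \<alpha>\<^sub>i)\<^sub>i\<^sub>\<in>\<^sub>\<Lambda>\<close>. Up to renaming of indices, \<open>\<Lambda>\<close> is a finite set of natural
  numbers; the values of the two families outside \<open>\<Lambda>\<close> are irrelevant and are forgotten by
  \<open>datum_rel\<close>.\<close>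

datatype 'k datum =
  Datum (n_plus: nat) (n_minus: nat) (index_set: "nat set") (part: "nat \<Rightarrow> nat")
    (orb: "nat \<Rightarrow> 'k set set")

definition data :: "nat \<Rightarrow> nat \<Rightarrow> 'k :: field \<Rightarrow> 'k datum set" where
  "data n q \<iota> = {d. finite (index_set d) \<and> n_plus d mod 2 = n mod 2 \<and>
     (\<forall>i\<in>index_set d. part d i > 0) \<and>
     (\<forall>i\<in>index_set d. orb d i \<in> hat_orbits q - {{hat 1}, {hat \<iota>}}) \<and>
     inj_on (orb d) (index_set d) \<and>
     n_plus d + n_minus d + (\<Sum>i\<in>index_set d. 2 * part d i * card (orb d i)) = n}"

definition datum_rel :: "nat \<Rightarrow> nat \<Rightarrow> 'k :: field \<Rightarrow> ('k datum \<times> 'k datum) set" where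
  "datum_rel n q \<iota> = {(d, e). d \<in> data n q \<iota> \<and> e \<in> data n q \<iota> \<and>
     n_plus d = n_plus e \<and> n_minus d = n_minus e \<and>
     (\<exists>f. bij_betw f (index_set d) (index_set e) \<and>
        (\<forall>i\<in>index_set d. part e (f i) = part d i \<and> orb e (f i) = orb d i))}"

definition T_C_s :: "nat \<Rightarrow> nat \<Rightarrow> 'k :: field \<Rightarrow> 'k datum set set" where
  "T_C_s n q \<iota> = data n q \<iota> // datum_rel n q \<iota>"

lemma equiv_datum_rel: "equiv (data n q \<iota>) (datum_rel n q \<iota>)"
proof (rule equivI)
  show "datum_rel n q \<iota> \<subseteq> data n q \<iota> \<times> data n q \<iota>"
    by (auto simp: datum_rel_def)
  show "refl_on (data n q \<iota>) (datum_rel n q \<iota>)"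
    by (auto simp: refl_on_def datum_rel_def intro!: exI[of _ id])
  show "sym (datum_rel n q \<iota>)"
  proof (rule symI)
    fix d e assume "(d, e) \<in> datum_rel n q \<iota>"
    then obtain f where f: "bij_betw f (index_set d) (index_set e)"
      "\<forall>i\<in>index_set d. part e (f i) = part d i \<and> orb e (f i) = orb d i"
      and *: "d \<in> data n q \<iota>" "e \<in> data n q \<iota>" "n_plus d = n_plus e" "n_minus d = n_minus e"
      by (auto simp: datum_rel_def)
    let ?g = "inv_into (index_set d) f"
    have "bij_betw ?g (index_set e) (index_set d)"
      using f(1) by (rule bij_betw_inv_into)
    moreover have "\<forall>i\<in>index_set e. part d (?g i) = part e i \<and> orb d (?g i) = orb e i"
      using f by (metis bij_betw_def bij_betw_inv_into_right inv_into_into)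
    ultimately show "(e, d) \<in> datum_rel n q \<iota>"
      using * by (auto simp: datum_rel_def)
  qed
  show "trans (datum_rel n q \<iota>)"
  proof (rule transI)
    fix d e h assume "(d, e) \<in> datum_rel n q \<iota>" "(e, h) \<in> datum_rel n q \<iota>"
    then obtain f g where f: "bij_betw f (index_set d) (index_set e)"
      "\<forall>i\<in>index_set d. part e (f i) = part d i \<and> orb e (f i) = orb d i"
      and g: "bij_betw g (index_set e) (index_set h)"
      "\<forall>i\<in>index_set e. part h (g i) = part e i \<and> orb h (g i) = orb e i"
      and *: "d \<in> data n q \<iota>" "h \<in> data n q \<iota>" "n_plus d = n_plus h" "n_minus d = n_minus h"
      by (auto simp: datum_rel_def)
    have "bij_betw (g \<circ> f) (index_set d) (index_set h)"
      using f(1) g(1) by (rule bij_betw_trans)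
    moreover have "\<forall>i\<in>index_set d. part h ((g \<circ> f) i) = part d i \<and> orb h ((g \<circ> f) i) = orb d i"
      using f(2) g(2) bij_betwE[OF f(1)] by simp
    ultimately show "(d, h) \<in> datum_rel n q \<iota>"
      using * by (auto simp: datum_rel_def)
  qed
qed

end

theory Submission
  imports Defs "HOL-Combinatorics.Permutations"
begin

text \<open>
  An element \<open>g \<sigma>\<close> of the coset is recorded by the Gram matrix \<open>A = g J\<close> of a nondegenerate
  bilinear form, where \<open>J\<close> is the matrix that defines the automorphism. Conjugation by \<open>h\<close> replaces
  \<open>A\<close> by \<open>h A h\<^sup>T\<close>, and \<open>g \<sigma>\<close> acts on \<open>GL\<^sub>n\<close> by \<open>X \<mapsto> A X\<^sup>-\<^sup>T A\<^sup>-\<^sup>1\<close>. The classes are therefore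
  congruence classes of forms.

  The element stabilises a maximal torus and a Borel subgroup containing it if and only if its form
  is congruent to an antidiagonal matrix. Indeed all maximal tori are conjugate to the group of
  diagonal matrices (\<open>maximal_torus_conj_diag\<close>), a Borel subgroup containing the diagonal matrices
  consists of the matrices that are triangular for some ordering of the basis
  (\<open>connected_solvable_imp_triangular\<close>), and a form whose automorphism preserves both permutes the
  coordinates and reverses that ordering (\<open>normalizing_form_reverses\<close>). Over the algebraic closure
  of a finite field every invertible matrix has finite order (\<open>GL_torsion\<close>), which makes both
  structural facts elementary: a torus is a commuting family of elements of order prime to the
  characteristic, hence simultaneously diagonalisable, and in the proof of the Lie-Kolchin theorem
  the characters that occur take values in the roots of unity of a fixed order, so that they are
  constant on connected sets.

  If \<open>A\<close> is antidiagonal with entries \<open>a\<^sub>i\<close>, then \<open>A = diag(r\<^sub>i) A\<^sup>T\<close> with \<open>r\<^sub>i = a\<^sub>i / a\<^sub>n\<^sub>+\<^sub>1\<^sub>-\<^sub>i\<close>. The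
  ratios \<open>r\<^sub>i\<close> and \<open>r\<^sub>n\<^sub>+\<^sub>1\<^sub>-\<^sub>i\<close> are inverse to each other, and the multiset of the \<open>n div 2\<close> unordered
  pairs \<open>{r, 1/r}\<close> is a complete invariant of the congruence class
  (\<open>congruent_imp_ratio_classes_eq\<close>, \<open>ratio_classes_eq_imp_congruent\<close>). Taking square roots turns
  such a pair into an element of \<open>khat\<close>. The Frobenius acts on the invariants through \<open>hat_frob\<close>,
  so the stable classes correspond to the multisets of size \<open>n div 2\<close> in \<open>khat\<close> that are stable
  under \<open>hat_frob\<close> (\<open>stable_classes_bij_stable_multisets\<close>).

  Such a multiset is constant on Frobenius orbits. Its multiplicities on \<open>{hat 1}\<close> and \<open>{hat \<iota>}\<close>
  are \<open>n\<^sub>+ div 2\<close> and \<open>n\<^sub>- div 2\<close>, those on the remaining orbits are the \<open>n\<^sub>i\<close>, and the parity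
  condition recovers \<open>n\<^sub>+\<close> and \<open>n\<^sub>-\<close> from their halves (\<open>data_classes_bij_stable_multisets\<close>).
\<close>


section \<open>Invertible matrices\<close>

lemma carrier_GL: "g \<in> carrier (GL n) \<longleftrightarrow> g \<in> carrier_mat n n \<and> det g \<noteq> 0"
  for g :: "'k :: field mat"
proof
  assume "g \<in> carrier (GL n)"
  then have *: "g \<in> Units (ring_mat TYPE('k) n ())"
    by (simp add: GL_def units_of_carrier)
  then show "g \<in> carrier_mat n n \<and> det g \<noteq> 0"
    using unit_imp_det_non_zero[OF *] by (simp add: Units_def ring_mat_simps)
next
  assume "g \<in> carrier_mat n n \<and> det g \<noteq> 0"
  then show "g \<in> carrier (GL n)"
    using det_non_zero_imp_unit[of g n "()"] by (simp add: GL_def units_of_carrier)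
qed

abbreviation ginv :: "nat \<Rightarrow> 'k :: field mat \<Rightarrow> 'k mat" where
  "ginv n x \<equiv> inv\<^bsub>GL n\<^esub> x"

lemma mult_GL [simp]: "x \<otimes>\<^bsub>GL n\<^esub> y = x * y"
  by (simp add: GL_def units_of_mult ring_mat_simps)

lemma one_GL [simp]: "\<one>\<^bsub>GL n\<^esub> = 1\<^sub>m n"
  by (simp add: GL_def units_of_one ring_mat_simps)

lemma group_GL: "group (GL n :: 'k :: field mat monoid)"
proof -
  interpret R: semiring "ring_mat TYPE('k) n ()" by (rule semiring_mat)
  show ?thesis unfolding GL_def by (rule R.units_group)
qed

interpretation GL: group "GL n :: 'k :: field mat monoid" for n
  by (rule group_GL)

lemma GL_dim [dest]: "g \<in> carrier (GL n) \<Longrightarrow> g \<in> carrier_mat n n"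
  by (simp add: carrier_GL)

lemmas GL_simps [simp] = GL.l_inv[simplified] GL.r_inv[simplified] GL.m_closed[simplified]
  GL.l_one[simplified] GL.r_one[simplified] GL.one_closed[simplified]

lemmas GL_assoc = GL.m_assoc[simplified]
lemmas GL_inv_mult = GL.inv_mult_group[simplified]

lemma GL_inv_cancel [simp]:
  assumes "x \<in> carrier (GL n)" "y \<in> carrier (GL n)"
  shows "x * (ginv n x * y) = y" "ginv n x * (x * y) = y"
    "y * x * ginv n x = y" "y * ginv n x * x = y"
proof -
  have "x * (ginv n x * y) = x * ginv n x * y"
    "ginv n x * (x * y) = ginv n x * x * y"
    "y * x * ginv n x = y * (x * ginv n x)"
    "y * ginv n x * x = y * (ginv n x * x)"
    using assms by (simp_all only: GL_assoc[where n = n] GL.inv_closed)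
  then show "x * (ginv n x * y) = y" "ginv n x * (x * y) = y"
    "y * x * ginv n x = y" "y * ginv n x * x = y"
    using assms by simp_all
qed

lemma GL_inv_eqI:
  assumes "x \<in> carrier (GL n)" "y \<in> carrier (GL n)" "x * y = 1\<^sub>m n"
  shows "ginv n x = y"
proof -
  have "y * x = 1\<^sub>m n"
    by (rule mat_mult_left_right_inverse[OF _ _ assms(3)]) (use assms in auto)
  then show ?thesis by (intro GL.inv_equality) (use assms in auto)
qed

lemma mat_mult_entry:
  assumes "g \<in> carrier_mat n n" "h \<in> carrier_mat n n" "i < n" "j < n"
  shows "(g * h) $$ (i, j) = (\<Sum>m<n. g $$ (i, m) * h $$ (m, j))"
  using assms by (auto simp: scalar_prod_def atLeast0LessThan intro!: sum.cong)

lemma transpose_GL [simp]: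
  "g \<in> carrier (GL n) \<Longrightarrow> transpose_mat g \<in> carrier (GL n)"
  by (auto simp: carrier_GL det_transpose)

lemma transpose_mult_GL:
  "g \<in> carrier (GL n) \<Longrightarrow> h \<in> carrier (GL n) \<Longrightarrow>
     transpose_mat (g * h) = transpose_mat h * transpose_mat g"
  by (rule transpose_mult) (auto simp: carrier_GL)

lemma inv_transpose_GL:
  assumes "g \<in> carrier (GL n)"
  shows "ginv n (transpose_mat g) = transpose_mat (ginv n g)"
  using assms
  by (intro GL_inv_eqI) (auto simp: transpose_mult_GL[where n = n, symmetric])

lemma mat_diag_GL [simp]:
  "mat_diag n f \<in> carrier (GL n) \<longleftrightarrow> (\<forall>i<n. f i \<noteq> (0 :: 'k :: field))"
proof -
  have "det (mat_diag n f) = (\<Prod>i<n. f i)"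
    by (subst det_upper_triangular[of _ n])
       (auto simp: mat_diag_def upper_triangular_def prod_list_diag_prod atLeast0LessThan)
  then show ?thesis by (auto simp: carrier_GL)
qed

lemma diag_groupI: "\<forall>i<n. f i \<noteq> 0 \<Longrightarrow> mat_diag n f \<in> diag_group n"
  by (auto simp only: diag_group_def mem_Collect_eq mat_diag_GL)
     (auto simp: diagonal_mat_def mat_diag_def)

lemma diag_groupE:
  assumes "d \<in> diag_group n"
  obtains f where "d = mat_diag n f" "\<forall>i<n. f i \<noteq> 0"
proof -
  have d: "d \<in> carrier (GL n)" "diagonal_mat d" using assms by (auto simp: diag_group_def)
  then have *: "d = mat_diag n (\<lambda>i. d $$ (i, i))"
    by (auto simp: carrier_GL mat_diag_def diagonal_mat_def intro!: eq_matI)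
  with d(1) have "\<forall>i<n. d $$ (i, i) \<noteq> 0" by (metis mat_diag_GL)
  with * show ?thesis by (rule that)
qed

lemma inv_mat_diag:
  assumes "\<forall>i<n. f i \<noteq> (0 :: 'k :: field)"
  shows "ginv n (mat_diag n f) = mat_diag n (\<lambda>i. inverse (f i))"
proof (rule GL_inv_eqI)
  show "mat_diag n f * mat_diag n (\<lambda>i. inverse (f i)) = 1\<^sub>m n"
    unfolding mat_diag_diag using assms by (auto simp: mat_diag_def)
qed (use assms in auto)

lemma mat_diag_conj_entry:
  assumes "\<forall>i<n. f i \<noteq> (0 :: 'k :: field)" "g \<in> carrier (GL n)" "i < n" "j < n"
  shows "(mat_diag n f * g * ginv n (mat_diag n f)) $$ (i, j) = f i * g $$ (i, j) / f j"
proof -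
  have "mat_diag n f * g = mat n n (\<lambda>(i, j). f i * g $$ (i, j))"
    using assms by (intro mat_diag_mult_left) auto
  then have "mat_diag n f * g * ginv n (mat_diag n f) =
      mat n n (\<lambda>(i, j). mat n n (\<lambda>(i, j). f i * g $$ (i, j)) $$ (i, j) * inverse (f j))"
    unfolding inv_mat_diag[OF assms(1)] by (simp add: mat_diag_mult_right[of _ n])
  then show ?thesis using assms by (simp add: divide_inverse)
qed

section \<open>Elements of finite order\<close>

lemma closure_power:
  assumes "algebraic_closure_of_Fq p q TYPE('k :: alg_closed_field)"
  shows "CHAR('k) = p" "prime p" "q > 1"
    and power_q_add: "(a + b :: 'k) ^ (q ^ m) = a ^ (q ^ m) + b ^ (q ^ m)"
    and power_q_sum: "(\<Sum>i\<in>A. f i :: 'k) ^ (q ^ m) = (\<Sum>i\<in>A. f i ^ (q ^ m))"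
proof -
  obtain e where e: "e > 0" "q = p ^ e" and p: "prime p" "CHAR('k) = p"
    using assms by (auto simp: algebraic_closure_of_Fq_def)
  show "CHAR('k) = p" "prime p" using p by auto
  show "q > 1" using e one_less_power[OF prime_gt_1_nat[OF p(1)] e(1)] by simp
  show "(a + b) ^ (q ^ m) = a ^ (q ^ m) + b ^ (q ^ m)"
    using freshmans_dream'[of "q ^ m" "e * m" a b] e p by (simp add: power_mult)
  show "(\<Sum>i\<in>A. f i) ^ (q ^ m) = (\<Sum>i\<in>A. f i ^ (q ^ m))"
    using freshmans_dream_sum'[of "q ^ m" "e * m" f A] e p by (simp add: power_mult)
qed

lemma power_q_inj:
  assumes "algebraic_closure_of_Fq p q TYPE('k :: alg_closed_field)"
    and "(a :: 'k) ^ (q ^ m) = b ^ (q ^ m)"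
  shows "a = b"
proof -
  have "(a - b) ^ (q ^ m) + b ^ (q ^ m) = a ^ (q ^ m)"
    using power_q_add[OF assms(1), of "a - b" b m] by simp
  with assms(2) have "(a - b) ^ (q ^ m) = 0" by simp
  then show ?thesis by auto
qed

text \<open>The iterates of \<open>x\<close> under the Frobenius are roots of every polynomial over the field with
  \<open>q\<close> elements that has \<open>x\<close> as a root, so two of them coincide.\<close>

lemma exists_power_q_fixed:
  assumes "algebraic_closure_of_Fq p q TYPE('k :: alg_closed_field)" 
  shows "\<exists>m>0. (x :: 'k) ^ (q ^ m) = x"
proof -
  note alg = assms
  obtain P where P: "P \<noteq> 0" "\<forall>i. coeff P i \<in> Fq q" "poly P x = 0"
    using assms unfolding algebraic_closure_of_Fq_def algebraic_over_def by blast
  have root: "poly P (x ^ (q ^ j)) = 0" for j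
  proof (induction j)
    case (Suc j)
    let ?y = "x ^ (q ^ j)"
    have "0 = poly P ?y ^ (q ^ 1)"
      using Suc closure_power(3)[OF alg] by simp
    also have "\<dots> = (\<Sum>i\<le>degree P. (coeff P i * ?y ^ i) ^ (q ^ 1))"
      unfolding poly_altdef by (rule power_q_sum[OF alg])
    also have "\<dots> = poly P (?y ^ q)"
      using P(2) by (auto simp: poly_altdef Fq_def power_mult_distrib power_mult[symmetric] mult_ac intro!: sum.cong)
    finally show ?case by (simp add: power_mult[symmetric] mult.commute)
  qed (use P in simp)
  then have "finite (range (\<lambda>j. x ^ (q ^ j)))"
    by (intro finite_subset[OF _ poly_roots_finite[OF P(1)]]) auto
  then have "\<not> inj (\<lambda>j. x ^ (q ^ j))"
    using finite_imageD infinite_UNIV_nat by blast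
  then obtain i j where "i < j" "x ^ (q ^ i) = x ^ (q ^ j)"
    by (metis injI linorder_neqE_nat)
  moreover from this have "x ^ (q ^ j) = (x ^ (q ^ (j - i))) ^ (q ^ i)"
    by (simp add: power_mult[symmetric] power_add[symmetric])
  ultimately have "x ^ (q ^ (j - i)) = x"
    using power_q_inj[OF alg, of x i "x ^ (q ^ (j - i))"] by simp
  with \<open>i < j\<close> show ?thesis by (intro exI[of _ "j - i"]) simp
qed

lemma power_q_fixed_mult:
  fixes x :: "'k :: monoid_mult"
  assumes "x ^ (q ^ m) = x"
  shows "x ^ (q ^ (m * l)) = x"
proof (induction l)
  case (Suc l)
  have "x ^ (q ^ (m * Suc l)) = (x ^ (q ^ m)) ^ (q ^ (m * l))"
    by (simp add: power_mult[symmetric] power_add[symmetric])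
  with Suc assms show ?case by simp
qed simp

lemma exists_power_q_fixed_finite:
  assumes "algebraic_closure_of_Fq p q TYPE('k :: alg_closed_field)" "finite (X :: 'k set)"
  shows "\<exists>m>0. \<forall>x\<in>X. x ^ (q ^ m) = x"
  using assms(2)
proof (induction rule: finite_induct)
  case (insert x X)
  obtain m l where m: "m > 0" "\<forall>x\<in>X. x ^ (q ^ m) = x" and l: "l > 0" "x ^ (q ^ l) = x"
    using insert.IH exists_power_q_fixed[OF assms(1)] by blast
  with power_q_fixed_mult[of _ q m l] power_q_fixed_mult[of x q l m] show ?case
    by (intro exI[of _ "m * l"]) (auto simp: mult.commute)
qed auto

lemma power_fixed_imp_torsion:
  fixes x :: "'k :: field"
  assumes "x ^ Q = x" "x \<noteq> 0" "Q > 0"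
  shows "x ^ (Q - 1) = 1"
  using assms by (cases Q) auto

lemma finite_roots_of_unity:
  assumes "N > 0"
  shows "finite {x :: 'k :: field. x ^ N = 1}"
proof -
  have "coeff (monom (1 :: 'k) N - 1) N = 1" using assms by simp
  then have "monom (1 :: 'k) N - 1 \<noteq> 0" by (metis coeff_0 zero_neq_one)
  from poly_roots_finite[OF this] show ?thesis by (simp add: poly_monom)
qed

text \<open>The powers of \<open>g\<close> have their entries in the finite field generated by the entries of \<open>g\<close>, so
  two of them coincide.\<close>

lemma GL_torsion:
  assumes alg: "algebraic_closure_of_Fq p q TYPE('k :: alg_closed_field)"
    and g: "(g :: 'k mat) \<in> carrier (GL n)"
  shows "\<exists>N>0::nat. g [^]\<^bsub>GL n\<^esub> N = 1\<^sub>m n"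
proof -
  let ?X = "(\<lambda>(i, j). g $$ (i, j)) ` ({..<n} \<times> {..<n})"
  obtain m where m: "m > 0" "\<forall>x\<in>?X. x ^ (q ^ m) = x"
    using exists_power_q_fixed_finite[OF alg, of ?X] by auto
  let ?Q = "q ^ m"
  have Q: "?Q > 0" using closure_power(3)[OF alg] by simp
  let ?K = "{x :: 'k. x ^ ?Q = x}"
  have "?K = {x. poly (monom 1 ?Q - monom 1 1) x = 0}" by (auto simp: poly_monom)
  moreover have "monom (1 :: 'k) ?Q - monom 1 1 \<noteq> 0"
  proof -
    have "coeff (monom (1 :: 'k) Q - monom 1 1) 1 \<noteq> 0" if "Q > 1" for Q using that by simp
    from this[OF one_less_power[OF closure_power(3)[OF alg] m(1)]]
    show ?thesis by (metis coeff_0)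
  qed
  ultimately have finK: "finite ?K" using poly_roots_finite by metis
  let ?S = "{h \<in> carrier_mat n n. \<forall>i<n. \<forall>j<n. h $$ (i, j) \<in> ?K}"
  have finS: "finite ?S"
  proof (rule finite_subset)
    show "?S \<subseteq> (\<lambda>f. mat n n f) ` (({..<n} \<times> {..<n}) \<rightarrow>\<^sub>E ?K)"
    proof
      fix h assume h: "h \<in> ?S"
      then have "h = mat n n (restrict (\<lambda>(i, j). h $$ (i, j)) ({..<n} \<times> {..<n}))"
        by (intro eq_matI) auto
      moreover have "restrict (\<lambda>(i, j). h $$ (i, j)) ({..<n} \<times> {..<n}) \<in> ({..<n} \<times> {..<n}) \<rightarrow>\<^sub>E ?K"
        using h by (intro restrict_PiE_iff[THEN iffD2]) auto
      ultimately show "h \<in> (\<lambda>f. mat n n f) ` (({..<n} \<times> {..<n}) \<rightarrow>\<^sub>E ?K)"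
        by (rule image_eqI)
    qed
    show "finite ((\<lambda>f. mat n n f) ` (({..<n} \<times> {..<n}) \<rightarrow>\<^sub>E ?K))"
      using finK by (intro finite_imageI finite_PiE) auto
  qed
  have pow: "g [^]\<^bsub>GL n\<^esub> (l :: nat) \<in> ?S" for l
  proof (induction l)
    case 0
    then show ?case using Q by auto
  next
    case (Suc l)
    let ?h = "g [^]\<^bsub>GL n\<^esub> l"
    have "(?h * g) $$ (i, j) ^ ?Q = (?h * g) $$ (i, j)" if "i < n" "j < n" for i j
    proof -
      have "(?h * g) $$ (i, j) ^ ?Q = (\<Sum>r<n. (?h $$ (i, r) * g $$ (r, j)) ^ ?Q)"
        using that g Suc by (subst mat_mult_entry[of _ n]) (auto intro: power_q_sum[OF alg])
      also have "\<dots> = (\<Sum>r<n. ?h $$ (i, r) * g $$ (r, j))"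
        using that Suc m(2) by (intro sum.cong) (auto simp: power_mult_distrib)
      finally show ?thesis using that g Suc by (subst (2) mat_mult_entry[of _ n]) auto
    qed
    then show ?case using Suc g by auto
  qed
  have "finite (range (\<lambda>l. g [^]\<^bsub>GL n\<^esub> (l :: nat)))"
    by (rule finite_subset[OF _ finS]) (intro image_subsetI pow)
  then have "\<not> inj (\<lambda>l. g [^]\<^bsub>GL n\<^esub> (l :: nat))"
    using finite_imageD infinite_UNIV_nat by blast
  then obtain i j :: nat where "i < j" "g [^]\<^bsub>GL n\<^esub> i = g [^]\<^bsub>GL n\<^esub> j"
    by (metis injI linorder_neqE_nat)
  then have "g [^]\<^bsub>GL n\<^esub> (j - i) = 1\<^sub>m n"
    using GL.pow_eq_div2[OF g, of j i] by simp
  with \<open>i < j\<close> show ?thesis by (intro exI[of _ "j - i"]) simp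
qed


section \<open>Regular functions on connected sets\<close>

text \<open>A regular function need only be given by an element of \<open>regular_funs\<close> on the invertible
  matrices; this allows inverses of matrices in formulas for regular functions.\<close>

definition regular_on :: "nat \<Rightarrow> ('k :: field mat \<Rightarrow> 'k) \<Rightarrow> bool" where
  "regular_on n f \<longleftrightarrow> (\<exists>f'\<in>regular_funs n. \<forall>g\<in>carrier (GL n). f g = f' g)"

lemma regular_on_regular: "f \<in> regular_funs n \<Longrightarrow> regular_on n f"
  by (auto simp: regular_on_def)

lemma regular_on_const [intro, simp]: "regular_on n (\<lambda>_. c)"
  by (intro regular_on_regular regular_funs.const)

lemma regular_on_entry [intro, simp]: "i < n \<Longrightarrow> j < n \<Longrightarrow> regular_on n (\<lambda>g. g $$ (i, j))"
  by (intro regular_on_regular regular_funs.entry)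

lemma regular_on_inv_det [intro, simp]: "regular_on n (\<lambda>g. inverse (det g))"
  by (intro regular_on_regular regular_funs.inv_det)

lemma regular_on_add [intro]:
  "regular_on n f \<Longrightarrow> regular_on n h \<Longrightarrow> regular_on n (\<lambda>g. f g + h g)"
  unfolding regular_on_def
proof (elim bexE)
  fix f' h' assume "f' \<in> regular_funs n" "h' \<in> regular_funs n"
    "\<forall>g\<in>carrier (GL n). f g = f' g" "\<forall>g\<in>carrier (GL n). h g = h' g"
  then show "\<exists>k\<in>regular_funs n. \<forall>g\<in>carrier (GL n). f g + h g = k g"
    by (intro bexI[of _ "\<lambda>g. f' g + h' g"] regular_funs.add) auto
qed

lemma regular_on_mult [intro]:
  "regular_on n f \<Longrightarrow> regular_on n h \<Longrightarrow> regular_on n (\<lambda>g. f g * h g)"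
  unfolding regular_on_def
proof (elim bexE)
  fix f' h' assume "f' \<in> regular_funs n" "h' \<in> regular_funs n"
    "\<forall>g\<in>carrier (GL n). f g = f' g" "\<forall>g\<in>carrier (GL n). h g = h' g"
  then show "\<exists>k\<in>regular_funs n. \<forall>g\<in>carrier (GL n). f g * h g = k g"
    by (intro bexI[of _ "\<lambda>g. f' g * h' g"] regular_funs.mult) auto
qed

lemma regular_on_diff [intro]:
  assumes "regular_on n f" "regular_on n h" shows "regular_on n (\<lambda>g. f g - h g)"
  using regular_on_add[OF assms(1) regular_on_mult[OF regular_on_const assms(2)], of "-1"] by simp

lemma regular_on_sum [intro]:
  "(\<And>a. a \<in> A \<Longrightarrow> regular_on n (f a)) \<Longrightarrow> regular_on n (\<lambda>g. \<Sum>a\<in>A. f a g)"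
  by (induction A rule: infinite_finite_induct) auto

lemma regular_on_prod [intro]:
  "(\<And>a. a \<in> A \<Longrightarrow> regular_on n (f a)) \<Longrightarrow> regular_on n (\<lambda>g. \<Prod>a\<in>A. f a g)"
  by (induction A rule: infinite_finite_induct) auto

lemma regular_on_cong:
  "regular_on n f \<Longrightarrow> (\<And>g. g \<in> carrier (GL n) \<Longrightarrow> f g = h g) \<Longrightarrow> regular_on n h"
  unfolding regular_on_def by auto

lemma regular_on_det:
  assumes "\<And>g. M g \<in> carrier_mat r r"
    and "\<And>i j. i < r \<Longrightarrow> j < r \<Longrightarrow> regular_on n (\<lambda>g. M g $$ (i, j))"
  shows "regular_on n (\<lambda>g. det (M g))"
  unfolding det_def'[OF assms(1)]
  by (intro regular_on_sum regular_on_mult regular_on_prod regular_on_const assms(2))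
     (auto dest: permutes_in_image)

text \<open>Regular functions pull back to regular functions along such maps. Since the inverse of the
  determinant is a coordinate function, it needs a clause of its own.\<close>

definition reg_map :: "nat \<Rightarrow> ('k :: field mat \<Rightarrow> 'k mat) \<Rightarrow> bool" where
  "reg_map n \<phi> \<longleftrightarrow> (\<forall>g\<in>carrier (GL n). \<phi> g \<in> carrier (GL n)) \<and>
     (\<forall>i<n. \<forall>j<n. regular_on n (\<lambda>g. \<phi> g $$ (i, j))) \<and>
     regular_on n (\<lambda>g. inverse (det (\<phi> g)))"

lemma reg_map_compose:
  assumes \<phi>: "reg_map n \<phi>" and "regular_on n f"
  shows "regular_on n (\<lambda>g. f (\<phi> g))"
proof -
  have "regular_on n (\<lambda>g. f' (\<phi> g))" if "f' \<in> regular_funs n" for f'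
    using that
    by induction (use \<phi> in \<open>auto simp: reg_map_def\<close>)
  moreover obtain f' where f': "f' \<in> regular_funs n" "\<forall>g\<in>carrier (GL n). f g = f' g"
    using assms(2) by (auto simp: regular_on_def)
  ultimately show ?thesis
    using \<phi> regular_on_cong[of n "\<lambda>g. f' (\<phi> g)" "\<lambda>g. f (\<phi> g)"] by (auto simp: reg_map_def)
qed

lemma reg_map_const [simp]: "a \<in> carrier (GL n) \<Longrightarrow> reg_map n (\<lambda>_. a)"
  by (auto simp: reg_map_def)

lemma reg_map_id [simp]: "reg_map n (\<lambda>g. g)"
  by (auto simp: reg_map_def)

lemma det_mult_GL: 
  "g \<in> carrier (GL n) \<Longrightarrow> h \<in> carrier (GL n) \<Longrightarrow> det (g * h) = det g * det h"
  by (intro det_mult) auto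

lemma reg_map_mult:
  assumes "reg_map n \<phi>" "reg_map n \<psi>"
  shows "reg_map n (\<lambda>g. \<phi> g * \<psi> g)"
  unfolding reg_map_def
proof (intro conjI allI impI ballI)
  fix i j assume "i < n" "j < n"
  with assms show "regular_on n (\<lambda>g. (\<phi> g * \<psi> g) $$ (i, j))"
    by (intro regular_on_cong[where h = "\<lambda>g. (\<phi> g * \<psi> g) $$ (i, j)",
          of n "\<lambda>g. \<Sum>m<n. \<phi> g $$ (i, m) * \<psi> g $$ (m, j)"] regular_on_sum regular_on_mult)
       (auto simp: reg_map_def mat_mult_entry[OF GL_dim GL_dim])
next
  show "regular_on n (\<lambda>g. inverse (det (\<phi> g * \<psi> g)))"
    using assms
    by (intro regular_on_cong[where h = "\<lambda>g. inverse (det (\<phi> g * \<psi> g))",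
          of n "\<lambda>g. inverse (det (\<phi> g)) * inverse (det (\<psi> g))"] regular_on_mult)
       (auto simp: reg_map_def det_mult_GL)
qed (use assms in \<open>auto simp: reg_map_def\<close>)

lemma inv_GL_adj:
  assumes "g \<in> carrier (GL n)"
  shows "ginv n g = inverse (det g) \<cdot>\<^sub>m adj_mat g"
proof (rule GL_inv_eqI[OF assms])
  have g: "g \<in> carrier_mat n n" "det g \<noteq> 0" using assms by (auto simp: carrier_GL)
  note adj = adj_mat[OF g(1)]
  show *: "g * (inverse (det g) \<cdot>\<^sub>m adj_mat g) = 1\<^sub>m n"
    using g adj by (subst mult_smult_distrib[of _ n n _ n]) (auto simp: adj intro!: eq_matI)
  have "det g * det (inverse (det g) \<cdot>\<^sub>m adj_mat g) = 1"
    using adj by (subst det_mult[symmetric, OF g(1)]) (auto simp: * simp del: det_smult)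
  then show "inverse (det g) \<cdot>\<^sub>m adj_mat g \<in> carrier (GL n)"
    using adj by (auto simp: carrier_GL simp del: det_smult)
qed

lemma reg_map_inv: "reg_map n (\<lambda>g :: 'k :: field mat. ginv n g)"
  unfolding reg_map_def
proof (intro conjI allI impI ballI)
  fix i j assume ij: "i < n" "j < n"
  let ?M = "\<lambda>g. mat (n - 1) (n - 1) (\<lambda>(a, b). g $$ (if a < j then a else Suc a, if b < i then b else Suc b))"
  have "regular_on n (\<lambda>g :: 'k mat. inverse (det g) * ((-1) ^ (j + i) * det (?M g)))"
    using ij by (intro regular_on_mult regular_on_det) auto
  then show "regular_on n (\<lambda>g :: 'k mat. (ginv n g) $$ (i, j))"
  proof (rule regular_on_cong)
    fix g :: "'k mat" assume g: "g \<in> carrier (GL n)"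
    then have "g \<in> carrier_mat n n" by auto
    then show "inverse (det g) * ((-1) ^ (j + i) * det (?M g)) = (ginv n g) $$ (i, j)"
      using ij unfolding inv_GL_adj[OF g] by (simp add: adj_mat_def cofactor_def mat_delete_def)
  qed
next
  have "regular_on n (\<lambda>g :: 'k mat. det g)"
  proof (rule regular_on_cong)
    show "regular_on n (\<lambda>g. det (mat n n (\<lambda>(i, j). g $$ (i, j))))"
      by (intro regular_on_det) auto
    fix g :: "'k mat" assume "g \<in> carrier (GL n)"
    then have "mat n n (\<lambda>(i, j). g $$ (i, j)) = g" by (auto intro!: eq_matI simp: carrier_GL)
    then show "det (mat n n (\<lambda>(i, j). g $$ (i, j))) = det g" by simp
  qed
  then show "regular_on n (\<lambda>g. inverse (det (ginv n g :: 'k mat)))"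
  proof (rule regular_on_cong)
    fix g :: "'k mat" assume g: "g \<in> carrier (GL n)"
    then have "det g * det (ginv n g) = 1"
      by (subst det_mult_GL[symmetric]) auto
    then show "det g = inverse (det (ginv n g))"
      by (metis inverse_unique mult.commute)
  qed
qed auto

text \<open>The consequence of connectedness on which the arguments below rest. It is inherited by images
  under regular maps and by generated subgroups through direct computation with functions.\<close>

definition rigid :: "nat \<Rightarrow> 'k :: field mat set \<Rightarrow> bool" where
  "rigid n S \<longleftrightarrow> (\<forall>f. regular_on n f \<longrightarrow> finite (f ` S) \<longrightarrow> (\<forall>x\<in>S. \<forall>y\<in>S. f x = f y))"

lemma rigidD:
  assumes "rigid n S" "regular_on n f" "finite (f ` S)" "x \<in> S" "y \<in> S"
  shows "f x = f y"
  using assms by (auto simp: rigid_def)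

lemma topspace_zariski [simp]: "topspace (zariski n) = (carrier (GL n) :: 'k :: field mat set)"
  and openin_zariski: "openin (zariski n) (U :: 'k mat set) = zariski_open n U"
proof -
  show op: "openin (zariski n) U = zariski_open n U" for U :: "'k mat set"
    unfolding zariski_def by (subst topology_inverse'[OF istopology_zariski_open]) simp
  have "zariski_open n (carrier (GL n) :: 'k mat set)"
    unfolding zariski_open_def
    by (intro exI[of _ "{\<lambda>_. 1}"]) (auto simp: zero_locus_def regular_funs.const)
  moreover have "U \<subseteq> carrier (GL n)" if "zariski_open n U" for U :: "'k mat set"
    using that by (auto simp: zariski_open_def)
  ultimately show "topspace (zariski n) = (carrier (GL n) :: 'k mat set)"
    unfolding topspace_def op by auto
qed

lemma openin_nonzero:
  assumes "regular_on n f"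
  shows "openin (zariski n) {g \<in> carrier (GL n). f g \<noteq> 0}"
proof -
  obtain f' where "f' \<in> regular_funs n" "\<forall>g\<in>carrier (GL n). f g = f' g"
    using assms by (auto simp: regular_on_def)
  then show ?thesis
    unfolding openin_zariski zariski_open_def
    by (intro exI[of _ "{f'}"]) (auto simp: zero_locus_def)
qed

text \<open>A fibre of a function with finite image is closed, and so is the union of the other fibres.\<close>

lemma connectedin_imp_rigid:
  assumes conn: "connectedin (zariski n) S"
  shows "rigid n S"
  unfolding rigid_def
proof (intro allI impI ballI)
  fix f x y assume f: "regular_on n f" "finite (f ` S)" and xy: "x \<in> S" "y \<in> S"
  have sub: "S \<subseteq> carrier (GL n)" using connectedin_subset_topspace[OF conn] by simp
  let ?E1 = "{g \<in> carrier (GL n). f g - f x \<noteq> 0}"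
  let ?E2 = "{g \<in> carrier (GL n). (\<Prod>c\<in>f ` S - {f x}. f g - c) \<noteq> 0}"
  show "f x = f y"
  proof (rule ccontr)
    assume neq: "f x \<noteq> f y"
    show False
    proof (rule connectedinD[OF conn])
      show "openin (zariski n) ?E1" "openin (zariski n) ?E2"
        using f by (intro openin_nonzero regular_on_diff regular_on_prod regular_on_const; simp)+
      show "S \<subseteq> ?E1 \<union> ?E2" using sub f(2) by auto
      show "?E1 \<inter> ?E2 \<inter> S = {}" using f(2) by auto
      have "y \<in> ?E1 \<inter> S" using xy neq sub by auto
      then show "?E1 \<inter> S \<noteq> {}" by blast
      have "x \<in> ?E2 \<inter> S" using xy neq sub f(2) by auto
      then show "?E2 \<inter> S \<noteq> {}" by blast
    qed
  qed
qed

lemma rigid_image: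
  assumes "rigid n S" "reg_map n \<phi>"
  shows "rigid n (\<phi> ` S)"
  unfolding rigid_def
proof (intro allI impI ballI)
  fix f x y assume f: "regular_on n f" "finite (f ` \<phi> ` S)" and "x \<in> \<phi> ` S" "y \<in> \<phi> ` S"
  then obtain x' y' where *: "x' \<in> S" "y' \<in> S" "x = \<phi> x'" "y = \<phi> y'" by blast
  have "finite ((\<lambda>g. f (\<phi> g)) ` S)" using f(2) by (simp add: image_image)
  then show "f x = f y"
    unfolding *(3,4) by (rule rigidD[OF assms(1) reg_map_compose[OF assms(2) f(1)] _ *(1,2)])
qed

lemma rigid_Union:
  assumes "\<And>S. S \<in> \<U> \<Longrightarrow> rigid n S \<and> a \<in> S"
  shows "rigid n (\<Union>\<U>)"
  unfolding rigid_def
proof (intro allI impI ballI)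
  fix f x y assume f: "regular_on n f" "finite (f ` \<Union>\<U>)" and xy: "x \<in> \<Union>\<U>" "y \<in> \<Union>\<U>"
  have "f z = f a" if z: "z \<in> \<Union>\<U>" for z
  proof -
    obtain S where "S \<in> \<U>" "z \<in> S" using z by auto
    moreover from this have "finite (f ` S)" by (intro finite_subset[OF _ f(2)]) auto
    moreover have "rigid n S" "a \<in> S" using assms \<open>S \<in> \<U>\<close> by auto
    ultimately show ?thesis by (intro rigidD[OF _ f(1)])
  qed
  with xy show "f x = f y" by metis
qed

text \<open>For \<open>y\<close> in the generated group, \<open>s \<mapsto> f (y s)\<close> is constant on \<open>C\<close>, so right translation by
  elements of \<open>C\<close> leaves \<open>f\<close> invariant, and the elements with this property form a group.\<close>

lemma rigid_generate:
  assumes C: "rigid n C" "1\<^sub>m n \<in> C" "C \<subseteq> carrier (GL n)"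
  shows "rigid n (generate (GL n) C)"
  unfolding rigid_def
proof (intro allI impI ballI)
  let ?H = "generate (GL n) C"
  interpret H: subgroup ?H "GL n" by (rule GL.generate_is_subgroup[OF C(3)])
  fix f x y assume f: "regular_on n f" "finite (f ` ?H)" and xy: "x \<in> ?H" "y \<in> ?H"
  have CH: "C \<subseteq> ?H" by (auto intro: generate.incl)
  have *: "f (y * s) = f y" if y: "y \<in> ?H" and s: "s \<in> C" for y s
  proof -
    have "rigid n ((\<lambda>s. y * s) ` C)"
      using y H.subset by (intro rigid_image[OF C(1)] reg_map_mult) auto
    moreover have "(\<lambda>s. y * s) ` C \<subseteq> ?H"
      using y CH H.m_closed[simplified] by blast
    then have "finite (f ` (\<lambda>s. y * s) ` C)"
      by (intro finite_subset[OF _ f(2)]) auto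
    ultimately have "f (y * s) = f (y * 1\<^sub>m n)"
      using s C(2) f(1) by (auto intro: rigidD)
    then show ?thesis using y H.subset by auto
  qed
  have "\<forall>y\<in>?H. f (y * z) = f y" if "z \<in> ?H" for z
    using that
  proof induction
    case one then show ?case using H.subset by auto
  next
    case (incl h) then show ?case using * by auto
  next
    case (inv h)
    show ?case
    proof
      fix y assume y: "y \<in> ?H"
      have "y * ginv n h \<in> ?H" using y inv CH H.m_closed[OF y H.m_inv_closed, of h] by auto
      from *[OF this inv] show "f (y * ginv n h) = f y"
        using y inv C(3) H.subset by (auto simp: subset_iff)
    qed
  next
    case (eng h1 h2)
    show ?case
    proof
      fix y assume y: "y \<in> ?H"
      then have "f (y * h1 * h2) = f (y * h1)"
        using eng H.m_closed[simplified] by blast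
      moreover have "y * h1 * h2 = y * (h1 * h2)"
        using y eng H.subset by (intro GL_assoc) auto
      ultimately show "f (y * (h1 \<otimes>\<^bsub>GL n\<^esub> h2)) = f y" using eng y by simp
    qed
  qed
  then have "f (1\<^sub>m n * z) = f (1\<^sub>m n)" if "z \<in> ?H" for z
    using that H.one_closed[simplified] by blast
  moreover have "1\<^sub>m n * z = z" if "z \<in> ?H" for z
    using that H.subset by (intro GL.l_one[simplified]) auto
  ultimately show "f x = f y" using xy by metis
qed

lemma rigid_derived:
  fixes K :: "'k :: field mat set"
  assumes "subgroup K (GL n)" "rigid n K"
  shows "rigid n (derived (GL n) K)"
  unfolding derived_def
proof (rule rigid_generate)
  interpret K: subgroup K "GL n" by fact
  let ?c = "\<lambda>h2 h1. h1 * h2 * ginv n h1 * ginv n h2"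
  have eq: "derived_set (GL n) K = \<Union> ((\<lambda>h2. ?c h2 ` K) ` K)" by auto
  have one: "1\<^sub>m n \<in> ?c h ` K" if "h \<in> K" for h
  proof (rule image_eqI)
    show "1\<^sub>m n \<in> K" using K.one_closed by simp
    have "ginv n (1\<^sub>m n :: 'k mat) = 1\<^sub>m n" using GL.inv_one by simp
    then show "1\<^sub>m n = ?c h (1\<^sub>m n)" using that K.subset by auto
  qed
  show "rigid n (derived_set (GL n) K)"
    unfolding eq
  proof (rule rigid_Union)
    fix S assume "S \<in> (\<lambda>h2. ?c h2 ` K) ` K"
    then obtain h where h: "h \<in> K" "S = ?c h ` K" by auto
    then show "rigid n S \<and> 1\<^sub>m n \<in> S"
      using K.subset one
      by (auto intro!: rigid_image[OF assms(2)] reg_map_mult reg_map_inv)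
  qed
  show "1\<^sub>m n \<in> derived_set (GL n) K"
    unfolding eq using K.one_closed one by auto
  show "derived_set (GL n) K \<subseteq> carrier (GL n)"
    using GL.derived_set_in_carrier[OF K.subset] .
qed


section \<open>Connected solvable groups containing the diagonal torus\<close>

text \<open>For a group normalised by the diagonal matrices this relation is a preorder, which determines
  the coordinate subspaces that the group stabilises. The group is triangular for some ordering of
  the basis if and only if the preorder is antisymmetric.\<close>

definition entry_rel :: "nat \<Rightarrow> 'k :: field mat set \<Rightarrow> nat \<Rightarrow> nat \<Rightarrow> bool" where
  "entry_rel n K i j \<longleftrightarrow> i < n \<and> j < n \<and> (\<exists>g\<in>K. g $$ (i, j) \<noteq> 0)"

definition diag_normalized :: "nat \<Rightarrow> 'k :: field mat set \<Rightarrow> bool" where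
  "diag_normalized n K \<longleftrightarrow>
     (\<forall>d\<in>diag_group n. \<forall>g\<in>K. d * g * ginv n d \<in> K)"

lemma entry_rel_refl:
  assumes "subgroup K (GL n)" "i < n"
  shows "entry_rel n K i i"
  using subgroup.one_closed[OF assms(1)] assms(2)
  by (auto simp: entry_rel_def intro!: bexI[of _ "1\<^sub>m n"])

text \<open>Conjugation by the diagonal matrix with \<open>t\<close> in position \<open>l\<close> and ones elsewhere. Comparing an
  identity between entries with its twisted version isolates single terms of the sums in it.\<close>

lemma diag_normalized_twist:
  assumes "diag_normalized n K" "subgroup K (GL n)" "g \<in> K" "t \<noteq> 0"
  obtains h where "h \<in> K" "\<And>i j. i < n \<Longrightarrow> j < n \<Longrightarrow>
    h $$ (i, j) = (if i = l then t else 1) * g $$ (i, j) / (if j = l then t else 1)"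
proof
  let ?d = "mat_diag n (\<lambda>i. if i = l then t else 1)"
  let ?h = "?d * g * ginv n ?d"
  have g: "g \<in> carrier (GL n)" using assms subgroup.mem_carrier by metis
  have "?d \<in> diag_group n" using assms(4) by (intro diag_groupI) auto
  then show "?h \<in> K" using assms(1,3) by (auto simp: diag_normalized_def)
  fix i j assume "i < n" "j < n"
  then show "?h $$ (i, j) = (if i = l then t else 1) * g $$ (i, j) / (if j = l then t else 1)"
    using mat_diag_conj_entry[of n "\<lambda>i. if i = l then t else 1" g i j] g assms(4) by auto
qed

lemma subgroup_GL_mult: "subgroup K (GL n) \<Longrightarrow> g \<in> K \<Longrightarrow> h \<in> K \<Longrightarrow> g * h \<in> K"
  using subgroup.m_closed[of K "GL n"] by simp

lemma subgroup_GL_carrier: "subgroup K (GL n) \<Longrightarrow> g \<in> K \<Longrightarrow> g \<in> carrier (GL n)"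
  using subgroup.mem_carrier by metis

lemma subgroup_entry_mult:
  assumes "subgroup K (GL n)" "g \<in> K" "h \<in> K" "i < n" "j < n"
  shows "(g * h) $$ (i, j) = (\<Sum>m<n. g $$ (i, m) * h $$ (m, j))"
  using assms subgroup_GL_carrier by (intro mat_mult_entry) blast+

lemma sum_remove_if:
  fixes f :: "nat \<Rightarrow> 'k :: field"
  assumes "l \<in> A" "finite A"
  shows "(\<Sum>m\<in>A. if m = l then x else f m) = x + (\<Sum>m\<in>A - {l}. f m)"
  using assms by (subst sum.remove[of A l]) (auto intro!: sum.cong)

text \<open>The entry \<open>(g h)\<^sub>i\<^sub>l\<close> can vanish by cancellation only; twisting \<open>h\<close> by a sign in position \<open>j\<close>
  changes the sign of the \<open>j\<close>-th summand alone.\<close>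

lemma entry_rel_trans:
  fixes K :: "'k :: field mat set"
  assumes two: "(2 :: 'k) \<noteq> 0" and K: "subgroup K (GL n)" "diag_normalized n K"
    and ij: "entry_rel n K i j" and jl: "entry_rel n K j l"
  shows "entry_rel n K i l"
proof (cases "j = l")
  case False
  obtain g h where gh: "g \<in> K" "g $$ (i, j) \<noteq> 0" "h \<in> K" "h $$ (j, l) \<noteq> 0"
    and n: "i < n" "j < n" "l < n"
    using ij jl by (auto simp: entry_rel_def)
  obtain h' where h': "h' \<in> K" "\<And>a b. a < n \<Longrightarrow> b < n \<Longrightarrow>
      h' $$ (a, b) = (if a = j then -1 else 1) * h $$ (a, b) / (if b = j then -1 else 1)"
    using diag_normalized_twist[OF K(2,1) gh(3), of "-1" j] by auto
  have "(g * h) $$ (i, l) = g $$ (i, j) * h $$ (j, l) + (\<Sum>m\<in>{..<n} - {j}. g $$ (i, m) * h $$ (m, l))"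
    using n gh K by (subst subgroup_entry_mult[of K]) (auto simp: sum.remove[of "{..<n}" j])
  moreover have "(g * h') $$ (i, l) = - (g $$ (i, j) * h $$ (j, l)) + (\<Sum>m\<in>{..<n} - {j}. g $$ (i, m) * h $$ (m, l))"
  proof -
    have "(g * h') $$ (i, l) = (\<Sum>m<n. g $$ (i, m) * h' $$ (m, l))"
      using n gh K h'(1) by (intro subgroup_entry_mult) auto
    also have "\<dots> = (\<Sum>m<n. if m = j then - (g $$ (i, j) * h $$ (j, l)) else g $$ (i, m) * h $$ (m, l))"
      using n False by (intro sum.cong) (auto simp: h'(2))
    finally show ?thesis using n by (simp add: sum_remove_if)
  qed
  ultimately have "(g * h) $$ (i, l) - (g * h') $$ (i, l) = 2 * (g $$ (i, j) * h $$ (j, l))"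
    by simp
  with two gh have "(g * h) $$ (i, l) \<noteq> 0 \<or> (g * h') $$ (i, l) \<noteq> 0" by auto
  then show ?thesis
    using n gh h'(1) subgroup_GL_mult[OF K(1)] by (auto simp: entry_rel_def)
qed (use assms in simp)

text \<open>The values \<open>1\<close>, \<open>-1\<close> and a square root of \<open>-1\<close> separate the characters \<open>t\<close>, \<open>1\<close>, \<open>1/t\<close>.\<close>

lemma laurent_coefficient_zero:
  fixes \<alpha> :: "'k :: alg_closed_field"
  assumes two: "(2 :: 'k) \<noteq> 0" and eq: "\<And>t. t \<noteq> 0 \<Longrightarrow> t * \<alpha> + a = \<gamma> / t + b"
  shows "\<alpha> = 0"
proof -
  obtain \<iota> :: 'k where "\<iota> ^ 2 = -1" using nth_root_exists[of 2 "-1 :: 'k"] by auto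
  then have \<iota>: "\<iota> * \<iota> = -1" "\<iota> \<noteq> 0" by (auto simp: power2_eq_square)
  have e1: "\<alpha> + a = \<gamma> + b" and e2: "- \<alpha> + a = - \<gamma> + b"
    using eq[of 1] eq[of "-1"] by simp_all
  have "(\<alpha> + a) - (- \<alpha> + a) = (\<gamma> + b) - (- \<gamma> + b)" by (simp only: e1 e2)
  then have "2 * \<alpha> = 2 * \<gamma>" by simp
  then have \<alpha>\<gamma>: "\<alpha> = \<gamma>" using two by simp
  then have "a = b" using e1 by simp
  with eq[OF \<iota>(2)] \<alpha>\<gamma> have "\<iota> * \<alpha> = \<alpha> / \<iota>" by simp
  then have "\<iota> * \<iota> * \<alpha> = \<alpha>" using \<iota>(2) by (simp add: field_simps)
  then have "2 * \<alpha> = 0" unfolding \<iota>(1) by (simp add: neg_eq_iff_add_eq_0)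
  then show ?thesis using two by simp
qed

text \<open>The inductive step of the Lie-Kolchin theorem. Let \<open>C\<close> be a class of mutually related indices.
  Entries with indices in \<open>C\<close> multiply like matrices, and comparing \<open>h x\<close> with \<open>x h\<close> for the diagonal
  twists \<open>x\<close> of an element shows that this block of \<open>K\<close> is not commutative once \<open>C\<close> has two elements.
  On the other hand the derived group acts on \<open>C\<close> by scalars: for an index \<open>i0\<close> of \<open>C\<close> that is minimal for the order of the derived group,
  \<open>g \<mapsto> g\<^sub>i\<^sub>0\<^sub>i\<^sub>0\<close> is a character \<open>\<chi>\<close> of it, and \<open>\<chi> (h\<^sup>-\<^sup>1 g h)\<close> is a root of unity of order dividing the
  order of \<open>g\<close>, hence does not depend on \<open>h\<close>. So all \<open>K\<close>-translates of the \<open>i0\<close>-th basis vector are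
  eigenvectors of \<open>g\<close> with the eigenvalue \<open>\<chi> g\<close> on \<open>C\<close>, and by twisting once more the block of \<open>g\<close>
  is \<open>\<chi> g\<close> times the identity. In the same way the scalar by which a commutator
  acts is constant, namely \<open>1\<close>, so the block is commutative.\<close>

lemma entry_rel_antisym_of_derived:
  fixes H K :: "'k :: alg_closed_field mat set"
  assumes alg: "algebraic_closure_of_Fq p q TYPE('k)" and two: "(2 :: 'k) \<noteq> 0"
    and K: "subgroup K (GL n)" "diag_normalized n K" "rigid n K"
    and K': "diag_normalized n (derived (GL n) K)"
    and antisym: "\<And>i j. entry_rel n (derived (GL n) K) i j \<Longrightarrow>
                    entry_rel n (derived (GL n) K) j i \<Longrightarrow> i = j"
    and ij: "entry_rel n K i j" "entry_rel n K j i"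
  shows "i = j"
proof (rule ccontr)
  assume neq: "i \<noteq> j"
  interpret K: subgroup K "GL n" by fact
  let ?K' = "derived (GL n) K"
  have K'sub: "subgroup ?K' (GL n)" by (rule GL.derived_is_subgroup[OF K.subset])
  interpret K': subgroup ?K' "GL n" by fact
  have K'K: "?K' \<subseteq> K" by (rule GL.derived_incl[OF order_refl K(1)])
  have K'conj: "ginv n h * g * h \<in> ?K'" if "g \<in> ?K'" "h \<in> K" for g h
  proof -
    have "?K' \<lhd> GL n\<lparr>carrier := K\<rparr>" by (rule GL.derived_subgroup_is_normal[OF K(1)])
    from normal.inv_op_closed1[OF this, of h g] that K'K show ?thesis
      using GL.m_inv_consistent[OF K(1)] by auto
  qed
  note trans = entry_rel_trans[OF two K(1,2)]
  note trans' = entry_rel_trans[OF two K'sub K']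
  have n: "i < n" "j < n" using ij by (auto simp: entry_rel_def)
  have relK: "entry_rel n K a b" if "g \<in> K" "g $$ (a, b) \<noteq> 0" "a < n" "b < n" for g a b
    using that by (auto simp: entry_rel_def)

  define C where "C = {c. entry_rel n K c i \<and> entry_rel n K i c}"
  have Cn: "c < n" if "c \<in> C" for c using that by (auto simp: C_def entry_rel_def)
  then have finC: "finite C" by (meson finite_lessThan finite_subset lessThan_iff subsetI)
  have iC: "i \<in> C" and jC: "j \<in> C"
    using ij entry_rel_refl[OF K(1) n(1)] by (auto simp: C_def)
  have Crel: "entry_rel n K a b" if "a \<in> C" "b \<in> C" for a b
    using that trans by (auto simp: C_def)
  have block: "(g * h) $$ (a, b) = (\<Sum>m\<in>C. g $$ (a, m) * h $$ (m, b))"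
    if "g \<in> K" "h \<in> K" "a \<in> C" "b \<in> C" for g h a b
  proof -
    have "(g * h) $$ (a, b) = (\<Sum>m<n. g $$ (a, m) * h $$ (m, b))"
      using that Cn by (intro subgroup_entry_mult[OF K(1)]) auto
    also have "\<dots> = (\<Sum>m\<in>C. g $$ (a, m) * h $$ (m, b))"
    proof (rule sum.mono_neutral_right)
      show "\<forall>m\<in>{..<n} - C. g $$ (a, m) * h $$ (m, b) = 0"
      proof (rule ballI, rule ccontr)
        fix m assume m: "m \<in> {..<n} - C" and "g $$ (a, m) * h $$ (m, b) \<noteq> 0"
        then have "entry_rel n K a m" "entry_rel n K m b"
          using relK[OF that(1), of a m] relK[OF that(2), of m b] that Cn by auto
        with that have "m \<in> C" unfolding C_def using trans by blast
        with m show False by simp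
      qed
    qed (use Cn in auto)
    finally show ?thesis .
  qed

  (* column i0 of the derived group has, within C, only its diagonal entry *)
  have "\<exists>i0\<in>C. \<forall>c\<in>C. c \<noteq> i0 \<longrightarrow> \<not> (entry_rel n ?K' c i0 \<and> c \<noteq> i0)"
  proof (rule Finite_Set.bex_min_element[OF finC])
    show "asymp_on C (\<lambda>a b. entry_rel n ?K' a b \<and> a \<noteq> b)"
      using antisym by (auto intro!: asymp_onI)
    show "transp_on C (\<lambda>a b. entry_rel n ?K' a b \<and> a \<noteq> b)"
      using antisym trans' by (intro transp_onI) blast
  qed (use iC in auto)
  then obtain i0 where i0: "i0 \<in> C" and min: "\<And>c. c \<in> C \<Longrightarrow> entry_rel n ?K' c i0 \<Longrightarrow> c = i0"
    by blast
  have i0n: "i0 < n" using Cn i0 by auto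
  have col: "g $$ (m, i0) = 0" if "g \<in> ?K'" "m \<in> C" "m \<noteq> i0" for g m
    using that min[of m] Cn i0 by (auto simp: entry_rel_def)
  have chi_mult: "(g * h) $$ (i0, i0) = g $$ (i0, i0) * h $$ (i0, i0)"
    if "g \<in> ?K'" "h \<in> ?K'" for g h
  proof -
    have "(g * h) $$ (i0, i0) = (\<Sum>m\<in>C. g $$ (i0, m) * h $$ (m, i0))"
      using that K'K i0 by (intro block) auto
    also have "\<dots> = (\<Sum>m\<in>C. if m = i0 then g $$ (i0, i0) * h $$ (i0, i0) else 0)"
      using that col by (intro sum.cong) auto
    finally show ?thesis using finC i0 by simp
  qed
  have pow_mem: "g [^]\<^bsub>GL n\<^esub> (l :: nat) \<in> S" if "subgroup S (GL n)" "g \<in> S" for g l S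
    using that by (induction l) (auto simp: subgroup.one_closed[of S "GL n", simplified] subgroup_GL_mult)
  have chi_pow: "(g [^]\<^bsub>GL n\<^esub> (l :: nat)) $$ (i0, i0) = g $$ (i0, i0) ^ l" if "g \<in> ?K'" for g l
  proof (induction l)
    case (Suc l)
    then show ?case using chi_mult[OF pow_mem[OF K'sub that] that] that by simp
  qed (use i0n in simp)
  have fin_roots: "finite {x :: 'k. x ^ N = 1}" if "N > 0" for N :: nat
    using that by (rule finite_roots_of_unity)

  have chi_conj: "(ginv n h * g * h) $$ (i0, i0) = g $$ (i0, i0)"
    if g: "g \<in> ?K'" and h: "h \<in> K" for g h
  proof -
    let ?f = "\<lambda>h. (ginv n h * g * h) $$ (i0, i0)"
    have gc: "g \<in> carrier (GL n)" using g by auto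
    obtain N :: nat where N: "N > 0" "g [^]\<^bsub>GL n\<^esub> N = 1\<^sub>m n"
      using GL_torsion[OF alg gc] by auto
    have "?f h ^ N = 1" if h: "h \<in> K" for h
    proof -
      have hc: "h \<in> carrier (GL n)" using h by auto
      have "(ginv n h * g * h) [^]\<^bsub>GL n\<^esub> l = ginv n h * (g [^]\<^bsub>GL n\<^esub> l) * h" for l :: nat
      proof (induction l)
        case (Suc l)
        have "g [^]\<^bsub>GL n\<^esub> l \<in> carrier (GL n)" using gc by simp
        then show ?case using gc hc Suc by (simp add: GL_assoc[where n = n])
      qed (use hc in simp)
      from this[of N] chi_pow[OF K'conj[OF g h], of N] show ?thesis
        using N(2) hc i0n by simp
    qed
    then have "?f ` K \<subseteq> {x. x ^ N = 1}" by auto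
    then have "finite (?f ` K)" using fin_roots[OF N(1)] finite_subset by blast
    moreover have "regular_on n ?f"
      using reg_map_compose[OF reg_map_mult[OF reg_map_mult[OF reg_map_inv reg_map_const[OF gc]] reg_map_id]
         regular_on_entry[OF i0n i0n]] .
    moreover have "1\<^sub>m n \<in> K" using K.one_closed by simp
    ultimately have "?f h = ?f (1\<^sub>m n)" using h by (intro rigidD[OF K(3)])
    moreover have "ginv n (1\<^sub>m n :: 'k mat) = 1\<^sub>m n" using GL.inv_one by simp
    ultimately show ?thesis using gc by simp
  qed

  have colsum: "(\<Sum>m\<in>C. g $$ (a, m) * h $$ (m, i0)) = g $$ (i0, i0) * h $$ (a, i0)"
    if g: "g \<in> ?K'" and h: "h \<in> K" and a: "a \<in> C" for g h a
  proof -
    let ?g' = "ginv n h * g * h"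
    have c: "g \<in> carrier (GL n)" "h \<in> carrier (GL n)" using g h by auto
    have "(\<Sum>m\<in>C. g $$ (a, m) * h $$ (m, i0)) = (g * h) $$ (a, i0)"
      using g h a i0 K'K by (intro block[symmetric]) auto
    also have "g * h = h * ?g'" using c by (simp add: GL_assoc[where n = n])
    also have "(h * ?g') $$ (a, i0) = (\<Sum>m\<in>C. h $$ (a, m) * ?g' $$ (m, i0))"
      using g h a i0 K'K K'conj by (intro block) auto
    also have "\<dots> = (\<Sum>m\<in>C. if m = i0 then h $$ (a, i0) * g $$ (i0, i0) else 0)"
      using col[OF K'conj[OF g h]] chi_conj[OF g h] by (intro sum.cong) auto
    finally show ?thesis using finC i0 by simp
  qed
  (* adding colsum for h to colsum for its sign twist at l leaves only the l-th summand; the factor e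
     compensates the sign that the twist puts on column i0 when i0 = l *)
  have offdiag: "g $$ (a, l) = 0" if g: "g \<in> ?K'" and a: "a \<in> C" and l: "l \<in> C" and al: "a \<noteq> l" for g a l
  proof -
    obtain h where h: "h \<in> K" "h $$ (l, i0) \<noteq> 0" using Crel[OF l i0] by (auto simp: entry_rel_def)
    obtain h' where h': "h' \<in> K" "\<And>a b. a < n \<Longrightarrow> b < n \<Longrightarrow>
        h' $$ (a, b) = (if a = l then -1 else 1) * h $$ (a, b) / (if b = l then -1 else 1)"
      using diag_normalized_twist[OF K(2,1) h(1), of "-1" l] by auto
    define e :: 'k where "e = (if i0 = l then -1 else 1)"
    have e: "e * e = 1" by (simp add: e_def)
    have h'i0: "e * h' $$ (m, i0) = (if m = l then -1 else 1) * h $$ (m, i0)" if "m \<in> C" for m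
      using Cn[OF that] i0n by (simp add: h'(2) e_def)
    have "e * (\<Sum>m\<in>C. g $$ (a, m) * h' $$ (m, i0)) = g $$ (i0, i0) * (e * h' $$ (a, i0))"
      by (subst colsum[OF g h'(1) a]) simp
    also have "\<dots> = g $$ (i0, i0) * h $$ (a, i0)" using al a by (simp add: h'i0)
    also have "e * (\<Sum>m\<in>C. g $$ (a, m) * h' $$ (m, i0)) = (\<Sum>m\<in>C. g $$ (a, m) * (e * h' $$ (m, i0)))"
      by (simp add: sum_distrib_left mult_ac)
    also have "\<dots> = (\<Sum>m\<in>C. if m = l then - (g $$ (a, l) * h $$ (l, i0)) else g $$ (a, m) * h $$ (m, i0))"
      by (intro sum.cong) (auto simp: h'i0)
    also have "\<dots> = - (g $$ (a, l) * h $$ (l, i0)) + (\<Sum>m\<in>C - {l}. g $$ (a, m) * h $$ (m, i0))"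
      by (rule sum_remove_if[OF l finC])
    finally have 1: "- (g $$ (a, l) * h $$ (l, i0)) + (\<Sum>m\<in>C - {l}. g $$ (a, m) * h $$ (m, i0)) =
       g $$ (i0, i0) * h $$ (a, i0)" .
    have 2: "g $$ (a, l) * h $$ (l, i0) + (\<Sum>m\<in>C - {l}. g $$ (a, m) * h $$ (m, i0)) =
       g $$ (i0, i0) * h $$ (a, i0)"
      using colsum[OF g h(1) a] finC l by (simp add: sum.remove)
    from 1 2 have "2 * (g $$ (a, l) * h $$ (l, i0)) = 0" by (simp add: algebra_simps)
    with two h(2) show ?thesis by simp
  qed
  have diag: "g $$ (a, a) = g $$ (i0, i0)" if g: "g \<in> ?K'" and a: "a \<in> C" for g a
  proof -
    obtain h where h: "h \<in> K" "h $$ (a, i0) \<noteq> 0" using Crel[OF a i0] by (auto simp: entry_rel_def)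
    have "g $$ (i0, i0) * h $$ (a, i0) = (\<Sum>m\<in>C. g $$ (a, m) * h $$ (m, i0))"
      by (rule colsum[OF g h(1) a, symmetric])
    also have "\<dots> = (\<Sum>m\<in>C. if m = a then g $$ (a, a) * h $$ (a, i0) else 0)"
      using offdiag[OF g a] by (intro sum.cong) auto
    finally show ?thesis using finC a h(2) by simp
  qed
  have scalar: "(g * h) $$ (a, b) = g $$ (i0, i0) * h $$ (a, b)"
    if g: "g \<in> ?K'" and h: "h \<in> K" and ab: "a \<in> C" "b \<in> C" for g h a b
  proof -
    have "(g * h) $$ (a, b) = (\<Sum>m\<in>C. g $$ (a, m) * h $$ (m, b))"
      using g h ab K'K by (intro block) auto
    also have "\<dots> = (\<Sum>m\<in>C. if m = a then g $$ (i0, i0) * h $$ (a, b) else 0)"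
      using offdiag[OF g ab(1)] diag[OF g ab(1)] by (intro sum.cong) auto
    finally show ?thesis using finC ab by simp
  qed

  let ?comm = "\<lambda>h h'. h * h' * ginv n h * ginv n h'"
  have comm_mem: "?comm h h' \<in> ?K'" if "h \<in> K" "h' \<in> K" for h h'
    unfolding derived_def using that by (intro generate.incl) auto
  have chi_comm: "?comm h h' $$ (i0, i0) = 1" if h: "h \<in> K" and h': "h' \<in> K" for h h'
  proof -
    let ?f = "\<lambda>h. ?comm h h' $$ (i0, i0)"
    have hc': "h' \<in> carrier (GL n)" using h' by auto
    obtain N :: nat where N: "N > 0" "h' [^]\<^bsub>GL n\<^esub> N = 1\<^sub>m n"
      using GL_torsion[OF alg hc'] by auto
    (* h h' h^-1 has the same order as h', and on C it is a scalar multiple of h' *)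
    have "?f h ^ N = 1" if h: "h \<in> K" for h
    proof -
      have hc: "h \<in> carrier (GL n)" using h by auto
      let ?x = "h * h' * ginv n h"
      have x: "?x = ?comm h h' * h'" using hc hc' by simp
      have xK: "?x \<in> K" using h h' K.m_inv_closed subgroup_GL_mult[OF K(1)] by auto
      have xpow: "?x [^]\<^bsub>GL n\<^esub> l = h * (h' [^]\<^bsub>GL n\<^esub> l) * ginv n h" for l :: nat
      proof (induction l)
        case (Suc l)
        have "h' [^]\<^bsub>GL n\<^esub> l \<in> carrier (GL n)" using hc' by simp
        then show ?case using hc hc' Suc by (simp add: GL_assoc[where n = n])
      qed (use hc in simp)
      have "(?x [^]\<^bsub>GL n\<^esub> l) $$ (a, b) = ?f h ^ l * (h' [^]\<^bsub>GL n\<^esub> l) $$ (a, b)"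
        if "a \<in> C" "b \<in> C" for a b and l :: nat
        using that
      proof (induction l arbitrary: b)
        case 0 then show ?case by simp
      next
        case (Suc l)
        have "(?x [^]\<^bsub>GL n\<^esub> Suc l) $$ (a, b) = (\<Sum>m\<in>C. (?x [^]\<^bsub>GL n\<^esub> l) $$ (a, m) * ?x $$ (m, b))"
          using block[OF pow_mem[OF K(1) xK] xK Suc.prems] by simp
        also have "\<dots> = (\<Sum>m\<in>C. (?f h ^ l * (h' [^]\<^bsub>GL n\<^esub> l) $$ (a, m)) * (?f h * h' $$ (m, b)))"
        proof (rule sum.cong[OF refl])
          fix m assume m: "m \<in> C"
          have "?x $$ (m, b) = ?f h * h' $$ (m, b)"
            by (subst x) (rule scalar[OF comm_mem[OF h h'] h' m Suc.prems(2)])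
          then show "(?x [^]\<^bsub>GL n\<^esub> l) $$ (a, m) * ?x $$ (m, b) =
              (?f h ^ l * (h' [^]\<^bsub>GL n\<^esub> l) $$ (a, m)) * (?f h * h' $$ (m, b))"
            by (simp only: Suc.IH[OF Suc.prems(1) m])
        qed
        also have "\<dots> = ?f h ^ Suc l * (\<Sum>m\<in>C. (h' [^]\<^bsub>GL n\<^esub> l) $$ (a, m) * h' $$ (m, b))"
          unfolding sum_distrib_left by (intro sum.cong) (simp_all add: mult_ac)
        also have "(\<Sum>m\<in>C. (h' [^]\<^bsub>GL n\<^esub> l) $$ (a, m) * h' $$ (m, b)) = (h' [^]\<^bsub>GL n\<^esub> Suc l) $$ (a, b)"
          using block[OF pow_mem[OF K(1) h'] h' Suc.prems] by simp
        finally show ?case .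
      qed
      from this[OF i0 i0, of N] xpow[of N] show ?thesis
        using N(2) hc i0n by simp
    qed
    then have "?f ` K \<subseteq> {x. x ^ N = 1}" by auto
    then have "finite (?f ` K)" using fin_roots[OF N(1)] finite_subset by blast
    moreover have "regular_on n ?f"
      using reg_map_compose[OF reg_map_mult[OF reg_map_mult[OF reg_map_mult[OF reg_map_id reg_map_const[OF hc']]
         reg_map_inv] reg_map_const[OF GL.inv_closed[OF hc']]] regular_on_entry[OF i0n i0n]] .
    moreover have "1\<^sub>m n \<in> K" using K.one_closed by simp
    ultimately have "?f h = ?f (1\<^sub>m n)" using h by (intro rigidD[OF K(3)])
    moreover have "ginv n (1\<^sub>m n :: 'k mat) = 1\<^sub>m n" using GL.inv_one by simp
    ultimately show ?thesis using hc' i0n by simp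
  qed
  have comm: "(h * h') $$ (a, b) = (h' * h) $$ (a, b)"
    if h: "h \<in> K" and h': "h' \<in> K" and ab: "a \<in> C" "b \<in> C" for h h' a b
  proof -
    have c: "h \<in> carrier (GL n)" "h' \<in> carrier (GL n)" using h h' by auto
    have "h * h' = ?comm h h' * (h' * h)"
      using c by (simp add: GL_assoc[where n = n])
    then show ?thesis
      using scalar[OF comm_mem[OF h h'] subgroup_GL_mult[OF K(1) h' h] ab] chi_comm[OF h h'] by simp
  qed

  obtain h h' where h: "h \<in> K" "h $$ (i, j) \<noteq> 0" and h': "h' \<in> K" "h' $$ (j, i) \<noteq> 0"
    using ij by (auto simp: entry_rel_def)
  define S1 S2 where "S1 = (\<Sum>m\<in>C - {j}. h $$ (i, m) * h' $$ (m, i))"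
    and "S2 = (\<Sum>m\<in>C - {j}. h' $$ (i, m) * h $$ (m, i))"
  let ?\<alpha> = "h $$ (i, j) * h' $$ (j, i)" and ?\<gamma> = "h' $$ (i, j) * h $$ (j, i)"
  have eq: "t * ?\<alpha> + S1 = ?\<gamma> / t + S2" if t: "t \<noteq> 0" for t
  proof -
    obtain x where x: "x \<in> K" "\<And>a b. a < n \<Longrightarrow> b < n \<Longrightarrow>
        x $$ (a, b) = (if a = j then t else 1) * h' $$ (a, b) / (if b = j then t else 1)"
      using diag_normalized_twist[OF K(2,1) h'(1) t, of j] by auto
    have "(h * x) $$ (i, i) = (\<Sum>m\<in>C. h $$ (i, m) * x $$ (m, i))"
      by (rule block[OF h(1) x(1) iC iC])
    also have "\<dots> = (\<Sum>m\<in>C. if m = j then t * ?\<alpha> else h $$ (i, m) * h' $$ (m, i))"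
      using neq n Cn by (intro sum.cong) (auto simp: x(2))
    also have "\<dots> = t * ?\<alpha> + S1" unfolding S1_def by (rule sum_remove_if[OF jC finC])
    finally have 1: "(h * x) $$ (i, i) = t * ?\<alpha> + S1" .
    have "(x * h) $$ (i, i) = (\<Sum>m\<in>C. x $$ (i, m) * h $$ (m, i))"
      by (rule block[OF x(1) h(1) iC iC])
    also have "\<dots> = (\<Sum>m\<in>C. if m = j then ?\<gamma> / t else h' $$ (i, m) * h $$ (m, i))"
      using neq n Cn by (intro sum.cong) (auto simp: x(2))
    also have "\<dots> = ?\<gamma> / t + S2" unfolding S2_def by (rule sum_remove_if[OF jC finC])
    finally show ?thesis using 1 comm[OF h(1) x(1) iC iC] by simp
  qed
  have "?\<alpha> = 0" by (rule laurent_coefficient_zero[OF two eq])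
  with h(2) h'(2) show False by simp
qed

lemma derived_power_normal:
  assumes "subgroup H (GL n)"
  shows "(derived (GL n) ^^ r) H \<lhd> GL n\<lparr>carrier := H\<rparr> \<and> (derived (GL n) ^^ r) H \<subseteq> H"
proof (induction r)
  case 0
  interpret HG: group "GL n\<lparr>carrier := H\<rparr>" by (rule GL.subgroup_imp_group[OF assms])
  show ?case using HG.normal_self by simp
next
  case (Suc r)
  interpret HG: group "GL n\<lparr>carrier := H\<rparr>" by (rule GL.subgroup_imp_group[OF assms])
  let ?K = "(derived (GL n) ^^ r) H"
  have "derived (GL n\<lparr>carrier := H\<rparr>) ?K \<lhd> GL n\<lparr>carrier := H\<rparr>"
    using Suc by (intro HG.derived_is_normal) auto
  moreover have "derived (GL n\<lparr>carrier := H\<rparr>) ?K = derived (GL n) ?K"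
    using Suc by (intro GL.derived_consistent[OF _ assms]) auto
  moreover have "derived (GL n) ?K \<subseteq> H"
    using Suc by (intro GL.derived_incl[OF _ assms]) auto
  ultimately show ?case by simp
qed

lemma solvable_GL_iff:
  assumes "subgroup H (GL n)"
  shows "solvable (GL n\<lparr>carrier := H\<rparr>) \<longleftrightarrow> (\<exists>m. (derived (GL n) ^^ m) H = {1\<^sub>m n})"
proof -
  interpret HG: group "GL n\<lparr>carrier := H\<rparr>" by (rule GL.subgroup_imp_group[OF assms])
  have "(derived (GL n\<lparr>carrier := H\<rparr>) ^^ m) H = (derived (GL n) ^^ m) H" for m
  proof (induction m)
    case (Suc m)
    then show ?case
      using derived_power_normal[OF assms, of m] GL.derived_consistent[OF _ assms] by simp
  qed simp
  then show ?thesis unfolding HG.solvable_iff_trivial_derived_seq by simp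
qed

text \<open>The Lie-Kolchin theorem for groups that contain the diagonal matrices. Antisymmetry
  climbs up the derived series from the trivial group.\<close>

theorem entry_rel_antisym:
  fixes H :: "'k :: alg_closed_field mat set"
  assumes alg: "algebraic_closure_of_Fq p q TYPE('k)" and two: "(2 :: 'k) \<noteq> 0"
    and H: "connected_solvable_subgroup n H" "diag_group n \<subseteq> H"
    and ij: "entry_rel n H i j" "entry_rel n H j i"
  shows "i = j"
proof -
  have sub: "subgroup H (GL n)" and "rigid n H" and "solvable (GL n\<lparr>carrier := H\<rparr>)"
    using H(1) by (auto simp: connected_solvable_subgroup_def closed_subgroup_def connectedin_imp_rigid)
  then obtain m where m: "(derived (GL n) ^^ m) H = {1\<^sub>m n}"
    using solvable_GL_iff[OF sub] by blast
  let ?D = "\<lambda>r. (derived (GL n) ^^ r) H"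
  have Dsub: "subgroup (?D r) (GL n)" for r by (rule GL.exp_of_derived_is_subgroup[OF sub])
  have Drigid: "rigid n (?D r)" for r
    by (induction r) (auto simp: \<open>rigid n H\<close> rigid_derived Dsub)
  have Dnorm: "diag_normalized n (?D r)" for r
    unfolding diag_normalized_def
  proof (intro ballI)
    fix d g :: "'k mat" assume d: "d \<in> diag_group n" and g: "g \<in> ?D r"
    have "?D r \<lhd> GL n\<lparr>carrier := H\<rparr>" using derived_power_normal[OF sub] by blast
    from normal.inv_op_closed2[OF this, of d g] d g H(2)
    show "d * g * ginv n d \<in> ?D r"
      using GL.m_inv_consistent[OF sub, of d] by auto
  qed
  have "entry_rel n (?D (m - r)) a b \<Longrightarrow> entry_rel n (?D (m - r)) b a \<Longrightarrow> a = b"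
    if "r \<le> m" for r a b
    using that
  proof (induction r arbitrary: a b)
    case 0
    then show ?case by (auto simp: m entry_rel_def split: if_splits)
  next
    case (Suc r)
    have eq: "?D (m - r) = derived (GL n) (?D (m - Suc r))"
      using Suc.prems(3) by (metis Suc_diff_le diff_Suc_Suc funpow.simps(2) o_apply)
    show ?case
    proof (rule entry_rel_antisym_of_derived[OF alg two Dsub Dnorm Drigid])
      show "diag_normalized n (derived (GL n) (?D (m - Suc r)))"
        using Dnorm[of "m - r"] eq by simp
    qed (use Suc eq in auto)
  qed
  from this[of m] ij show ?thesis by simp
qed


section \<open>Conjugation\<close>

definition cj :: "nat \<Rightarrow> 'k :: field mat \<Rightarrow> 'k mat \<Rightarrow> 'k mat" where
  "cj n h g = h * g * ginv n h"

lemma cj_closed [simp]: "h \<in> carrier (GL n) \<Longrightarrow> g \<in> carrier (GL n) \<Longrightarrow> cj n h g \<in> carrier (GL n)"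
  by (simp add: cj_def)

lemma cj_mult:
  assumes "h \<in> carrier (GL n)" "g \<in> carrier (GL n)" "g' \<in> carrier (GL n)"
  shows "cj n h (g * g') = cj n h g * cj n h g'"
  using assms by (simp add: cj_def GL_assoc[where n = n])

lemma cj_inv_cj [simp]:
  assumes "h \<in> carrier (GL n)" "g \<in> carrier (GL n)"
  shows "cj n (ginv n h) (cj n h g) = g" "cj n h (cj n (ginv n h) g) = g"
  using assms by (simp_all add: cj_def GL_assoc[where n = n])

lemma inv_one_GL [simp]: "ginv n (1\<^sub>m n) = (1\<^sub>m n :: 'k :: field mat)"
  using GL.inv_one[where 'k = 'k, of n] by simp

lemma cj_one [simp]: "g \<in> carrier (GL n) \<Longrightarrow> cj n (1\<^sub>m n) g = g"
  by (simp add: cj_def)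

lemma cj_image_inv:
  assumes "h \<in> carrier (GL n)" "S \<subseteq> carrier (GL n)"
  shows "cj n (ginv n h) ` cj n h ` S = S" "cj n h ` cj n (ginv n h) ` S = S"
  using assms by (force simp: image_image subset_iff)+

lemma cj_hom: "h \<in> carrier (GL n) \<Longrightarrow> group_hom (GL n) (GL n) (cj n h)"
  by unfold_locales (auto simp: hom_def cj_mult)

lemma reg_map_cj: "h \<in> carrier (GL n) \<Longrightarrow> reg_map n (cj n h)"
  unfolding cj_def by (intro reg_map_mult) auto

lemma continuous_map_zariski:
  fixes \<phi> :: "'k :: field mat \<Rightarrow> 'k mat"
  assumes \<phi>: "reg_map n \<phi>"
  shows "continuous_map (zariski n) (zariski n) \<phi>"
  unfolding continuous_map_def
proof (intro conjI allI impI)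
  show "\<phi> \<in> topspace (zariski n) \<rightarrow> topspace (zariski n)"
    using \<phi> by (auto simp: reg_map_def)
next
  fix U :: "'k mat set" assume "openin (zariski n) U"
  then obtain S where S: "S \<subseteq> regular_funs n" "U = carrier (GL n) - zero_locus n S"
    by (auto simp: openin_zariski zariski_open_def)
  have "{x \<in> topspace (zariski n). \<phi> x \<in> U} = (\<Union>f\<in>S. {g \<in> carrier (GL n). f (\<phi> g) \<noteq> 0})"
    using \<phi> S(2) by (auto simp: reg_map_def zero_locus_def)
  moreover have "openin (zariski n) (\<Union>f\<in>S. {g \<in> carrier (GL n). f (\<phi> g) \<noteq> 0})"
    using S(1) by (intro openin_Union ballI) 
      (auto intro!: openin_nonzero reg_map_compose[OF \<phi> regular_on_regular])
  ultimately show "openin (zariski n) {x \<in> topspace (zariski n). \<phi> x \<in> U}" by simp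
qed

lemma closedin_zeros:
  assumes "\<And>f. f \<in> F \<Longrightarrow> regular_on n f"
  shows "closedin (zariski n) {g \<in> carrier (GL n). \<forall>f\<in>F. f g = 0}"
proof -
  have "topspace (zariski n) - {g \<in> carrier (GL n). \<forall>f\<in>F. f g = 0} =
      (\<Union>f\<in>F. {g \<in> carrier (GL n). f g \<noteq> 0})" by auto
  moreover have "openin (zariski n) (\<Union>f\<in>F. {g \<in> carrier (GL n). f g \<noteq> 0})"
    using assms by (intro openin_Union ballI) (auto intro!: openin_nonzero)
  ultimately show ?thesis by (auto simp: closedin_def)
qed

lemma closed_subgroup_cj:
  assumes h: "h \<in> carrier (GL n)" and S: "closed_subgroup n S"
  shows "closed_subgroup n (cj n h ` S)"
  unfolding closed_subgroup_def
proof
  have sub: "subgroup S (GL n)" using S by (simp add: closed_subgroup_def)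
  then have car: "S \<subseteq> carrier (GL n)" by (rule subgroup.subset)
  show "subgroup (cj n h ` S) (GL n)"
    using group_hom.subgroup_img_is_subgroup[OF cj_hom[OF h] sub] .
  have "closedin (zariski n) {x \<in> topspace (zariski n). cj n (ginv n h) x \<in> S}"
    using S by (intro closedin_continuous_map_preimage[OF continuous_map_zariski[OF reg_map_cj[OF GL.inv_closed[OF h]]]])
      (simp add: closed_subgroup_def)
  also have "{x \<in> topspace (zariski n). cj n (ginv n h) x \<in> S} = cj n h ` S"
  proof (intro equalityI subsetI)
    fix x assume "x \<in> {x \<in> topspace (zariski n). cj n (ginv n h) x \<in> S}"
    then have "x = cj n h (cj n (ginv n h) x)" "cj n (ginv n h) x \<in> S"
      using h by auto
    then show "x \<in> cj n h ` S" by (rule image_eqI)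
  next
    fix x assume "x \<in> cj n h ` S"
    then obtain y where "y \<in> S" "x = cj n h y" by blast
    with h car show "x \<in> {x \<in> topspace (zariski n). cj n (ginv n h) x \<in> S}" by auto
  qed
  finally show "closedin (zariski n) (cj n h ` S)" .
qed

lemma connected_solvable_cj:
  assumes h: "h \<in> carrier (GL n)" and S: "connected_solvable_subgroup n S"
  shows "connected_solvable_subgroup n (cj n h ` S)"
  unfolding connected_solvable_subgroup_def
proof (intro conjI)
  show cl: "closed_subgroup n (cj n h ` S)"
    using S h by (simp add: connected_solvable_subgroup_def closed_subgroup_cj)
  have sub: "subgroup S (GL n)"
    using S by (simp add: connected_solvable_subgroup_def closed_subgroup_def)
  show "connectedin (zariski n) (cj n h ` S)"
    using S connectedin_continuous_map_image[OF continuous_map_zariski[OF reg_map_cj[OF h]]]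
    by (auto simp: connected_solvable_subgroup_def)
  interpret cj: group_hom "GL n" "GL n" "cj n h" by (rule cj_hom[OF h])
  obtain m where m: "(derived (GL n) ^^ m) S = {1\<^sub>m n}"
    using S solvable_GL_iff[OF sub] by (auto simp: connected_solvable_subgroup_def)
  have "(derived (GL n) ^^ m) (cj n h ` S) = {1\<^sub>m n}"
    using cj.exp_of_derived_img[OF subgroup.subset[OF sub], of m] m h by (simp add: cj_def)
  then show "solvable (GL n\<lparr>carrier := cj n h ` S\<rparr>)"
    using solvable_GL_iff cl by (auto simp: closed_subgroup_def)
qed

section \<open>Tori are diagonalisable\<close>

text \<open>Used to replace an infinite commuting family of matrices by a finite one: a common eigenvector of
  matrices that span the family is an eigenvector of the whole family.\<close>

lemma exists_finite_spanning:
  fixes F :: "('a \<Rightarrow> 'k :: field) set"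
  assumes "finite X"
  shows "\<exists>S\<subseteq>F. finite S \<and> (\<forall>f\<in>F. \<exists>c. \<forall>x\<in>X. f x = (\<Sum>s\<in>S. c s * s x))"
  using assms
proof (induction X rule: finite_induct)
  case empty
  then show ?case by (intro exI[of _ "{}"]) auto
next
  case (insert x X)
  obtain S where S: "S \<subseteq> F" "finite S" "\<forall>f\<in>F. \<exists>c. \<forall>x\<in>X. f x = (\<Sum>s\<in>S. c s * s x)"
    using insert.IH by blast
  show ?case
  proof (cases "\<forall>f\<in>F. \<exists>c. \<forall>x\<in>insert x X. f x = (\<Sum>s\<in>S. c s * s x)")
    case True
    with S show ?thesis by blast
  next
    case False
    then obtain f0 where f0: "f0 \<in> F" "\<not> (\<exists>c. \<forall>x\<in>insert x X. f0 x = (\<Sum>s\<in>S. c s * s x))" by blast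
    obtain c0 where c0: "\<forall>x\<in>X. f0 x = (\<Sum>s\<in>S. c0 s * s x)" using S f0 by blast
    define d where "d = f0 x - (\<Sum>s\<in>S. c0 s * s x)"
    have d: "d \<noteq> 0" using f0(2) c0 by (auto simp: d_def)
    have f0S: "f0 \<notin> S"
    proof
      assume "f0 \<in> S"
      then have "\<forall>y\<in>insert x X. f0 y = (\<Sum>s\<in>S. (if s = f0 then 1 else 0) * s y)"
        using S(2) by (simp add: if_distrib[of "\<lambda>c. c * _"] cong: if_cong)
      then have "\<exists>c. \<forall>y\<in>insert x X. f0 y = (\<Sum>s\<in>S. c s * s y)"
        by (rule exI[of _ "\<lambda>s. if s = f0 then 1 else 0"])
      with f0(2) show False by contradiction
    qed
    have "\<exists>c. \<forall>y\<in>insert x X. f y = (\<Sum>s\<in>insert f0 S. c s * s y)" if f: "f \<in> F" for f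
    proof -
      obtain c where c: "\<forall>x\<in>X. f x = (\<Sum>s\<in>S. c s * s x)" using S f by blast
      define e where "e = (f x - (\<Sum>s\<in>S. c s * s x)) / d"
      define c' where "c' = (\<lambda>s. if s = f0 then e else c s - e * c0 s)"
      have "(\<Sum>s\<in>insert f0 S. c' s * s y) =
          e * (f0 y - (\<Sum>s\<in>S. c0 s * s y)) + (\<Sum>s\<in>S. c s * s y)" for y
      proof -
        have "(\<Sum>s\<in>insert f0 S. c' s * s y) = e * f0 y + (\<Sum>s\<in>S. (c s - e * c0 s) * s y)"
          using f0S S(2) by (auto simp: c'_def intro!: sum.cong)
        then show ?thesis by (simp add: algebra_simps sum_subtractf sum_distrib_left)
      qed
      moreover have "f y = e * (f0 y - (\<Sum>s\<in>S. c0 s * s y)) + (\<Sum>s\<in>S. c s * s y)"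
        if "y \<in> insert x X" for y
        using that c c0 d by (auto simp: e_def d_def)
      ultimately show ?thesis by (intro exI[of _ c']) auto
    qed
    then show ?thesis using S f0(1) by (intro exI[of _ "insert f0 S"]) auto
  qed
qed

text \<open>\<open>X\<^sup>N - 1\<close> splits into linear factors, and a double root would be a root of its derivative.\<close>

lemma card_roots_of_unity:
  assumes N: "of_nat N \<noteq> (0 :: 'k :: alg_closed_field)"
  shows "card {x :: 'k. x ^ N = 1} = N"
proof -
  have N0: "N > 0" using N by (cases N) auto
  let ?p = "monom (1 :: 'k) N - 1"
  have degp: "degree ?p = N"
  proof (rule antisym)
    show "degree ?p \<le> N" by (intro degree_diff_le degree_monom_le) simp
    show "N \<le> degree ?p" using N0 by (intro le_degree) simp
  qed
  then have p0: "?p \<noteq> 0" using N0 by auto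
  have lc: "lead_coeff ?p = 1" using degp N0 by simp
  obtain A where A: "size A = N" "?p = (\<Prod>x\<in>#A. [:-x, 1:])"
    using alg_closed_imp_factorization[OF p0] degp lc by auto
  have "count A x \<le> 1" for x
  proof (rule ccontr)
    assume "\<not> count A x \<le> 1"
    then have "{#x, x#} \<subseteq># A" by (auto simp: subseteq_mset_def)
    then obtain B where "A = {#x, x#} + B" using subset_mset.le_iff_add by blast
    then have p: "?p = [:-x, 1:] * ([:-x, 1:] * (\<Prod>y\<in>#B. [:-y, 1:]))" using A by simp
    have "poly ?p x = 0" by (subst p) simp
    then have x1: "x ^ N = 1" by (simp add: poly_monom)
    have "poly (pderiv ?p) x = 0" by (subst p) (simp add: pderiv_mult del: mult_pCons_left mult_pCons_right)
    then have "of_nat N * x ^ (N - 1) = 0" by (simp add: pderiv_diff pderiv_monom poly_monom)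
    with N have "x ^ (N - 1) = 0" by simp
    then have "x = 0" by simp
    with x1 N0 show False by (simp add: power_0_left)
  qed
  then have "A = mset_set (set_mset A)"
    by (intro multiset_eqI) (auto simp: count_mset_set' Suc_le_eq not_in_iff dest!: spec intro!: le_antisym)
  moreover have "set_mset A = {x. poly ?p x = 0}"
    unfolding A(2) by (auto simp: poly_prod_mset prod_mset_zero_iff)
  then have "set_mset A = {x. x ^ N = 1}" by (simp add: poly_monom)
  ultimately show ?thesis using A(1) by (metis size_mset_set)
qed

lemma sum_roots_of_unity:
  assumes N: "of_nat N \<noteq> (0 :: 'k :: alg_closed_field)" and j: "0 < j" "j < N"
  shows "(\<Sum>x | x ^ N = (1 :: 'k). x ^ j) = 0"
proof -
  have fin: "finite {x :: 'k. x ^ N = 1}" using j by (intro finite_roots_of_unity) simp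
  have "\<not> {x :: 'k. x ^ N = 1} \<subseteq> {x. x ^ j = 1}"
  proof
    assume sub: "{x :: 'k. x ^ N = 1} \<subseteq> {x. x ^ j = 1}"
    let ?p = "monom (1 :: 'k) j - 1"
    have "coeff ?p j = 1" using j by simp
    then have p0: "?p \<noteq> 0" by (metis coeff_0 zero_neq_one)
    have "N \<le> card {x :: 'k. poly ?p x = 0}"
      using card_mono[OF finite_roots_of_unity[OF j(1)] sub] card_roots_of_unity[OF N]
      by (simp add: poly_monom)
    also have "\<dots> \<le> degree ?p" by (rule card_poly_roots_bound[OF p0])
    also have "\<dots> \<le> j" by (intro degree_diff_le degree_monom_le) simp
    finally show False using j by simp
  qed
  then obtain y :: 'k where y: "y ^ N = 1" "y ^ j \<noteq> 1" by auto
  then have y0: "y \<noteq> 0" using j by (auto simp: power_0_left)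
  have "bij_betw (\<lambda>x. y * x) {x. x ^ N = 1} {x. x ^ N = 1}"
    using y y0 by (intro bij_betwI[of _ _ _ "\<lambda>x. x / y"]) (auto simp: power_mult_distrib power_divide)
  then have "(\<Sum>x | x ^ N = (1 :: 'k). x ^ j) = (\<Sum>x | x ^ N = 1. (y * x) ^ j)"
    by (rule sum.reindex_bij_betw[symmetric])
  also have "\<dots> = y ^ j * (\<Sum>x | x ^ N = 1. x ^ j)"
    by (simp add: power_mult_distrib sum_distrib_left)
  finally have "(1 - y ^ j) * (\<Sum>x | x ^ N = (1 :: 'k). x ^ j) = 0" by (simp add: algebra_simps)
  with y(2) show ?thesis by simp
qed

text \<open>Row vectors are functions on the indices below \<open>n\<close>.\<close>

definition row_act :: "nat \<Rightarrow> (nat \<Rightarrow> 'k :: field) \<Rightarrow> 'k mat \<Rightarrow> nat \<Rightarrow> 'k" where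
  "row_act n v t j = (\<Sum>i<n. v i * t $$ (i, j))"

definition row_eigen :: "nat \<Rightarrow> (nat \<Rightarrow> 'k :: field) \<Rightarrow> 'k mat \<Rightarrow> bool" where
  "row_eigen n v t \<longleftrightarrow> (\<exists>c. \<forall>j<n. row_act n v t j = c * v j)"

lemma row_act_mult:
  assumes "s \<in> carrier_mat n n" "t \<in> carrier_mat n n" "j < n"
  shows "row_act n (row_act n v s) t j = row_act n v (s * t) j"
proof -
  have "row_act n (row_act n v s) t j = (\<Sum>i<n. \<Sum>m<n. v m * s $$ (m, i) * t $$ (i, j))"
    by (simp add: row_act_def sum_distrib_right)
  also have "\<dots> = (\<Sum>m<n. \<Sum>i<n. v m * s $$ (m, i) * t $$ (i, j))" by (rule sum.swap)
  also have "\<dots> = row_act n v (s * t) j"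
    unfolding row_act_def
    by (intro sum.cong refl, subst mat_mult_entry[OF assms(1,2) _ assms(3)])
       (auto simp: sum_distrib_left mult.assoc)
  finally show ?thesis .
qed

lemma row_act_cong: "(\<And>i. i < n \<Longrightarrow> v i = w i) \<Longrightarrow> row_act n v t j = row_act n w t j"
  by (simp add: row_act_def)

text \<open>The summands are \<open>N\<^sup>-\<^sup>1 \<Sum>\<^sub>l \<zeta>\<^sup>-\<^sup>l v t\<^sup>l\<close> for the \<open>N\<close>-th roots of unity \<open>\<zeta>\<close>. Being the images of \<open>v\<close>
  under polynomials in \<open>t\<close>, they remain eigenvectors of everything that commutes with \<open>t\<close> and has
  \<open>v\<close> as an eigenvector.\<close>

lemma row_eigen_decomposition:
  fixes t :: "'k :: alg_closed_field mat"
  assumes t: "t \<in> carrier (GL n)" and N: "of_nat N \<noteq> (0 :: 'k)" "t [^]\<^bsub>GL n\<^esub> N = 1\<^sub>m n"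
  shows "\<exists>ws. (\<forall>i<n. v i = (\<Sum>w\<leftarrow>ws. w i)) \<and> (\<forall>w\<in>set ws. row_eigen n w t \<and>
     (\<forall>s\<in>carrier (GL n). s * t = t * s \<longrightarrow> row_eigen n v s \<longrightarrow> row_eigen n w s))"
proof -
  have N0: "N > 0" using N by (cases N) auto
  let ?P = "\<lambda>l. t [^]\<^bsub>GL n\<^esub> (l :: nat)"
  have P: "?P l \<in> carrier_mat n n" for l using GL.nat_pow_closed[OF t, of l] by auto
  have tm: "t \<in> carrier_mat n n" using t by auto
  define u where "u = (\<lambda>\<zeta> j. (\<Sum>l<N. inverse \<zeta> ^ l * row_act n v (?P l) j) / of_nat N)"
  let ?Z = "{x :: 'k. x ^ N = 1}"
  have finZ: "finite ?Z" using N0 by (rule finite_roots_of_unity)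
  obtain zs where zs: "set zs = ?Z" "distinct zs" using finite_distinct_list[OF finZ] by blast
  have sum_u: "v j = (\<Sum>w\<leftarrow>map u zs. w j)" if j: "j < n" for j
  proof -
    have "(\<Sum>w\<leftarrow>map u zs. w j) = (\<Sum>\<zeta>\<in>?Z. u \<zeta> j)"
      using zs by (simp add: o_def sum_list_distinct_conv_sum_set)
    also have "\<dots> = (\<Sum>l<N. (\<Sum>\<zeta>\<in>?Z. inverse \<zeta> ^ l) * row_act n v (?P l) j) / of_nat N"
      unfolding u_def sum_divide_distrib[symmetric] sum_distrib_right by (subst sum.swap) simp
    also have "(\<Sum>l<N. (\<Sum>\<zeta>\<in>?Z. inverse \<zeta> ^ l) * row_act n v (?P l) j) =
        (\<Sum>l<N. if l = 0 then of_nat N * v j else 0)"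
    proof (intro sum.cong refl)
      fix l assume l: "l \<in> {..<N}"
      show "(\<Sum>\<zeta>\<in>?Z. inverse \<zeta> ^ l) * row_act n v (?P l) j = (if l = 0 then of_nat N * v j else 0)"
      proof (cases "l = 0")
        case True
        have "row_act n v (1\<^sub>m n) j = (\<Sum>i<n. if i = j then v j else 0)"
          unfolding row_act_def using j by (intro sum.cong) auto
        with True j show ?thesis by (simp add: card_roots_of_unity[OF N(1)])
      next
        case False
        have "bij_betw inverse ?Z ?Z"
          by (intro bij_betwI[of _ _ _ inverse]) (auto simp: power_inverse)
        then have "(\<Sum>\<zeta>\<in>?Z. inverse \<zeta> ^ l) = (\<Sum>\<zeta>\<in>?Z. \<zeta> ^ l)"
          by (rule sum.reindex_bij_betw)
        also have "\<dots> = 0" using False l by (intro sum_roots_of_unity[OF N(1)]) auto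
        finally show ?thesis using False by simp
      qed
    qed
    also have "\<dots> / of_nat N = v j" using N0 N(1) by simp
    finally show ?thesis by simp
  qed
  have act_u: "row_act n (u \<zeta>) s j = (\<Sum>l<N. inverse \<zeta> ^ l * row_act n v (?P l * s) j) / of_nat N"
    if s: "s \<in> carrier_mat n n" and j: "j < n" for s \<zeta> j
  proof -
    have "row_act n (u \<zeta>) s j = (\<Sum>l<N. inverse \<zeta> ^ l * row_act n (row_act n v (?P l)) s j) / of_nat N"
    proof -
      have "row_act n (u \<zeta>) s j =
          (\<Sum>i<n. \<Sum>l<N. inverse \<zeta> ^ l * row_act n v (?P l) i * s $$ (i, j) / of_nat N)"
        unfolding row_act_def[of n "u \<zeta>"] unfolding u_def
        by (simp only: sum_divide_distrib sum_distrib_right times_divide_eq_left)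
      also have "\<dots> = (\<Sum>l<N. \<Sum>i<n. inverse \<zeta> ^ l * row_act n v (?P l) i * s $$ (i, j) / of_nat N)"
        by (rule sum.swap)
      also have "\<dots> = (\<Sum>l<N. inverse \<zeta> ^ l * row_act n (row_act n v (?P l)) s j) / of_nat N"
        unfolding row_act_def[of n "row_act n v _"]
        by (simp only: sum_divide_distrib sum_distrib_left mult.assoc)
      finally show ?thesis .
    qed
    then show ?thesis using row_act_mult[OF P s j] by simp
  qed
  have eig_t: "row_eigen n (u \<zeta>) t" if \<zeta>: "\<zeta> \<in> ?Z" for \<zeta>
    unfolding row_eigen_def
  proof (intro exI allI impI)
    fix j assume j: "j < n"
    have \<zeta>0: "\<zeta> \<noteq> 0" using \<zeta> N0 by (auto simp: power_0_left)
    let ?f = "\<lambda>l. inverse \<zeta> ^ l * row_act n v (?P l) j"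
    have "?f N = ?f 0" using N(2) \<zeta> by (simp add: power_inverse)
    then have shift: "(\<Sum>l<N. ?f (Suc l)) = (\<Sum>l<N. ?f l)"
      using sum.lessThan_Suc_shift[of ?f N] sum.lessThan_Suc[of ?f N] by simp
    have "(\<Sum>l<N. inverse \<zeta> ^ l * row_act n v (?P l * t) j) = (\<Sum>l<N. \<zeta> * ?f (Suc l))"
      using \<zeta>0 by (intro sum.cong) auto
    also have "\<dots> = \<zeta> * (\<Sum>l<N. ?f l)" unfolding sum_distrib_left[symmetric] shift ..
    finally show "row_act n (u \<zeta>) t j = \<zeta> * u \<zeta> j"
      unfolding act_u[OF tm j] by (simp add: u_def)
  qed
  have eig_s: "row_eigen n (u \<zeta>) s"
    if s: "s \<in> carrier (GL n)" and comm: "s * t = t * s" and eig: "row_eigen n v s" for \<zeta> s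
  proof -
    obtain c where c: "\<forall>j<n. row_act n v s j = c * v j" using eig by (auto simp: row_eigen_def)
    have sm: "s \<in> carrier_mat n n" using s by auto
    have com: "?P l * s = s * ?P l" for l
    proof (induction l)
      case (Suc l)
      have Pl: "?P l \<in> carrier (GL n)" using t by simp
      have "?P (Suc l) * s = ?P l * (t * s)" using Pl t s by (simp add: GL_assoc[where n = n])
      also have "\<dots> = (?P l * s) * t" using Pl t s by (simp add: comm[symmetric] GL_assoc[where n = n])
      also have "\<dots> = s * ?P (Suc l)" unfolding Suc using Pl t s by (simp add: GL_assoc[where n = n])
      finally show ?case .
    qed (use s in simp)
    have "row_act n (u \<zeta>) s j = c * u \<zeta> j" if j: "j < n" for j
    proof -
      have "row_act n v (?P l * s) j = c * row_act n v (?P l) j" for l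
      proof -
        have "row_act n v (?P l * s) j = row_act n (row_act n v s) (?P l) j"
          unfolding com by (rule row_act_mult[OF sm P j, symmetric])
        also have "\<dots> = row_act n (\<lambda>j. c * v j) (?P l) j" using c by (intro row_act_cong) auto
        finally show ?thesis by (simp add: row_act_def sum_distrib_left mult.assoc)
      qed
      then show ?thesis unfolding act_u[OF sm j] by (simp add: u_def sum_distrib_left mult.left_commute)
    qed
    then show ?thesis by (auto simp: row_eigen_def)
  qed
  show ?thesis
    using sum_u eig_t eig_s zs(1) by (intro exI[of _ "map u zs"]) auto
qed

lemma common_row_eigen_decomposition:
  fixes S :: "'k :: alg_closed_field mat set"
  assumes "finite S" "S \<subseteq> carrier (GL n)" "\<And>s t. s \<in> S \<Longrightarrow> t \<in> S \<Longrightarrow> s * t = t * s"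
    and "\<And>s. s \<in> S \<Longrightarrow> \<exists>N. of_nat N \<noteq> (0 :: 'k) \<and> s [^]\<^bsub>GL n\<^esub> N = 1\<^sub>m n"
  shows "\<exists>ws. (\<forall>i<n. v i = (\<Sum>w\<leftarrow>ws. w i)) \<and> (\<forall>w\<in>set ws. \<forall>s\<in>S. row_eigen n w s)"
  using assms
proof (induction S rule: finite_induct)
  case empty
  then show ?case by (intro exI[of _ "[v]"]) auto
next
  case (insert t S)
  have "\<exists>ws. (\<forall>i<n. v i = (\<Sum>w\<leftarrow>ws. w i)) \<and> (\<forall>w\<in>set ws. \<forall>s\<in>S. row_eigen n w s)"
    using insert.prems by (intro insert.IH) auto
  then obtain ws where ws: "\<forall>i<n. v i = (\<Sum>w\<leftarrow>ws. w i)" "\<forall>w\<in>set ws. \<forall>s\<in>S. row_eigen n w s"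
    by blast
  obtain N where N: "of_nat N \<noteq> (0 :: 'k)" "t [^]\<^bsub>GL n\<^esub> N = 1\<^sub>m n" using insert.prems by blast
  have "\<exists>us. (\<forall>i<n. w i = (\<Sum>u\<leftarrow>us. u i)) \<and> (\<forall>u\<in>set us. \<forall>s\<in>insert t S. row_eigen n u s)"
    if "w \<in> set ws" for w
  proof -
    obtain us where us: "\<forall>i<n. w i = (\<Sum>u\<leftarrow>us. u i)" "\<forall>u\<in>set us. row_eigen n u t \<and>
      (\<forall>s\<in>carrier (GL n). s * t = t * s \<longrightarrow> row_eigen n w s \<longrightarrow> row_eigen n u s)"
      using row_eigen_decomposition[OF _ N, of w] insert.prems(1) by auto
    then show ?thesis using ws(2) that insert.prems(1,2) by (intro exI[of _ us]) auto
  qed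
  then obtain U where U: "\<And>w i. w \<in> set ws \<Longrightarrow> i < n \<Longrightarrow> w i = (\<Sum>u\<leftarrow>U w. u i)"
    "\<And>w u s. w \<in> set ws \<Longrightarrow> u \<in> set (U w) \<Longrightarrow> s \<in> insert t S \<Longrightarrow> row_eigen n u s"
    by metis
  have "(\<Sum>w\<leftarrow>ws. w i) = (\<Sum>u\<leftarrow>concat (map U ws). u i)" if "i < n" for i
    using U(1)[OF _ that] by (induction ws) auto
  with ws(1) U(2) show ?case by (intro exI[of _ "concat (map U ws)"]) auto
qed

text \<open>The unit vectors are sums of common eigenvectors. Expanding the determinant of the identity
  matrix by multilinearity in the rows, some choice of one summand for each unit vector has a
  nonzero determinant, and these eigenvectors are the rows of \<open>h\<close>.\<close>

theorem simultaneous_diagonalisation: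
  fixes T :: "'k :: alg_closed_field mat set"
  assumes T: "T \<subseteq> carrier (GL n)" "\<And>s t. s \<in> T \<Longrightarrow> t \<in> T \<Longrightarrow> s * t = t * s"
    and tor: "\<And>s. s \<in> T \<Longrightarrow> \<exists>N. of_nat N \<noteq> (0 :: 'k) \<and> s [^]\<^bsub>GL n\<^esub> N = 1\<^sub>m n"
  shows "\<exists>h\<in>carrier (GL n). cj n h ` T \<subseteq> diag_group n"
proof -
  let ?X = "{..<n} \<times> {..<n}"
  let ?F = "(\<lambda>t x. t $$ x) ` T"
  obtain S0 where S0: "S0 \<subseteq> ?F" "finite S0" "\<forall>f\<in>?F. \<exists>c. \<forall>x\<in>?X. f x = (\<Sum>s\<in>S0. c s * s x)"
    using exists_finite_spanning[of ?X ?F] by auto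
  obtain S where S: "S \<subseteq> T" "finite S" "S0 = (\<lambda>t x. t $$ x) ` S"
    using finite_subset_image[OF S0(2,1)] by blast
  have eigT: "row_eigen n w t" if w: "\<forall>s\<in>S. row_eigen n w s" and t: "t \<in> T" for w t
  proof -
    have "(\<lambda>x. t $$ x) \<in> ?F" using t by blast
    with S0(3) obtain c where c: "\<forall>x\<in>?X. t $$ x = (\<Sum>s\<in>S0. c s * s x)" by blast
    have "\<forall>s\<in>S0. \<exists>e. \<forall>j<n. (\<Sum>i<n. w i * s (i, j)) = e * w j"
      using w unfolding S(3) row_eigen_def row_act_def by auto
    then obtain e where e: "\<And>s j. s \<in> S0 \<Longrightarrow> j < n \<Longrightarrow> (\<Sum>i<n. w i * s (i, j)) = e s * w j" by metis
    have "row_act n w t j = (\<Sum>s\<in>S0. c s * e s) * w j" if j: "j < n" for j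
    proof -
      have "row_act n w t j = (\<Sum>i<n. \<Sum>s\<in>S0. w i * (c s * s (i, j)))"
        unfolding row_act_def using c j by (auto simp: sum_distrib_left intro!: sum.cong)
      also have "\<dots> = (\<Sum>s\<in>S0. \<Sum>i<n. w i * (c s * s (i, j)))" by (rule sum.swap)
      also have "\<dots> = (\<Sum>s\<in>S0. c s * (\<Sum>i<n. w i * s (i, j)))"
        by (simp add: sum_distrib_left mult.left_commute)
      finally show ?thesis using e j by (simp add: sum_distrib_right mult.assoc)
    qed
    then show ?thesis by (auto simp: row_eigen_def)
  qed
  have "\<forall>l. \<exists>ws. (\<forall>i<n. (if i = l then 1 else 0 :: 'k) = (\<Sum>w\<leftarrow>ws. w i)) \<and> (\<forall>w\<in>set ws. \<forall>s\<in>S. row_eigen n w s)"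
    using S T tor by (intro allI common_row_eigen_decomposition) blast+
  then obtain W where W: "\<And>l i. i < n \<Longrightarrow> (if i = l then 1 else 0 :: 'k) = (\<Sum>w\<leftarrow>W l. w i)"
    "\<And>l w s. w \<in> set (W l) \<Longrightarrow> s \<in> S \<Longrightarrow> row_eigen n w s"
    by metis
  (* multilinearity needs a common index set, so the families W l are padded with zero vectors *)
  define M where "M = (\<Sum>l<n. length (W l))"
  have M: "length (W l) \<le> M" if "l < n" for l
    unfolding M_def using that by (intro member_le_sum) auto
  define w where "w = (\<lambda>l m. if m < length (W l) then W l ! m else (\<lambda>_. 0))"
  let ?a = "\<lambda>l m. vec n (w l m)"
  have w_eig: "row_eigen n (w l m) t" if "t \<in> T" for l m t
  proof (cases "m < length (W l)")
    case True
    then have "w l m = W l ! m" "W l ! m \<in> set (W l)" by (auto simp: w_def)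
    moreover from this have "\<forall>s\<in>S. row_eigen n (W l ! m) s" using W(2) by blast
    ultimately show ?thesis using eigT that by simp
  next
    case False
    then show ?thesis by (auto simp: w_def row_eigen_def row_act_def)
  qed
  have "mat\<^sub>r n n (\<lambda>l. finsum_vec TYPE('k) n (?a l) {..<M}) = 1\<^sub>m n"
  proof (rule eq_matI)
    fix l j assume "l < dim_row (1\<^sub>m n :: 'k mat)" "j < dim_col (1\<^sub>m n :: 'k mat)"
    then have lj: "l < n" "j < n" by auto
    have "finsum_vec TYPE('k) n (?a l) {..<M} $ j = (\<Sum>m<M. ?a l m $ j)"
      using lj by (intro index_finsum_vec) auto
    also have "\<dots> = (\<Sum>m<M. w l m j)" using lj by simp
    also have "\<dots> = (\<Sum>m<length (W l). w l m j)"
      using M[OF lj(1)] by (intro sum.mono_neutral_right) (auto simp: w_def)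
    also have "\<dots> = (\<Sum>m<length (W l). (W l ! m) j)" by (simp add: w_def)
    also have "\<dots> = (\<Sum>w\<leftarrow>W l. w j)" by (simp add: sum_list_sum_nth atLeast0LessThan)
    also have "\<dots> = (if j = l then 1 else 0)" using W(1) lj by simp
    finally show "mat\<^sub>r n n (\<lambda>l. finsum_vec TYPE('k) n (?a l) {..<M}) $$ (l, j) = 1\<^sub>m n $$ (l, j)"
      using lj by auto
  qed auto
  then have "det (mat\<^sub>r n n (\<lambda>l. finsum_vec TYPE('k) n (?a l) {..<M})) \<noteq> 0" by simp
  also have "det (mat\<^sub>r n n (\<lambda>l. finsum_vec TYPE('k) n (?a l) {..<M})) =
      (\<Sum>f\<in>{f. (\<forall>i\<in>{0..<n}. f i \<in> {..<M}) \<and> (\<forall>i. i \<notin> {0..<n} \<longrightarrow> f i = i)}. det (mat\<^sub>r n n (\<lambda>l. ?a l (f l))))"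
    by (rule det_linear_rows_sum) auto
  finally obtain f where f: "det (mat\<^sub>r n n (\<lambda>l. ?a l (f l))) \<noteq> 0"
    by (meson sum.neutral)
  let ?h = "mat\<^sub>r n n (\<lambda>l. ?a l (f l))"
  have h: "?h \<in> carrier (GL n)" using f by (auto simp: carrier_GL)
  have "cj n ?h t \<in> diag_group n" if t: "t \<in> T" for t
  proof -
    have tc: "t \<in> carrier (GL n)" using t T by auto
    have "\<forall>l. \<exists>c. \<forall>j<n. row_act n (w l (f l)) t j = c * w l (f l) j"
      using w_eig[OF t] unfolding row_eigen_def by blast
    then obtain e where e: "\<And>l j. j < n \<Longrightarrow> row_act n (w l (f l)) t j = e l * w l (f l) j"
      by metis
    have "?h * t = mat_diag n e * ?h"
    proof (rule eq_matI)
      fix i j assume "i < dim_row (mat_diag n e * ?h)" "j < dim_col (mat_diag n e * ?h)"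
      then have ij: "i < n" "j < n" by (auto simp: mat_diag_def)
      have "(?h * t) $$ (i, j) = (\<Sum>m<n. ?h $$ (i, m) * t $$ (m, j))"
        using ij tc h by (intro mat_mult_entry) auto
      also have "\<dots> = row_act n (w i (f i)) t j"
        unfolding row_act_def using ij by (intro sum.cong) auto
      also have "\<dots> = e i * w i (f i) j" by (rule e[OF ij(2)])
      also have "\<dots> = (mat_diag n e * ?h) $$ (i, j)"
        using ij by (subst mat_diag_mult_left[of _ n n]) auto
      finally show "(?h * t) $$ (i, j) = (mat_diag n e * ?h) $$ (i, j)" .
    qed (use tc in \<open>auto simp: mat_diag_def carrier_GL\<close>)
    then have *: "cj n ?h t = mat_diag n e * ?h * ginv n ?h" by (simp add: cj_def)
    also have "\<dots> = mat_diag n e * (?h * ginv n ?h)"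
      using h GL_dim[OF GL.inv_closed[OF h]] by (intro assoc_mult_mat[of _ n n _ n _ n]) auto
    also have "\<dots> = mat_diag n e" using h by (simp add: right_mult_one_mat[of _ n n])
    finally have eq: "cj n ?h t = mat_diag n e" .
    then have "\<forall>i<n. e i \<noteq> 0" using cj_closed[OF h tc] by simp
    then show ?thesis unfolding eq by (rule diag_groupI)
  qed
  with h show ?thesis by blast
qed


section \<open>Maximal tori\<close>

lemma two_neq_zero:
  assumes "algebraic_closure_of_Fq p q TYPE('k :: alg_closed_field)" "odd p"
  shows "(2 :: 'k) \<noteq> 0"
proof
  assume "(2 :: 'k) = 0"
  then have "of_nat 2 = (0 :: 'k)" by simp
  then have "p dvd 2" using closure_power(1)[OF assms(1)] by (simp only: of_nat_eq_0_iff_char_dvd)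
  then have "p \<le> 2" by (intro dvd_imp_le) auto
  with closure_power(2)[OF assms(1)] have "p = 2" by (simp add: prime_ge_2_nat le_antisym)
  with assms(2) show False by simp
qed

lemma mat_diag_commute:
  "d \<in> diag_group n \<Longrightarrow> d' \<in> diag_group n \<Longrightarrow> d * d' = d' * d"
  by (elim diag_groupE) (simp add: mult.commute)

lemma diag_group_carrier: "diag_group n \<subseteq> carrier (GL n)"
  by (auto simp: diag_group_def)

lemma subgroup_diag_group: "subgroup (diag_group n) (GL n :: 'k :: field mat monoid)"
proof (rule GL.subgroupI)
  show "diag_group n \<subseteq> carrier (GL n)" by (rule diag_group_carrier)
  have "mat_diag n (\<lambda>_. 1) \<in> (diag_group n :: 'k mat set)" by (rule diag_groupI) simp
  then show "diag_group n \<noteq> ({} :: 'k mat set)" by blast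
next
  fix a :: "'k mat" assume "a \<in> diag_group n"
  then obtain f where "a = mat_diag n f" "\<forall>i<n. f i \<noteq> 0" by (rule diag_groupE)
  then show "ginv n a \<in> diag_group n" by (simp add: inv_mat_diag diag_groupI)
next
  fix a b :: "'k mat" assume ab: "a \<in> diag_group n" "b \<in> diag_group n"
  obtain f where "a = mat_diag n f" "\<forall>i<n. f i \<noteq> 0" using ab(1) by (rule diag_groupE)
  moreover obtain f' where "b = mat_diag n f'" "\<forall>i<n. f' i \<noteq> 0" using ab(2) by (rule diag_groupE)
  ultimately show "a \<otimes>\<^bsub>GL n\<^esub> b \<in> diag_group n" by (simp add: diag_groupI)
qed

text \<open>An isomorphism with a group of diagonal matrices transports commutativity, and also the orders
  of elements: finitely many nonzero scalars are all killed by the exponent \<open>q\<^sup>m - 1\<close> for a suitable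
  \<open>m\<close>, and this number equals \<open>-1\<close> in the field.\<close>

lemma torus_commutative_torsion:
  fixes T :: "'k :: alg_closed_field mat set"
  assumes alg: "algebraic_closure_of_Fq p q TYPE('k)" and T: "torus n T"
  shows "T \<subseteq> carrier (GL n)"
    and "\<And>s t. s \<in> T \<Longrightarrow> t \<in> T \<Longrightarrow> s * t = t * s"
    and "\<And>t. t \<in> T \<Longrightarrow> \<exists>N. of_nat N \<noteq> (0 :: 'k) \<and> t [^]\<^bsub>GL n\<^esub> N = 1\<^sub>m n"
proof -
  have sub: "subgroup T (GL n)" using T by (simp add: torus_def closed_subgroup_def)
  then show car: "T \<subseteq> carrier (GL n)" by (rule subgroup.subset)
  obtain r \<phi> \<psi> where hom: "\<phi> \<in> hom (GL n\<lparr>carrier := T\<rparr>) (GL r\<lparr>carrier := diag_group r :: 'k mat set\<rparr>)"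
    and inv: "\<And>g. g \<in> T \<Longrightarrow> \<psi> (\<phi> g) = g"
    using T unfolding torus_def alg_group_isomorphic_def alg_group_morphism_def by blast
  interpret h: group_hom "GL n\<lparr>carrier := T\<rparr>" "GL r\<lparr>carrier := diag_group r\<rparr>" \<phi>
    using hom GL.subgroup_imp_group[OF sub] GL.subgroup_imp_group[OF subgroup_diag_group]
    by (simp add: group_hom_def group_hom_axioms_def)
  have \<phi>D: "\<phi> t \<in> diag_group r" if "t \<in> T" for t using h.hom_closed[of t] that by simp
  show "s * t = t * s" if st: "s \<in> T" "t \<in> T" for s t
  proof -
    have "\<phi> (s * t) = \<phi> s * \<phi> t" "\<phi> (t * s) = \<phi> t * \<phi> s"
      using h.hom_mult[of s t] h.hom_mult[of t s] st by simp_all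
    then have "\<phi> (s * t) = \<phi> (t * s)" using mat_diag_commute[OF \<phi>D \<phi>D] st by metis
    then have "\<psi> (\<phi> (s * t)) = \<psi> (\<phi> (t * s))" by simp
    then show ?thesis using inv subgroup_GL_mult[OF sub] st by simp
  qed
  show "\<exists>N. of_nat N \<noteq> (0 :: 'k) \<and> t [^]\<^bsub>GL n\<^esub> N = 1\<^sub>m n" if t: "t \<in> T" for t
  proof -
    obtain f where f: "\<phi> t = mat_diag r f" "\<forall>i<r. f i \<noteq> 0" using \<phi>D[OF t] by (rule diag_groupE)
    obtain m where m: "m > 0" "\<forall>x\<in>f ` {..<r}. x ^ (q ^ m) = x"
      using exists_power_q_fixed_finite[OF alg, of "f ` {..<r}"] by auto
    define N where "N = q ^ m - 1"
    have q0: "q ^ m > 0" using closure_power(3)[OF alg] by simp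
    have "p dvd q ^ m"
      using alg m(1) by (auto simp: algebraic_closure_of_Fq_def power_mult[symmetric] intro!: dvd_power)
    then have "of_nat (q ^ m) = (0 :: 'k)"
      using closure_power(1)[OF alg] by (simp only: of_nat_eq_0_iff_char_dvd)
    then have "of_nat (Suc N) = (0 :: 'k)" using q0 by (simp add: N_def)
    then have N0: "of_nat N \<noteq> (0 :: 'k)" by (metis add.right_neutral of_nat_Suc one_neq_zero)
    have tN: "t [^]\<^bsub>GL n\<^esub> N \<in> T" for N :: nat
      using t subgroup.one_closed[OF sub] subgroup_GL_mult[OF sub] by (induction N) auto
    have "\<phi> (t [^]\<^bsub>GL n\<^esub> l) = mat_diag r (\<lambda>i. f i ^ l)" for l :: nat
    proof (induction l)
      case 0 show ?case using h.hom_one by simp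
    next
      case (Suc l)
      then show ?case using h.hom_mult[of "t [^]\<^bsub>GL n\<^esub> l" t] t tN f by (simp add: mult.commute)
    qed
    moreover have "f i ^ N = 1" if "i < r" for i
      unfolding N_def using m(2) f(2) q0 that by (intro power_fixed_imp_torsion) auto
    then have "mat_diag r (\<lambda>i. f i ^ N) = 1\<^sub>m r"
      by (auto simp: mat_diag_def intro!: eq_matI)
    ultimately have "\<phi> (t [^]\<^bsub>GL n\<^esub> N) = \<phi> (1\<^sub>m n)" using h.hom_one by simp
    then have "\<psi> (\<phi> (t [^]\<^bsub>GL n\<^esub> N)) = \<psi> (\<phi> (1\<^sub>m n))" by simp
    then have "t [^]\<^bsub>GL n\<^esub> N = 1\<^sub>m n"
      using inv tN subgroup.one_closed[OF sub] by simp
    with N0 show ?thesis by blast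
  qed
qed

lemma closed_subgroup_diag_group: "closed_subgroup n (diag_group n :: 'k :: field mat set)"
proof -
  let ?F = "{\<lambda>g :: 'k mat. g $$ (i, j) | i j. i < n \<and> j < n \<and> i \<noteq> j}"
  have "closedin (zariski n) {g \<in> carrier (GL n). \<forall>f\<in>?F. f g = (0 :: 'k)}"
    by (rule closedin_zeros) auto
  also have "{g \<in> carrier (GL n). \<forall>f\<in>?F. f g = 0} = diag_group n"
    by (fastforce simp: diag_group_def diagonal_mat_def carrier_GL)
  finally show ?thesis by (simp add: closed_subgroup_def subgroup_diag_group)
qed

lemma alg_group_morphism_cj:
  assumes "h \<in> carrier (GL n)" "S \<subseteq> carrier (GL n)" "cj n h ` S \<subseteq> S'"
  shows "alg_group_morphism n S n S' (cj n h)"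
  unfolding alg_group_morphism_def
proof (intro conjI allI impI)
  show "cj n h \<in> hom (GL n\<lparr>carrier := S\<rparr>) (GL n\<lparr>carrier := S'\<rparr>)"
    using assms by (auto simp: hom_def subset_iff cj_mult)
next
  fix i j assume "i < n" "j < n"
  then obtain f where "f \<in> regular_funs n" "\<forall>g\<in>carrier (GL n). cj n h g $$ (i, j) = f g"
    using reg_map_cj[OF assms(1)] unfolding reg_map_def regular_on_def by blast
  then show "\<exists>f\<in>regular_funs n. \<forall>g\<in>S. cj n h g $$ (i, j) = f g" using assms(2) by blast
qed

lemma torus_cj_diag_group:
  assumes "h \<in> carrier (GL n)"
  shows "torus n (cj n h ` diag_group n)"
  unfolding torus_def alg_group_isomorphic_def
proof (intro conjI exI ballI)
  show "closed_subgroup n (cj n h ` diag_group n)"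
    by (rule closed_subgroup_cj[OF assms closed_subgroup_diag_group])
  have i: "ginv n h \<in> carrier (GL n)" using assms by simp
  have sub: "cj n h ` diag_group n \<subseteq> carrier (GL n)" using assms diag_group_carrier by fastforce
  show "alg_group_morphism n (cj n h ` diag_group n) n (diag_group n) (cj n (ginv n h))"
    using cj_image_inv(1)[OF assms diag_group_carrier] by (intro alg_group_morphism_cj i sub) simp
  show "alg_group_morphism n (diag_group n) n (cj n h ` diag_group n) (cj n h)"
    by (rule alg_group_morphism_cj[OF assms diag_group_carrier order_refl])
  show "cj n h (cj n (ginv n h) g) = g" if "g \<in> cj n h ` diag_group n" for g
    using assms sub that by auto
  show "cj n (ginv n h) (cj n h g) = g" if "g \<in> diag_group n" for g
    using assms subsetD[OF diag_group_carrier that] by simp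
qed

lemma maximal_torus_conj_diag:
  fixes T :: "'k :: alg_closed_field mat set"
  assumes alg: "algebraic_closure_of_Fq p q TYPE('k)" and T: "maximal_torus n T"
  shows "\<exists>h\<in>carrier (GL n). cj n h ` T = diag_group n"
proof -
  have tor: "torus n T" using T by (simp add: maximal_torus_def)
  note T' = torus_commutative_torsion[OF alg tor]
  obtain h where h: "h \<in> carrier (GL n)" "cj n h ` T \<subseteq> diag_group n"
    using simultaneous_diagonalisation[OF T'] by blast
  let ?S = "cj n (ginv n h) ` diag_group n"
  have "torus n ?S" using h by (intro torus_cj_diag_group) simp
  moreover have "T \<subseteq> ?S"
    using image_mono[OF h(2), of "cj n (ginv n h)"] cj_image_inv(1)[OF h(1) T'(1)] by simp
  ultimately have "?S = T" using T by (simp add: maximal_torus_def)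
  then show ?thesis using h cj_image_inv(2)[OF h(1) diag_group_carrier] by metis
qed

text \<open>A matrix that commutes with the diagonal sign matrices is diagonal in odd characteristic.\<close>

lemma maximal_torus_diag:
  assumes alg: "algebraic_closure_of_Fq p q TYPE('k :: alg_closed_field)" and odd: "odd p"
  shows "maximal_torus n (diag_group n :: 'k mat set)"
  unfolding maximal_torus_def
proof (intro conjI allI impI)
  have "cj n (1\<^sub>m n) ` diag_group n = (diag_group n :: 'k mat set)"
    using diag_group_carrier by (force simp: subset_iff)
  moreover have "torus n (cj n (1\<^sub>m n) ` diag_group n :: 'k mat set)"
    by (rule torus_cj_diag_group) simp
  ultimately show "torus n (diag_group n :: 'k mat set)" by simp
next
  fix S :: "'k mat set" assume S: "torus n S \<and> diag_group n \<subseteq> S"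
  note S' = torus_commutative_torsion[OF alg conjunct1[OF S]]
  have "s \<in> diag_group n" if s: "s \<in> S" for s
  proof -
    have sc: "s \<in> carrier (GL n)" using s S'(1) by auto
    have "s $$ (i, j) = 0" if ij: "i < n" "j < n" "i \<noteq> j" for i j
    proof -
      let ?f = "\<lambda>l. if l = i then -1 else 1 :: 'k"
      have d: "mat_diag n ?f \<in> diag_group n" by (rule diag_groupI) auto
      then have dc: "mat_diag n ?f \<in> carrier (GL n)" using diag_group_carrier by auto
      have "mat_diag n ?f * s * ginv n (mat_diag n ?f) = s"
        using S'(2)[OF _ s, of "mat_diag n ?f"] S d sc dc by auto
      with mat_diag_conj_entry[of n ?f s i j] ij sc have "- s $$ (i, j) = s $$ (i, j)" by auto
      then have "2 * s $$ (i, j) = 0" by (simp add: neg_eq_iff_add_eq_0)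
      then show ?thesis using two_neq_zero[OF alg odd] by simp
    qed
    then show ?thesis using sc by (auto simp: diag_group_def diagonal_mat_def carrier_GL)
  qed
  with S show "S = diag_group n" by blast
qed

section \<open>Triangular groups\<close>

definition triangular :: "nat \<Rightarrow> (nat \<Rightarrow> nat) \<Rightarrow> 'k :: field mat set" where
  "triangular n \<pi> = {g \<in> carrier (GL n). \<forall>i<n. \<forall>j<n. g $$ (i, j) \<noteq> 0 \<longrightarrow> \<pi> i \<le> \<pi> j}"

text \<open>In a torsion group inverses are powers.\<close>

lemma subgroup_of_torsion:
  assumes alg: "algebraic_closure_of_Fq p q TYPE('k :: alg_closed_field)"
    and "S \<subseteq> carrier (GL n)" "(1\<^sub>m n :: 'k mat) \<in> S" "\<And>g h. g \<in> S \<Longrightarrow> h \<in> S \<Longrightarrow> g * h \<in> S"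
  shows "subgroup S (GL n)"
proof (rule GL.subgroupI)
  fix g assume g: "g \<in> S"
  then have gc: "g \<in> carrier (GL n)" using assms by auto
  obtain N :: nat where N: "N > 0" "g [^]\<^bsub>GL n\<^esub> N = 1\<^sub>m n" using GL_torsion[OF alg gc] by blast
  have pow: "g [^]\<^bsub>GL n\<^esub> (l :: nat) \<in> S" for l using g assms by (induction l) auto
  have "g [^]\<^bsub>GL n\<^esub> (N - 1) * g = 1\<^sub>m n" using N by (cases N) auto
  then have "ginv n g = g [^]\<^bsub>GL n\<^esub> (N - 1)"
    using gc by (intro GL.inv_equality) auto
  then show "ginv n g \<in> S" using pow by simp
qed (use assms in auto)

lemma sum_nonzero_obtain:
  assumes "(\<Sum>m<n. f m) \<noteq> (0 :: 'k :: field)" obtains m where "m < (n :: nat)" "f m \<noteq> 0"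
  using assms by (metis lessThan_iff sum.neutral)

lemma subgroup_triangular:
  assumes alg: "algebraic_closure_of_Fq p q TYPE('k :: alg_closed_field)"
  shows "subgroup (triangular n \<pi> :: 'k mat set) (GL n)"
proof (rule subgroup_of_torsion[OF alg])
  fix g h :: "'k mat" assume g: "g \<in> triangular n \<pi>" and h: "h \<in> triangular n \<pi>"
  have "\<pi> i \<le> \<pi> j" if "i < n" "j < n" "(g * h) $$ (i, j) \<noteq> 0" for i j
  proof -
    have "(\<Sum>m<n. g $$ (i, m) * h $$ (m, j)) \<noteq> 0"
      using that g h by (subst mat_mult_entry[of _ n, symmetric]) (auto simp: triangular_def)
    then obtain m where "m < n" "g $$ (i, m) * h $$ (m, j) \<noteq> 0" by (rule sum_nonzero_obtain)
    then have "\<pi> i \<le> \<pi> m" "\<pi> m \<le> \<pi> j" using that g h by (auto simp: triangular_def)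
    then show ?thesis by simp
  qed
  then show "g * h \<in> triangular n \<pi>" using g h by (auto simp: triangular_def)
qed (auto simp: triangular_def)

text \<open>The filtration of the unipotent triangular matrices by the distance from the diagonal below
  which they agree with the identity matrix.\<close>

definition unitriangular :: "nat \<Rightarrow> (nat \<Rightarrow> nat) \<Rightarrow> nat \<Rightarrow> 'k :: field mat set" where
  "unitriangular n \<pi> k = {g \<in> carrier (GL n). \<forall>i<n. \<forall>j<n.
     g $$ (i, j) \<noteq> (if i = j then 1 else 0) \<longrightarrow> \<pi> i + k \<le> \<pi> j}"

lemma unitriangularI:
  assumes "g \<in> carrier (GL n)"
    "\<And>i j. i < n \<Longrightarrow> j < n \<Longrightarrow> \<pi> j < \<pi> i + k \<Longrightarrow> g $$ (i, j) = (if i = j then 1 else 0)"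
  shows "g \<in> unitriangular n \<pi> k"
  unfolding unitriangular_def
proof (intro CollectI conjI allI impI assms(1))
  fix i j assume "i < n" "j < n" "g $$ (i, j) \<noteq> (if i = j then 1 else 0)"
  then have "\<not> \<pi> j < \<pi> i + k" using assms(2) by blast
  then show "\<pi> i + k \<le> \<pi> j" by simp
qed

lemma unitriangularD:
  assumes "g \<in> unitriangular n \<pi> k" "k > 0" "i < n"
  shows "g $$ (i, i) = 1" "\<And>j. j < n \<Longrightarrow> i \<noteq> j \<Longrightarrow> \<pi> j < \<pi> i + k \<Longrightarrow> g $$ (i, j) = 0"
  using assms by (force simp: unitriangular_def)+

text \<open>At distance exactly \<open>k\<close> from the diagonal, multiplication is addition of entries. This is
  commutative, and so commutators lie in the next step of the filtration.\<close>

lemma unitriangular_mult_entry: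
  assumes g: "g \<in> unitriangular n \<pi> k" and h: "h \<in> unitriangular n \<pi> k" and k: "k > 0"
    and ij: "i < n" "j < n" "\<pi> j < \<pi> i + Suc k"
  shows "(g * h) $$ (i, j) = (if i = j then 1 else g $$ (i, j) + h $$ (i, j))"
proof -
  have "(g * h) $$ (i, j) = (\<Sum>m<n. g $$ (i, m) * h $$ (m, j))"
    using g h ij by (intro mat_mult_entry) (auto simp: unitriangular_def)
  also have "\<dots> = (\<Sum>m\<in>{i, j}. g $$ (i, m) * h $$ (m, j))"
  proof (rule sum.mono_neutral_right)
    show "\<forall>m\<in>{..<n} - {i, j}. g $$ (i, m) * h $$ (m, j) = 0"
    proof (rule ballI, rule ccontr)
      fix m assume m: "m \<in> {..<n} - {i, j}" "g $$ (i, m) * h $$ (m, j) \<noteq> 0"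
      then have "\<pi> i + k \<le> \<pi> m" "\<pi> m + k \<le> \<pi> j"
        using g h ij by (auto simp: unitriangular_def)
      with ij(3) k show False by simp
    qed
  qed (use ij in auto)
  finally show ?thesis using unitriangularD[OF g k] unitriangularD[OF h k] ij by auto
qed

lemma subgroup_unitriangular:
  assumes alg: "algebraic_closure_of_Fq p q TYPE('k :: alg_closed_field)" and k: "k > 0"
  shows "subgroup (unitriangular n \<pi> k :: 'k mat set) (GL n)"
proof (rule subgroup_of_torsion[OF alg])
  fix g h :: "'k mat" assume g: "g \<in> unitriangular n \<pi> k" and h: "h \<in> unitriangular n \<pi> k"
  have "(g * h) $$ (i, j) = (if i = j then 1 else 0)" if "i < n" "j < n" "\<pi> j < \<pi> i + k" for i j
    using that unitriangular_mult_entry[OF g h k, of i j]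
      unitriangularD[OF g k, of i] unitriangularD[OF h k, of i] by auto
  moreover have "g * h \<in> carrier (GL n)" using g h by (auto simp: unitriangular_def)
  ultimately show "g * h \<in> unitriangular n \<pi> k" by (intro unitriangularI)
qed (auto simp: unitriangular_def)

lemma commutator_split:
  assumes "g \<in> carrier (GL n)" "h \<in> carrier (GL n)"
  shows "(g * h * ginv n g * ginv n h) * (h * g) = g * h"
  using assms by (simp add: GL_assoc[where n = n])

lemma derived_GL_incl:
  assumes "K \<subseteq> carrier (GL n)" "subgroup L (GL n)"
    "\<And>g h. g \<in> K \<Longrightarrow> h \<in> K \<Longrightarrow> g * h * ginv n g * ginv n h \<in> L"
  shows "derived (GL n) K \<subseteq> L"
  unfolding derived_def using assms by (intro GL.generate_subgroup_incl) auto

lemma derived_unitriangular: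
  assumes alg: "algebraic_closure_of_Fq p q TYPE('k :: alg_closed_field)" and k: "k > 0"
  shows "derived (GL n) (unitriangular n \<pi> k) \<subseteq> (unitriangular n \<pi> (Suc k) :: 'k mat set)"
proof (rule derived_GL_incl)
  let ?V = "unitriangular n \<pi> k :: 'k mat set"
  have sub: "subgroup ?V (GL n)" by (rule subgroup_unitriangular[OF alg k])
  then show car: "?V \<subseteq> carrier (GL n)" by (rule subgroup.subset)
  show "subgroup (unitriangular n \<pi> (Suc k) :: 'k mat set) (GL n)"
    by (rule subgroup_unitriangular[OF alg]) simp
  fix g h assume g: "g \<in> ?V" and h: "h \<in> ?V"
  let ?c = "g * h * ginv n g * ginv n h"
  have c: "?c \<in> ?V"
    using g h subgroup_GL_mult[OF sub] subgroup.m_inv_closed[OF sub] by simp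
  have hg: "h * g \<in> ?V" using g h subgroup_GL_mult[OF sub] by simp
  have split: "?c * (h * g) = g * h" using g h car by (intro commutator_split) auto
  have "?c $$ (i, j) = (if i = j then 1 else 0)" if ij: "i < n" "j < n" "\<pi> j < \<pi> i + Suc k" for i j
  proof (cases "i = j")
    case True then show ?thesis using unitriangularD(1)[OF c k] ij by simp
  next
    case False
    have "?c $$ (i, j) + (h * g) $$ (i, j) = (g * h) $$ (i, j)"
      using unitriangular_mult_entry[OF c hg k ij] False split by simp
    also have "\<dots> = (h * g) $$ (i, j)"
      using unitriangular_mult_entry[OF g h k ij] unitriangular_mult_entry[OF h g k ij]
      by (simp add: add.commute)
    finally show ?thesis using False by simp
  qed
  then show "?c \<in> unitriangular n \<pi> (Suc k)"
    using subsetD[OF car c] by (intro unitriangularI)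
qed

lemma triangular_mult_diag:
  assumes "inj_on \<pi> {..<n}" "g \<in> triangular n \<pi>" "h \<in> triangular n \<pi>" "i < n"
  shows "(g * h) $$ (i, i) = g $$ (i, i) * h $$ (i, i)"
proof -
  have "(g * h) $$ (i, i) = (\<Sum>m<n. g $$ (i, m) * h $$ (m, i))"
    using assms by (intro mat_mult_entry) (auto simp: triangular_def)
  also have "\<dots> = (\<Sum>m<n. if m = i then g $$ (i, i) * h $$ (i, i) else 0)"
  proof (rule sum.cong[OF refl])
    fix m assume m: "m \<in> {..<n}"
    show "g $$ (i, m) * h $$ (m, i) = (if m = i then g $$ (i, i) * h $$ (i, i) else 0)"
    proof (cases "g $$ (i, m) * h $$ (m, i) = 0")
      case False
      then have "\<pi> i \<le> \<pi> m" "\<pi> m \<le> \<pi> i" using assms m by (auto simp: triangular_def)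
      then have "m = i" using inj_onD[OF assms(1), of m i] m assms(4) by auto
      then show ?thesis by simp
    qed auto
  qed
  finally show ?thesis using assms(4) by simp
qed

lemma derived_triangular:
  assumes alg: "algebraic_closure_of_Fq p q TYPE('k :: alg_closed_field)" and inj: "inj_on \<pi> {..<n}"
  shows "derived (GL n) (triangular n \<pi>) \<subseteq> (unitriangular n \<pi> 1 :: 'k mat set)"
proof (rule derived_GL_incl)
  let ?U = "triangular n \<pi> :: 'k mat set"
  have sub: "subgroup ?U (GL n)" by (rule subgroup_triangular[OF alg])
  then show car: "?U \<subseteq> carrier (GL n)" by (rule subgroup.subset)
  show "subgroup (unitriangular n \<pi> 1 :: 'k mat set) (GL n)"
    by (rule subgroup_unitriangular[OF alg]) simp
  have nz: "x $$ (i, i) \<noteq> 0" if x: "x \<in> ?U" and i: "i < n" for x i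
  proof -
    have "ginv n x \<in> ?U" by (rule subgroup.m_inv_closed[OF sub x])
    from triangular_mult_diag[OF inj x this i] have "x $$ (i, i) * (ginv n x) $$ (i, i) = 1"
      using x car i by (auto simp: subset_iff)
    then show ?thesis by auto
  qed
  fix g h assume g: "g \<in> ?U" and h: "h \<in> ?U"
  let ?c = "g * h * ginv n g * ginv n h"
  have c: "?c \<in> ?U"
    using g h subgroup_GL_mult[OF sub] subgroup.m_inv_closed[OF sub] by simp
  have hg: "h * g \<in> ?U" using g h subgroup_GL_mult[OF sub] by simp
  have split: "?c * (h * g) = g * h" using g h car by (intro commutator_split) auto
  have c1: "?c $$ (i, i) = 1" if i: "i < n" for i
  proof -
    have "?c $$ (i, i) * (h * g) $$ (i, i) = (g * h) $$ (i, i)"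
      using triangular_mult_diag[OF inj c hg i] split by simp
    also have "\<dots> = (h * g) $$ (i, i)"
      using triangular_mult_diag[OF inj g h i] triangular_mult_diag[OF inj h g i] by simp
    finally show ?thesis using nz[OF hg i] by simp
  qed
  have "\<pi> i + 1 \<le> \<pi> j" if ij: "i < n" "j < n" "?c $$ (i, j) \<noteq> (if i = j then 1 else 0)" for i j
  proof -
    have "i \<noteq> j" "?c $$ (i, j) \<noteq> 0" using ij c1 by (auto split: if_splits)
    moreover from this have "\<pi> i \<le> \<pi> j" using c ij by (auto simp: triangular_def)
    moreover have "\<pi> i \<noteq> \<pi> j" using inj_onD[OF inj, of i j] ij \<open>i \<noteq> j\<close> by auto
    ultimately show ?thesis by simp
  qed
  then show "?c \<in> unitriangular n \<pi> 1"
    using c by (auto simp: unitriangular_def triangular_def)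
qed

lemma solvable_triangular:
  assumes alg: "algebraic_closure_of_Fq p q TYPE('k :: alg_closed_field)" and inj: "inj_on \<pi> {..<n}"
  shows "solvable (GL n\<lparr>carrier := triangular n \<pi> :: 'k mat set\<rparr>)"
proof -
  let ?U = "triangular n \<pi> :: 'k mat set"
  have sub: "subgroup ?U (GL n)" by (rule subgroup_triangular[OF alg])
  have incl: "(derived (GL n) ^^ Suc k) ?U \<subseteq> unitriangular n \<pi> (Suc k)" for k
  proof (induction k)
    case 0 show ?case using derived_triangular[OF alg inj] by simp
  next
    case (Suc k)
    have "(derived (GL n) ^^ Suc (Suc k)) ?U \<subseteq> derived (GL n) (unitriangular n \<pi> (Suc k))"
      using GL.mono_derived[OF Suc] by simp
    with derived_unitriangular[OF alg, of "Suc k" n \<pi>] show ?case by auto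
  qed
  define k where "k = (\<Sum>i<n. \<pi> i)"
  have k: "\<pi> j \<le> k" if "j < n" for j unfolding k_def using that by (intro member_le_sum) auto
  have "g = 1\<^sub>m n" if g: "g \<in> unitriangular n \<pi> (Suc k)" for g :: "'k mat"
  proof (rule eq_matI)
    fix i j assume "i < dim_row (1\<^sub>m n :: 'k mat)" "j < dim_col (1\<^sub>m n :: 'k mat)"
    then have "i < n" "j < n" by auto
    moreover from k[OF this(2)] have "\<not> \<pi> i + Suc k \<le> \<pi> j" by simp
    ultimately have "g $$ (i, j) = (if i = j then 1 else 0)"
      using g unfolding unitriangular_def by blast
    then show "g $$ (i, j) = 1\<^sub>m n $$ (i, j)" using \<open>i < n\<close> \<open>j < n\<close> by simp
  qed (use g in \<open>auto simp: unitriangular_def carrier_GL\<close>)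
  with incl[of k] have "(derived (GL n) ^^ Suc k) ?U \<subseteq> {1\<^sub>m n}" by blast
  moreover have "1\<^sub>m n \<in> (derived (GL n) ^^ Suc k) ?U"
    using subgroup.one_closed[OF GL.exp_of_derived_is_subgroup[OF sub, of "Suc k"]] by simp
  ultimately have "(derived (GL n) ^^ Suc k) ?U = {1\<^sub>m n}" by blast
  then show ?thesis using solvable_GL_iff[OF sub] by blast
qed

text \<open>Otherwise \<open>1 + \<Prod>\<^sub>a (X - a)\<close> would have no root.\<close>

lemma infinite_alg_closed: "infinite (UNIV :: 'k :: alg_closed_field set)"
proof
  assume fin: "finite (UNIV :: 'k set)"
  let ?P = "(\<Prod>a\<in>(UNIV :: 'k set). [:-a, 1:])"
  have "poly ?P x = 0" for x using fin by (auto simp: poly_prod)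
  moreover have "degree (?P + 1) > 0"
  proof -
    have "degree ?P = card (UNIV :: 'k set)"
      by (subst degree_prod_eq_sum_degree) auto
    moreover have "card (UNIV :: 'k set) > 0" using fin by (simp add: card_gt_0_iff)
    ultimately show ?thesis by (subst degree_add_eq_left) auto
  qed
  then obtain x where "poly (?P + 1) x = 0" using alg_closed_imp_poly_has_root by blast
  ultimately show False by simp
qed

text \<open>On the line through two matrices a regular function is a rational function of the parameter.\<close>

lemma regular_on_line:
  fixes g h :: "'k :: field mat" and n :: nat
  defines "L \<equiv> (\<lambda>s. mat n n (\<lambda>(i, j). g $$ (i, j) + s * (h $$ (i, j) - g $$ (i, j))))"
  shows "\<exists>P. \<forall>s. det (L s) = poly P s"
    and "f \<in> regular_funs n \<Longrightarrow>
      \<exists>P Q. \<forall>s. det (L s) \<noteq> 0 \<longrightarrow> poly Q s \<noteq> 0 \<and> f (L s) = poly P s / poly Q s"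
proof -
  let ?M = "mat n n (\<lambda>(i, j). [:g $$ (i, j), h $$ (i, j) - g $$ (i, j):])"
  have det: "det (L s) = poly (det ?M) s" for s
  proof -
    interpret ev: comm_ring_hom "\<lambda>p. poly p s" by unfold_locales auto
    have "L s = map_mat (\<lambda>p. poly p s) ?M" by (auto simp: L_def intro!: eq_matI)
    then show ?thesis by simp
  qed
  then show "\<exists>P. \<forall>s. det (L s) = poly P s" by blast
  show "\<exists>P Q. \<forall>s. det (L s) \<noteq> 0 \<longrightarrow> poly Q s \<noteq> 0 \<and> f (L s) = poly P s / poly Q s"
    if "f \<in> regular_funs n"
    using that
  proof induction
    case (const c)
    show ?case by (intro exI[of _ "[:c:]"] exI[of _ 1]) simp
  next
    case (entry i j)
    then show ?case
      by (intro exI[of _ "[:g $$ (i, j), h $$ (i, j) - g $$ (i, j):]"] exI[of _ 1]) (simp add: L_def)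
  next
    case inv_det
    show ?case by (intro exI[of _ 1] exI[of _ "det ?M"]) (simp add: det divide_inverse)
  next
    case (add f1 f2)
    then obtain P1 Q1 P2 Q2 where
      "\<forall>s. det (L s) \<noteq> 0 \<longrightarrow> poly Q1 s \<noteq> 0 \<and> f1 (L s) = poly P1 s / poly Q1 s"
      "\<forall>s. det (L s) \<noteq> 0 \<longrightarrow> poly Q2 s \<noteq> 0 \<and> f2 (L s) = poly P2 s / poly Q2 s" by blast
    then show ?case
      by (intro exI[of _ "P1 * Q2 + P2 * Q1"] exI[of _ "Q1 * Q2"]) (auto simp: field_simps)
  next
    case (mult f1 f2)
    then obtain P1 Q1 P2 Q2 where
      "\<forall>s. det (L s) \<noteq> 0 \<longrightarrow> poly Q1 s \<noteq> 0 \<and> f1 (L s) = poly P1 s / poly Q1 s"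
      "\<forall>s. det (L s) \<noteq> 0 \<longrightarrow> poly Q2 s \<noteq> 0 \<and> f2 (L s) = poly P2 s / poly Q2 s" by blast
    then show ?case
      by (intro exI[of _ "P1 * P2"] exI[of _ "Q1 * Q2"]) auto
  qed
qed

text \<open>The triangular matrices are closed under affine combinations as long as these are invertible. Two
  nonempty open subsets therefore both meet the line through a point of each of them in all but
  finitely many of its points.\<close>

lemma connected_triangular:
  "connectedin (zariski n) (triangular n \<pi> :: 'k :: alg_closed_field mat set)"
  unfolding connectedin
proof (intro conjI notI)
  let ?U = "triangular n \<pi> :: 'k mat set"
  show "?U \<subseteq> topspace (zariski n)" by (auto simp: triangular_def)
  assume "\<exists>E1 E2. openin (zariski n) E1 \<and> openin (zariski n) E2 \<and> ?U \<subseteq> E1 \<union> E2 \<and>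
    E1 \<inter> E2 \<inter> ?U = {} \<and> E1 \<inter> ?U \<noteq> {} \<and> E2 \<inter> ?U \<noteq> {}"
  then obtain E1 E2 g h where E: "zariski_open n E1" "zariski_open n E2" "E1 \<inter> E2 \<inter> ?U = {}"
    and g: "g \<in> E1" "g \<in> ?U" and h: "h \<in> E2" "h \<in> ?U"
    by (auto simp: openin_zariski)
  obtain f1 where f1: "f1 \<in> regular_funs n" "f1 g \<noteq> 0" "\<And>x. x \<in> carrier (GL n) \<Longrightarrow> f1 x \<noteq> 0 \<Longrightarrow> x \<in> E1"
    using E(1) g(1) by (auto simp: zariski_open_def zero_locus_def)
  obtain f2 where f2: "f2 \<in> regular_funs n" "f2 h \<noteq> 0" "\<And>x. x \<in> carrier (GL n) \<Longrightarrow> f2 x \<noteq> 0 \<Longrightarrow> x \<in> E2"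
    using E(2) h(1) by (auto simp: zariski_open_def zero_locus_def)
  define L where "L = (\<lambda>s. mat n n (\<lambda>(i, j). g $$ (i, j) + s * (h $$ (i, j) - g $$ (i, j))))"
  have L0: "L 0 = g" and L1: "L 1 = h"
    using g h by (auto simp: L_def triangular_def carrier_GL intro!: eq_matI)
  have LU: "L s \<in> ?U" if "det (L s) \<noteq> 0" for s
    using that g h by (auto simp: triangular_def carrier_GL L_def) (metis add.right_neutral diff_0_right mult_zero_right)+
  obtain D where D: "\<And>s. det (L s) = poly D s"
    using regular_on_line(1)[of n g h] unfolding L_def by blast
  obtain P1 Q1 where 1: "\<And>s. det (L s) \<noteq> 0 \<Longrightarrow> poly Q1 s \<noteq> 0 \<and> f1 (L s) = poly P1 s / poly Q1 s"
    using regular_on_line(2)[OF f1(1), of g h] unfolding L_def by blast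
  obtain P2 Q2 where 2: "\<And>s. det (L s) \<noteq> 0 \<Longrightarrow> poly Q2 s \<noteq> 0 \<and> f2 (L s) = poly P2 s / poly Q2 s"
    using regular_on_line(2)[OF f2(1), of g h] unfolding L_def by blast
  have "poly (P1 * P2 * D) s = 0" for s
  proof (rule ccontr)
    assume nz: "poly (P1 * P2 * D) s \<noteq> 0"
    then have d: "det (L s) \<noteq> 0" using D by simp
    then have "f1 (L s) \<noteq> 0" "f2 (L s) \<noteq> 0" using 1[OF d] 2[OF d] nz by auto
    moreover have "L s \<in> carrier (GL n)" using LU[OF d] by (simp add: triangular_def)
    ultimately have "L s \<in> E1 \<inter> E2 \<inter> ?U" using f1(3) f2(3) LU[OF d] by blast
    with E(3) show False by simp
  qed
  then have "{s. poly (P1 * P2 * D) s = 0} = UNIV" by blast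
  then have "P1 * P2 * D = 0"
    using poly_roots_finite[of "P1 * P2 * D"] infinite_alg_closed[where 'k = 'k] by metis
  moreover have "det (L 0) \<noteq> 0" "det (L 1) \<noteq> 0"
    using g h unfolding L0 L1 by (auto simp: triangular_def carrier_GL)
  then have "D \<noteq> 0" "P1 \<noteq> 0" "P2 \<noteq> 0"
    using D[of 0] 1[of 0] 2[of 1] f1(2) f2(2) by (auto simp: L0 L1)
  ultimately show False by simp
qed

lemma connected_solvable_triangular:
  assumes alg: "algebraic_closure_of_Fq p q TYPE('k :: alg_closed_field)" and inj: "inj_on \<pi> {..<n}"
  shows "connected_solvable_subgroup n (triangular n \<pi> :: 'k mat set)"
proof -
  let ?F = "{\<lambda>g :: 'k mat. g $$ (i, j) | i j. i < n \<and> j < n \<and> \<not> \<pi> i \<le> \<pi> j}"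
  have "closedin (zariski n) {g \<in> carrier (GL n). \<forall>f\<in>?F. f g = (0 :: 'k)}"
    by (rule closedin_zeros) auto
  also have "{g \<in> carrier (GL n). \<forall>f\<in>?F. f g = 0} = triangular n \<pi>"
    by (auto simp: triangular_def)
  finally show ?thesis
    using subgroup_triangular[OF alg] connected_triangular solvable_triangular[OF alg inj]
    by (simp add: connected_solvable_subgroup_def closed_subgroup_def)
qed

lemma diag_group_triangular: "diag_group n \<subseteq> triangular n \<pi>"
  by (auto simp: diag_group_def triangular_def diagonal_mat_def carrier_GL) (metis order_refl)

text \<open>Elements are sorted by the number of their predecessors and, for equal numbers, by their value;
  \<open>\<pi>\<close> is the rank in this sorting.\<close>

lemma exists_linear_extension:
  assumes trans: "\<And>i j l. R i j \<Longrightarrow> R j l \<Longrightarrow> R i l" and antisym: "\<And>i j. R i j \<Longrightarrow> R j i \<Longrightarrow> i = j"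
    and dom: "\<And>i j. R i j \<Longrightarrow> i < n \<and> j < (n :: nat)"
  shows "\<exists>\<pi>. bij_betw \<pi> {..<n} {..<n} \<and> (\<forall>i j. R i j \<longrightarrow> \<pi> i \<le> \<pi> j)"
proof -
  define key where "key = (\<lambda>i. card {l. R l i \<and> l \<noteq> i} * n + i)"
  have fin: "finite {l. R l i \<and> l \<noteq> i}" for i
    by (rule finite_subset[of _ "{..<n}"]) (use dom in auto)
  have key_less: "key i < key j" if "R i j" "i \<noteq> j" for i j
  proof -
    have "{l. R l i \<and> l \<noteq> i} \<subset> {l. R l j \<and> l \<noteq> j}" using that trans antisym by blast
    then have "card {l. R l i \<and> l \<noteq> i} < card {l. R l j \<and> l \<noteq> j}" by (rule psubset_card_mono[OF fin])
    then have "card {l. R l i \<and> l \<noteq> i} * n + n \<le> card {l. R l j \<and> l \<noteq> j} * n"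
      by (metis Suc_leI add.commute mult_Suc mult_le_mono1)
    then show ?thesis using dom[OF that(1)] by (simp add: key_def)
  qed
  have key_inj: "i = j" if "key i = key j" "i < n" "j < n" for i j
  proof -
    have "key l mod n = l" if "l < n" for l using that by (simp add: key_def)
    from this[OF that(2)] this[OF that(3)] that(1) show ?thesis by metis
  qed
  define \<pi> where "\<pi> = (\<lambda>i. card {l. l < n \<and> key l < key i})"
  have less: "\<pi> i < \<pi> j" if "key i < key j" "i < n" for i j
    unfolding \<pi>_def using that by (intro psubset_card_mono) auto
  have "inj_on \<pi> {..<n}"
  proof (rule inj_onI)
    fix i j assume "i \<in> {..<n}" "j \<in> {..<n}" "\<pi> i = \<pi> j"
    then show "i = j" using less[of i j] less[of j i] key_inj[of i j]
      by (metis lessThan_iff less_irrefl nat_neq_iff)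
  qed
  moreover have "\<pi> ` {..<n} \<subseteq> {..<n}"
  proof
    fix x assume "x \<in> \<pi> ` {..<n}"
    then obtain i where i: "i < n" "x = \<pi> i" by auto
    then have "\<pi> i < card {l. l < n}" unfolding \<pi>_def by (intro psubset_card_mono) auto
    with i show "x \<in> {..<n}" by simp
  qed
  ultimately have "bij_betw \<pi> {..<n} {..<n}"
    by (simp add: bij_betw_def endo_inj_surj)
  moreover have "\<pi> i \<le> \<pi> j" if "R i j" for i j
    using less[of i j] key_less[OF that] dom[OF that] by (cases "i = j") auto
  ultimately show ?thesis by blast
qed

text \<open>Any linear extension of the partial order \<open>entry_rel\<close> is an ordering for which \<open>H\<close> is
  triangular.\<close>

theorem connected_solvable_imp_triangular:
  fixes H :: "'k :: alg_closed_field mat set"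
  assumes alg: "algebraic_closure_of_Fq p q TYPE('k)" and odd: "odd p"
    and H: "connected_solvable_subgroup n H" "diag_group n \<subseteq> H"
  shows "\<exists>\<pi>. bij_betw \<pi> {..<n} {..<n} \<and> H \<subseteq> triangular n \<pi>"
proof -
  note two = two_neq_zero[OF alg odd]
  have sub: "subgroup H (GL n)"
    using H by (simp add: connected_solvable_subgroup_def closed_subgroup_def)
  have norm: "diag_normalized n H"
    unfolding diag_normalized_def
    using H(2) subgroup_GL_mult[OF sub] subgroup.m_inv_closed[OF sub] by blast
  have dom: "entry_rel n H i j \<Longrightarrow> i < n \<and> j < n" for i j by (simp add: entry_rel_def)
  have "\<exists>\<pi>. bij_betw \<pi> {..<n} {..<n} \<and> (\<forall>i j. entry_rel n H i j \<longrightarrow> \<pi> i \<le> \<pi> j)"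
  proof (rule exists_linear_extension)
    show "entry_rel n H i l" if "entry_rel n H i j" "entry_rel n H j l" for i j l
      using that by (rule entry_rel_trans[OF two sub norm])
    show "i = j" if "entry_rel n H i j" "entry_rel n H j i" for i j
      using that by (rule entry_rel_antisym[OF alg two H])
  qed (rule dom)
  then obtain \<pi> where \<pi>: "bij_betw \<pi> {..<n} {..<n}" "\<And>i j. entry_rel n H i j \<Longrightarrow> \<pi> i \<le> \<pi> j"
    by blast
  have "H \<subseteq> triangular n \<pi>"
    using \<pi>(2) subgroup.subset[OF sub] by (auto simp: triangular_def entry_rel_def)
  with \<pi>(1) show ?thesis by blast
qed

definition elementary :: "nat \<Rightarrow> nat \<Rightarrow> nat \<Rightarrow> 'k :: field mat" where
  "elementary n i j = mat n n (\<lambda>(a, b). if a = b \<or> a = i \<and> b = j then 1 else 0)"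

lemma elementary_GL:
  assumes "i \<noteq> j" "i < n" "j < n"
  shows "(elementary n i j :: 'k :: field mat) \<in> carrier (GL n)"
proof -
  have "elementary n i j = (addrow_mat n 1 i j :: 'k mat)"
    using assms(1) by (intro eq_matI) (auto simp: elementary_def addrow_mat_def)
  then have "det (elementary n i j :: 'k mat) = 1" using det_addrow_mat[OF assms(1)] by simp
  then show ?thesis by (simp add: carrier_GL elementary_def)
qed

lemma elementary_triangular:
  assumes "i \<noteq> j" "i < n" "j < n" "\<pi> i \<le> \<pi> j"
  shows "elementary n i j \<in> triangular n \<pi>"
  using elementary_GL[OF assms(1-3)] assms by (auto simp: triangular_def elementary_def)

text \<open>For an overgroup, \<open>entry_rel\<close> contains the usual order because of the elementary matrices, and
  being antisymmetric it cannot contain more.\<close>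

lemma borel_triangular:
  assumes alg: "algebraic_closure_of_Fq p q TYPE('k :: alg_closed_field)" and odd: "odd p"
  shows "borel_subgroup n (triangular n (\<lambda>i. i) :: 'k mat set)"
  unfolding borel_subgroup_def
proof (intro conjI allI impI)
  let ?U = "triangular n (\<lambda>i. i) :: 'k mat set"
  show "connected_solvable_subgroup n ?U"
    by (rule connected_solvable_triangular[OF alg]) simp
  fix H :: "'k mat set" assume H: "connected_solvable_subgroup n H \<and> ?U \<subseteq> H"
  then have D: "diag_group n \<subseteq> H" using diag_group_triangular by blast
  have sub: "subgroup H (GL n)"
    using H by (simp add: connected_solvable_subgroup_def closed_subgroup_def)
  have "H \<subseteq> ?U"
  proof
    fix g assume g: "g \<in> H"
    have "i \<le> j" if ij: "i < n" "j < n" "g $$ (i, j) \<noteq> 0" for i j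
    proof (rule ccontr)
      assume nle: "\<not> i \<le> j"
      have "elementary n j i \<in> H"
        using elementary_triangular[of j i n "\<lambda>i. i"] nle ij H by auto
      moreover have "elementary n j i $$ (j, i) \<noteq> (0 :: 'k)" using ij by (simp add: elementary_def)
      ultimately have "entry_rel n H j i" using ij unfolding entry_rel_def by blast
      moreover have "entry_rel n H i j" using ij g by (auto simp: entry_rel_def)
      ultimately have "i = j"
        using entry_rel_antisym[OF alg two_neq_zero[OF alg odd] conjunct1[OF H] D] by blast
      with nle show False by simp
    qed
    then show "g \<in> ?U" using g subgroup.subset[OF sub] by (auto simp: triangular_def)
  qed
  with H show "H = ?U" by blast
qed


section \<open>Bilinear forms normalising a torus and a Borel subgroup\<close>

text \<open>The map \<open>X \<mapsto> A X\<^sup>-\<^sup>T A\<^sup>-\<^sup>1\<close>, for an arbitrary Gram matrix \<open>A\<close>.\<close>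

abbreviation tw :: "nat \<Rightarrow> 'k :: field mat \<Rightarrow> 'k mat \<Rightarrow> 'k mat" where
  "tw \<equiv> twisted_inv_transpose"

lemma tw_closed [simp]:
  "A \<in> carrier (GL n) \<Longrightarrow> X \<in> carrier (GL n) \<Longrightarrow> tw n A X \<in> carrier (GL n)"
  by (simp add: twisted_inv_transpose_def)

lemma inv_transpose_GL_rev:
  "g \<in> carrier (GL n) \<Longrightarrow> transpose_mat (ginv n g) = ginv n (transpose_mat g)"
  by (simp add: inv_transpose_GL)

lemmas tw_simps = twisted_inv_transpose_def inv_transpose_GL_rev transpose_mult_GL[where n = n]
  GL_inv_mult[where n = n] GL_assoc[where n = n] for n

lemma tw_mult:
  assumes "A \<in> carrier (GL n)" "X \<in> carrier (GL n)" "Y \<in> carrier (GL n)"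
  shows "tw n A (X * Y) = tw n A X * tw n A Y"
  using assms by (simp add: tw_simps[where n = n])

lemma tw_congruence:
  assumes "A \<in> carrier (GL n)" "X \<in> carrier (GL n)" "h \<in> carrier (GL n)"
  shows "tw n (h * A * transpose_mat h) (cj n h X) = cj n h (tw n A X)"
  using assms by (simp add: cj_def tw_simps[where n = n])

lemma tw_tw_transpose:
  assumes "A \<in> carrier (GL n)" "Y \<in> carrier (GL n)"
  shows "tw n A (tw n (transpose_mat A) Y) = Y"
  using assms by (simp add: tw_simps[where n = n])

definition congruent_forms :: "nat \<Rightarrow> 'k :: field mat \<Rightarrow> 'k mat \<Rightarrow> bool" where
  "congruent_forms n A B \<longleftrightarrow> (\<exists>h\<in>carrier (GL n). B = h * A * transpose_mat h)"

lemma congruent_forms_trans: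
  assumes "A \<in> carrier (GL n)" "congruent_forms n A B" "congruent_forms n B C"
  shows "congruent_forms n A C"
proof -
  obtain h h' where h: "h \<in> carrier (GL n)" "B = h * A * transpose_mat h"
    and h': "h' \<in> carrier (GL n)" "C = h' * B * transpose_mat h'"
    using assms by (auto simp: congruent_forms_def)
  then have "C = (h' * h) * A * transpose_mat (h' * h)"
    using assms(1) by (simp add: GL_assoc[where n = n] transpose_mult_GL[where n = n])
  then show ?thesis using h h' unfolding congruent_forms_def by (intro bexI[of _ "h' * h"]) auto
qed

lemma congruent_forms_sym:
  assumes "A \<in> carrier (GL n)" "congruent_forms n A B"
  shows "congruent_forms n B A"
proof -
  obtain h where h: "h \<in> carrier (GL n)" "B = h * A * transpose_mat h"
    using assms by (auto simp: congruent_forms_def)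
  then have "ginv n h * B * transpose_mat (ginv n h) = A"
    using assms(1) by (simp add: GL_assoc[where n = n] inv_transpose_GL_rev)
  then show ?thesis using h unfolding congruent_forms_def
    by (intro bexI[of _ "ginv n h"]) auto
qed

definition antidiagonal :: "nat \<Rightarrow> 'k :: field mat \<Rightarrow> bool" where
  "antidiagonal n A \<longleftrightarrow> A \<in> carrier (GL n) \<and> (\<forall>i<n. \<forall>j<n. A $$ (i, j) \<noteq> 0 \<longrightarrow> i + j + 1 = n)"

definition monomial :: "nat \<Rightarrow> (nat \<Rightarrow> nat) \<Rightarrow> (nat \<Rightarrow> 'k :: field) \<Rightarrow> 'k mat" where
  "monomial n w x = mat n n (\<lambda>(i, j). if j = w i then x i else 0)"

lemma monomial_GL:
  assumes w: "bij_betw w {..<n} {..<n}" and x: "\<And>i. i < n \<Longrightarrow> x i \<noteq> 0"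
  shows "monomial n w x \<in> carrier (GL n)"
proof -
  let ?Y = "mat n n (\<lambda>(i, j). if i = w j then inverse (x j) else 0)"
  have wn: "w i < n" if "i < n" for i using bij_betwE[OF w] that by auto
  have wi: "w i = w j \<longleftrightarrow> i = j" if "i < n" "j < n" for i j
    using bij_betw_imp_inj_on[OF w] that by (auto simp: inj_on_def)
  have "monomial n w x * ?Y = 1\<^sub>m n"
  proof (rule eq_matI)
    fix i j assume "i < dim_row (1\<^sub>m n :: 'a mat)" "j < dim_col (1\<^sub>m n :: 'a mat)"
    then have ij: "i < n" "j < n" by auto
    have "(monomial n w x * ?Y) $$ (i, j) = (\<Sum>m<n. monomial n w x $$ (i, m) * ?Y $$ (m, j))"
      using ij by (intro mat_mult_entry) (auto simp: monomial_def)
    also have "\<dots> = (\<Sum>m<n. if m = w i then (if w i = w j then x i * inverse (x j) else 0) else 0)"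
      using ij by (intro sum.cong) (auto simp: monomial_def)
    also have "\<dots> = 1\<^sub>m n $$ (i, j)" using ij wn wi x by simp
    finally show "(monomial n w x * ?Y) $$ (i, j) = 1\<^sub>m n $$ (i, j)" .
  qed (auto simp: monomial_def)
  then have "det (monomial n w x) * det ?Y = 1"
    by (subst det_mult[symmetric, of _ n]) (auto simp: monomial_def)
  then show ?thesis by (auto simp: carrier_GL monomial_def)
qed

lemma monomial_congruence_entry:
  assumes w: "\<And>i. i < n \<Longrightarrow> w i < n" and B: "B \<in> carrier_mat n n" and ij: "i < n" "j < n"
  shows "(monomial n w x * B * transpose_mat (monomial n w x)) $$ (i, j) = x i * x j * B $$ (w i, w j)"
proof -
  let ?h = "monomial n w x"
  have h: "?h \<in> carrier_mat n n" by (simp add: monomial_def)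
  have hB: "(?h * B) $$ (i, m) = x i * B $$ (w i, m)" if "m < n" for m
  proof -
    have "(?h * B) $$ (i, m) = (\<Sum>l<n. ?h $$ (i, l) * B $$ (l, m))"
      using h B ij that by (intro mat_mult_entry)
    also have "\<dots> = (\<Sum>l<n. if l = w i then x i * B $$ (w i, m) else 0)"
      using ij by (intro sum.cong) (auto simp: monomial_def)
    finally show ?thesis using w ij by simp
  qed
  have ht: "transpose_mat ?h $$ (m, j) = (if m = w j then x j else 0)" if "m < n" for m
    using ij that by (simp add: monomial_def)
  have "(?h * B * transpose_mat ?h) $$ (i, j) = (\<Sum>m<n. (?h * B) $$ (i, m) * transpose_mat ?h $$ (m, j))"
    using h B ij by (intro mat_mult_entry) auto
  also have "\<dots> = (\<Sum>m<n. if m = w j then x i * x j * B $$ (w i, w j) else 0)"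
    using ij by (intro sum.cong) (auto simp: hB ht)
  finally show ?thesis using w ij by simp
qed

lemma antitone_eq_reversal:
  assumes anti: "\<And>x y. x < y \<Longrightarrow> y < n \<Longrightarrow> f y < f x" and bound: "\<And>x. x < n \<Longrightarrow> f x < (n :: nat)"
    and x: "x < n"
  shows "f x + x + 1 = n"
proof -
  have up: "f x + x < n" if "x < n" for x
    using that
  proof (induction x)
    case 0 then show ?case using bound by simp
  next
    case (Suc x) then show ?case using anti[of x "Suc x"] by simp
  qed
  have down: "k \<le> f (n - 1 - k)" if "k < n" for k
    using that
  proof (induction k)
    case (Suc k)
    then have "n - 1 - Suc k < n - 1 - k" "n - 1 - k < n" by simp_all
    from anti[OF this] Suc show ?case by simp
  qed simp
  from up[OF x] down[of "n - 1 - x"] x show ?thesis by simp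
qed

lemma GL_row_nonzero:
  assumes "A \<in> carrier (GL n)" "i < n" obtains j where "j < n" "A $$ (i, j) \<noteq> 0"
proof -
  have "(\<Sum>m<n. A $$ (i, m) * (ginv n A) $$ (m, i)) = 1"
    using assms GL_dim[OF GL.inv_closed[OF assms(1)]]
    by (subst mat_mult_entry[of _ n, symmetric]) auto
  then have "(\<Sum>m<n. A $$ (i, m) * (ginv n A) $$ (m, i)) \<noteq> 0" by simp
  then obtain m where "m < n" "A $$ (i, m) * (ginv n A) $$ (m, i) \<noteq> 0" by (rule sum_nonzero_obtain)
  then show ?thesis using that by auto
qed

lemma GL_col_nonzero:
  assumes "A \<in> carrier (GL n)" "j < n" obtains i where "i < n" "A $$ (i, j) \<noteq> 0"
proof -
  obtain i where "i < n" "transpose_mat A $$ (j, i) \<noteq> 0"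
    using GL_row_nonzero[OF transpose_GL[OF assms(1)] assms(2)] .
  then show ?thesis using that assms by (auto simp: carrier_GL)
qed

lemma tw_mat_diag_entry:
  assumes A: "A \<in> carrier (GL n)" and f: "\<forall>i<n. f i \<noteq> 0" and f': "tw n A (mat_diag n f) = mat_diag n f'"
    and ij: "i < n" "j < n" "A $$ (i, j) \<noteq> 0"
  shows "f' i = inverse (f j)"
proof -
  let ?d = "mat_diag n (\<lambda>i. inverse (f i))"
  have dt: "transpose_mat (ginv n (mat_diag n f)) = ?d"
    unfolding inv_mat_diag[OF f] by (auto simp: mat_diag_def intro!: eq_matI)
  have d: "?d \<in> carrier (GL n)" using f by simp
  have "mat_diag n f' * A = A * ?d"
    unfolding f'[symmetric] twisted_inv_transpose_def dt using A d by simp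
  then have "(mat_diag n f' * A) $$ (i, j) = (A * ?d) $$ (i, j)" by simp
  then have "f' i * A $$ (i, j) = A $$ (i, j) * inverse (f j)"
    using A ij by (simp add: mat_diag_mult_left[of _ n n] mat_diag_mult_right[of _ n n] carrier_GL)
  with ij(3) show ?thesis by simp
qed

text \<open>Preserving the diagonal matrices forces \<open>A\<close> to have one nonzero entry in each row and column.
  Since \<open>X \<mapsto> X\<^sup>-\<^sup>T\<close> exchanges the two triangular groups, the corresponding permutation must reverse
  the order of the basis, as one sees on elementary matrices.\<close>

lemma normalizing_form_reverses:
  fixes A :: "'k :: alg_closed_field mat"
  assumes alg: "algebraic_closure_of_Fq p q TYPE('k)" and two: "(2 :: 'k) \<noteq> 0"
    and A: "A \<in> carrier (GL n)" and \<pi>: "bij_betw \<pi> {..<n} {..<n}"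
    and D: "tw n A ` diag_group n = diag_group n"
    and U: "tw n A ` triangular n \<pi> = triangular n \<pi>"
    and ij: "i < n" "j < n" "A $$ (i, j) \<noteq> 0"
  shows "\<pi> i + \<pi> j + 1 = n"
proof -
  have one: "(1 :: 'k) \<noteq> -1" using two by (metis add.right_inverse one_add_one)
  have \<pi>n: "\<pi> a < n" if "a < n" for a using bij_betwE[OF \<pi>] that by auto
  have \<pi>i: "a = b" if "\<pi> a = \<pi> b" "a < n" "b < n" for a b
    using bij_betw_imp_inj_on[OF \<pi>] that by (auto simp: inj_on_def)
  have sign: "mat_diag n (\<lambda>l. if l = m then -1 else 1 :: 'k) \<in> diag_group n" for m
    by (rule diag_groupI) auto
  have row: "j = l" if "a < n" "j < n" "l < n" "A $$ (a, j) \<noteq> 0" "A $$ (a, l) \<noteq> 0" for a j l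
  proof (rule ccontr)
    assume neq: "j \<noteq> l"
    let ?f = "\<lambda>m. if m = j then -1 else 1 :: 'k"
    have "tw n A (mat_diag n ?f) \<in> diag_group n" using D sign by blast
    then obtain f' where f': "tw n A (mat_diag n ?f) = mat_diag n f'" by (rule diag_groupE)
    have "f' a = inverse (?f j)" "f' a = inverse (?f l)"
      using that by (intro tw_mat_diag_entry[OF A _ f']; simp)+
    with neq one show False by simp
  qed
  have col: "a = b" if "a < n" "b < n" "j < n" "A $$ (a, j) \<noteq> 0" "A $$ (b, j) \<noteq> 0" for a b j
  proof (rule ccontr)
    assume neq: "a \<noteq> b"
    let ?f' = "\<lambda>m. if m = a then -1 else 1 :: 'k"
    have "mat_diag n ?f' \<in> tw n A ` diag_group n" using D sign by blast
    then obtain d where d: "d \<in> diag_group n" "tw n A d = mat_diag n ?f'" by force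
    obtain f where f: "d = mat_diag n f" "\<forall>i<n. f i \<noteq> 0" using d(1) by (rule diag_groupE)
    have "?f' a = inverse (f j)" "?f' b = inverse (f j)"
      using that d(2) f(1) by (intro tw_mat_diag_entry[OF A f(2)]; simp)+
    with neq one show False by simp
  qed
  have subU: "subgroup (triangular n \<pi> :: 'k mat set) (GL n)" by (rule subgroup_triangular[OF alg])
  have rev: "\<pi> a < \<pi> b" if jl: "\<pi> l < \<pi> j" and n: "a < n" "b < n" "j < n" "l < n"
    and nz: "A $$ (a, j) \<noteq> 0" "A $$ (b, l) \<noteq> 0" for a b j l
  proof -
    have neq: "l \<noteq> j" using jl by auto
    let ?e = "elementary n l j :: 'k mat"
    have e: "?e \<in> triangular n \<pi>" using neq n jl by (intro elementary_triangular) auto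
    have ec: "?e \<in> carrier (GL n)" using neq n by (intro elementary_GL) auto
    let ?x = "ginv n ?e"
    have "?x \<in> triangular n \<pi>" by (rule subgroup.m_inv_closed[OF subU e])
    then have v: "tw n A ?x \<in> triangular n \<pi>" using U by blast
    let ?v = "tw n A ?x"
    have vc: "?v \<in> carrier (GL n)" using A ec by simp
    have "?v * A = A * transpose_mat ?e"
      using A ec by (simp add: twisted_inv_transpose_def)
    then have "(?v * A) $$ (a, l) = (A * transpose_mat ?e) $$ (a, l)" by simp
    also have "\<dots> = (\<Sum>m<n. A $$ (a, m) * transpose_mat ?e $$ (m, l))"
      using A ec n by (intro mat_mult_entry) auto
    also have "\<dots> = (\<Sum>m<n. if m = j then A $$ (a, j) else 0)"
    proof (rule sum.cong[OF refl])
      fix m assume m: "m \<in> {..<n}"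
      have "A $$ (a, m) = 0" if "m \<noteq> j" using row[of a j m] n nz that m by auto
      then show "A $$ (a, m) * transpose_mat ?e $$ (m, l) = (if m = j then A $$ (a, j) else 0)"
        using m n by (auto simp: elementary_def)
    qed
    also have "\<dots> = A $$ (a, j)" using n by simp
    finally have "(?v * A) $$ (a, l) \<noteq> 0" using nz by simp
    moreover have "(?v * A) $$ (a, l) = (\<Sum>m<n. ?v $$ (a, m) * A $$ (m, l))"
      using A vc n by (intro mat_mult_entry) auto
    ultimately have "(\<Sum>m<n. ?v $$ (a, m) * A $$ (m, l)) \<noteq> 0" by simp
    then obtain m where m: "m < n" "?v $$ (a, m) * A $$ (m, l) \<noteq> 0" by (rule sum_nonzero_obtain)
    then have "m = b" using col[of m b l] n nz by auto
    then have "\<pi> a \<le> \<pi> b" using v m n by (auto simp: triangular_def)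
    moreover have "a \<noteq> b" using row[of a j l] nz n neq by auto
    then have "\<pi> a \<noteq> \<pi> b" using \<pi>i n by blast
    ultimately show ?thesis by simp
  qed
  define u where "u = inv_into {..<n} \<pi>"
  have u: "u y < n" "\<pi> (u y) = y" if "y < n" for y
    using that bij_betw_inv_into_right[OF \<pi>, of y] bij_betwE[OF bij_betw_inv_into[OF \<pi>]]
    by (auto simp: u_def)
  have "\<forall>y. \<exists>a. y < n \<longrightarrow> a < n \<and> A $$ (a, u y) \<noteq> 0"
    using GL_col_nonzero[OF A u(1)] by metis
  then obtain c where c: "\<And>y. y < n \<Longrightarrow> c y < n" "\<And>y. y < n \<Longrightarrow> A $$ (c y, u y) \<noteq> 0" by metis
  have "\<pi> (c y) + y + 1 = n" if "y < n" for y
  proof (rule antitone_eq_reversal[where f = "\<lambda>y. \<pi> (c y)"])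
    fix x y assume xy: "x < y" "y < n"
    then have x: "x < n" by simp
    show "\<pi> (c y) < \<pi> (c x)"
    proof (rule rev)
      show "\<pi> (u x) < \<pi> (u y)" using xy u(2)[OF x] u(2)[OF xy(2)] by simp
    qed (intro c u(1) x xy(2))+
  next
    fix x assume "x < n" then show "\<pi> (c x) < n" by (rule \<pi>n[OF c(1)])
  qed (rule that)
  from this[of "\<pi> j"] have "\<pi> (c (\<pi> j)) + \<pi> j + 1 = n" using \<pi>n ij by simp
  moreover have "u (\<pi> j) = j" using u[OF \<pi>n] \<pi>i \<pi>n ij by blast
  then have "c (\<pi> j) = i"
    using col[of "c (\<pi> j)" i j] c(1)[OF \<pi>n[OF ij(2)]] c(2)[OF \<pi>n[OF ij(2)]] ij by simp
  ultimately show ?thesis by simp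
qed

lemma normalizing_form_imp_antidiagonal:
  fixes A :: "'k :: alg_closed_field mat"
  assumes alg: "algebraic_closure_of_Fq p q TYPE('k)" and odd: "odd p"
    and A: "A \<in> carrier (GL n)"
    and T: "maximal_torus n T" "tw n A ` T = T"
    and B: "borel_subgroup n B" "T \<subseteq> B" "tw n A ` B = B"
  shows "\<exists>A'. congruent_forms n A A' \<and> antidiagonal n A'"
proof -
  obtain h where h: "h \<in> carrier (GL n)" "cj n h ` T = diag_group n"
    using maximal_torus_conj_diag[OF alg T(1)] by blast
  let ?A = "h * A * transpose_mat h"
  have A1: "?A \<in> carrier (GL n)" using h A by simp
  have Bcs: "connected_solvable_subgroup n B" using B by (simp add: borel_subgroup_def)
  then have Bcar: "B \<subseteq> carrier (GL n)"
    by (auto simp: connected_solvable_subgroup_def closed_subgroup_def dest: subgroup.subset)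
  have Tcar: "T \<subseteq> carrier (GL n)" using Bcar B by blast
  let ?B = "cj n h ` B"
  have "diag_group n \<subseteq> ?B" using h(2) B(2) by blast
  then obtain \<pi> where \<pi>: "bij_betw \<pi> {..<n} {..<n}" "?B \<subseteq> triangular n \<pi>"
    using connected_solvable_imp_triangular[OF alg odd connected_solvable_cj[OF h(1) Bcs]] by blast
  let ?U = "triangular n \<pi> :: 'k mat set"
  have Ucar: "?U \<subseteq> carrier (GL n)" by (auto simp: triangular_def)
  have "connected_solvable_subgroup n (cj n (ginv n h) ` ?U)"
    using h(1) by (intro connected_solvable_cj connected_solvable_triangular[OF alg]
      bij_betw_imp_inj_on[OF \<pi>(1)]) simp
  moreover have "B \<subseteq> cj n (ginv n h) ` ?U"
    using image_mono[OF \<pi>(2), of "cj n (ginv n h)"] cj_image_inv(1)[OF h(1) Bcar] by simp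
  ultimately have "cj n (ginv n h) ` ?U = B" using B(1) by (simp add: borel_subgroup_def)
  then have BU: "?B = ?U" using cj_image_inv(2)[OF h(1) Ucar] by simp
  have tw_image: "tw n ?A ` cj n h ` S = cj n h ` S" if "S \<subseteq> carrier (GL n)" "tw n A ` S = S" for S
  proof -
    have "tw n ?A ` cj n h ` S = cj n h ` tw n A ` S"
      unfolding image_image using that(1) A h by (intro image_cong refl tw_congruence) auto
    with that(2) show ?thesis by simp
  qed
  have rev: "\<pi> i + \<pi> j + 1 = n" if "i < n" "j < n" "?A $$ (i, j) \<noteq> 0" for i j
    using normalizing_form_reverses[OF alg two_neq_zero[OF alg odd] A1 \<pi>(1) _ _ that]
      tw_image[OF Tcar T(2)] tw_image[OF Bcar B(3)] unfolding h(2) BU by blast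
  define w where "w = inv_into {..<n} \<pi>"
  have w: "bij_betw w {..<n} {..<n}" unfolding w_def by (rule bij_betw_inv_into[OF \<pi>(1)])
  have \<pi>w: "\<pi> (w i) = i" if "i < n" for i
    unfolding w_def using that bij_betw_inv_into_right[OF \<pi>(1)] by auto
  have wn: "w i < n" if "i < n" for i using bij_betwE[OF w] that by auto
  let ?P = "monomial n w (\<lambda>_. 1 :: 'k)"
  have P: "?P \<in> carrier (GL n)" using w by (rule monomial_GL) simp
  let ?A' = "?P * ?A * transpose_mat ?P"
  have "antidiagonal n ?A'"
    unfolding antidiagonal_def
  proof (intro conjI allI impI)
    show "?A' \<in> carrier (GL n)" using P A1 by simp
    fix i j assume ij: "i < n" "j < n" "?A' $$ (i, j) \<noteq> 0"
    have "?A' $$ (i, j) = 1 * 1 * ?A $$ (w i, w j)"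
      using A1 ij wn by (intro monomial_congruence_entry) auto
    with ij rev[of "w i" "w j"] \<pi>w wn show "i + j + 1 = n" by simp
  qed
  moreover have "congruent_forms n A ?A" "congruent_forms n ?A ?A'"
    unfolding congruent_forms_def using h(1) P by blast+
  then have "congruent_forms n A ?A'" by (rule congruent_forms_trans[OF A])
  ultimately show ?thesis by blast
qed

lemma reversal_monomial_antidiagonal:
  assumes "\<And>i. i < n \<Longrightarrow> x i \<noteq> 0"
  shows "antidiagonal n (monomial n (\<lambda>i. n - 1 - i) x)"
proof -
  have "bij_betw (\<lambda>i. n - 1 - i) {..<n} {..<n}" by (intro bij_betwI[of _ _ _ "\<lambda>i. n - 1 - i"]) auto
  then have "monomial n (\<lambda>i. n - 1 - i) x \<in> carrier (GL n)" using assms by (rule monomial_GL)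
  then show ?thesis by (auto simp: antidiagonal_def monomial_def split: if_splits)
qed

lemma antidiagonalD:
  assumes "antidiagonal n A" "i < n" "j < n" "A $$ (i, j) \<noteq> 0"
  shows "i + j + 1 = n"
  using assms unfolding antidiagonal_def by blast

lemma antidiagonal_nonzero:
  assumes "antidiagonal n A" "i < n"
  shows "A $$ (i, n - 1 - i) \<noteq> 0"
proof -
  obtain j where "j < n" "A $$ (i, j) \<noteq> 0"
    using assms GL_row_nonzero[of A n i] by (auto simp: antidiagonal_def)
  moreover from antidiagonalD[OF assms this] have "j = n - 1 - i" by simp
  ultimately show ?thesis by simp
qed

lemma antidiagonal_entry:
  assumes "antidiagonal n A" "i < n" "j < n" "j \<noteq> n - 1 - i"
  shows "A $$ (i, j) = 0"
proof (rule ccontr)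
  assume "A $$ (i, j) \<noteq> 0"
  from antidiagonalD[OF assms(1-3) this] assms(4) show False by simp
qed

lemma antidiagonal_transpose:
  assumes A: "antidiagonal n A"
  shows "antidiagonal n (transpose_mat A)"
proof -
  have Ac: "A \<in> carrier (GL n)" using A by (simp add: antidiagonal_def)
  have "i + j + 1 = n" if "i < n" "j < n" "transpose_mat A $$ (i, j) \<noteq> 0" for i j
    using antidiagonalD[OF A that(2,1)] GL_dim[OF Ac] that by auto
  with Ac show ?thesis by (simp add: antidiagonal_def)
qed

lemma antidiagonal_mult_entry:
  assumes A: "antidiagonal n A" and B: "B \<in> carrier_mat n n" and ij: "i < n" "j < n"
  shows "(A * B) $$ (i, j) = A $$ (i, n - 1 - i) * B $$ (n - 1 - i, j)"
    and "(B * A) $$ (i, j) = B $$ (i, n - 1 - j) * A $$ (n - 1 - j, j)"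
proof -
  have Ac: "A \<in> carrier_mat n n" using A by (auto simp: antidiagonal_def)
  have "(A * B) $$ (i, j) = (\<Sum>m<n. A $$ (i, m) * B $$ (m, j))"
    using Ac B ij by (intro mat_mult_entry)
  also have "\<dots> = (\<Sum>m<n. if m = n - 1 - i then A $$ (i, n - 1 - i) * B $$ (n - 1 - i, j) else 0)"
    using antidiagonal_entry[OF A ij(1)] by (intro sum.cong) auto
  also have "\<dots> = A $$ (i, n - 1 - i) * B $$ (n - 1 - i, j)" using ij by simp
  finally show "(A * B) $$ (i, j) = A $$ (i, n - 1 - i) * B $$ (n - 1 - i, j)" .
  have "(B * A) $$ (i, j) = (\<Sum>m<n. B $$ (i, m) * A $$ (m, j))"
    using Ac B ij by (intro mat_mult_entry)
  also have "\<dots> = (\<Sum>m<n. if m = n - 1 - j then B $$ (i, n - 1 - j) * A $$ (n - 1 - j, j) else 0)"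
  proof (rule sum.cong[OF refl])
    fix m assume m: "m \<in> {..<n}"
    show "B $$ (i, m) * A $$ (m, j) = (if m = n - 1 - j then B $$ (i, n - 1 - j) * A $$ (n - 1 - j, j) else 0)"
      using antidiagonal_entry[OF A, of m j] m ij by (cases "m = n - 1 - j") auto
  qed
  also have "\<dots> = B $$ (i, n - 1 - j) * A $$ (n - 1 - j, j)" using ij by simp
  finally show "(B * A) $$ (i, j) = B $$ (i, n - 1 - j) * A $$ (n - 1 - j, j)" .
qed

text \<open>The inverse of \<open>X \<mapsto> A X\<^sup>-\<^sup>T A\<^sup>-\<^sup>1\<close> is the same map for \<open>A\<^sup>T\<close>, which is again antidiagonal, so one
  inclusion suffices.\<close>

lemma antidiagonal_tw_triangular:
  fixes A :: "'k :: alg_closed_field mat"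
  assumes alg: "algebraic_closure_of_Fq p q TYPE('k)" and A: "antidiagonal n A"
  shows "tw n A ` triangular n (\<lambda>i. i) = triangular n (\<lambda>i. i)"
proof -
  let ?U = "triangular n (\<lambda>i. i) :: 'k mat set"
  have sub: "subgroup ?U (GL n)" by (rule subgroup_triangular[OF alg])
  have incl: "tw n A u \<in> ?U" if A: "antidiagonal n A" and u: "u \<in> ?U" for A u :: "'k mat"
  proof -
    have Ac: "A \<in> carrier (GL n)" using A by (simp add: antidiagonal_def)
    let ?y = "ginv n u" and ?v = "tw n A u"
    have y: "?y \<in> ?U" by (rule subgroup.m_inv_closed[OF sub u])
    have uc: "u \<in> carrier (GL n)" using u by (simp add: triangular_def)
    have vc: "?v \<in> carrier (GL n)" using Ac uc by simp
    have eq: "?v * A = A * transpose_mat ?y"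
      using Ac uc by (simp add: twisted_inv_transpose_def)
    have "i \<le> j" if ij: "i < n" "j < n" and nz: "?v $$ (i, j) \<noteq> 0" for i j
    proof -
      let ?l = "n - 1 - j"
      have l: "?l < n" "n - 1 - ?l = j" using ij by auto
      have "?v $$ (i, j) * A $$ (j, ?l) = (?v * A) $$ (i, ?l)"
        using antidiagonal_mult_entry(2)[OF A, of ?v i ?l] vc ij l by auto
      also have "\<dots> = A $$ (i, n - 1 - i) * transpose_mat ?y $$ (n - 1 - i, ?l)"
        unfolding eq using GL_dim[OF GL.inv_closed[OF uc]] ij l
        by (intro antidiagonal_mult_entry(1)[OF A]) auto
      also have "transpose_mat ?y $$ (n - 1 - i, ?l) = ?y $$ (?l, n - 1 - i)"
        using GL_dim[OF GL.inv_closed[OF uc]] ij l by auto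
      finally have "?y $$ (?l, n - 1 - i) \<noteq> 0"
        using nz antidiagonal_nonzero[OF A ij(2)] by auto
      then have "?l \<le> n - 1 - i" using y ij l by (auto simp: triangular_def)
      with ij show ?thesis by simp
    qed
    with vc show ?thesis by (auto simp: triangular_def)
  qed
  have Ac: "A \<in> carrier (GL n)" using A by (simp add: antidiagonal_def)
  show ?thesis
  proof (intro equalityI subsetI)
    fix y assume "y \<in> tw n A ` ?U" then show "y \<in> ?U" using incl[OF A] by blast
  next
    fix y assume y: "y \<in> ?U"
    then have "tw n (transpose_mat A) y \<in> ?U" by (rule incl[OF antidiagonal_transpose[OF A]])
    moreover have "y = tw n A (tw n (transpose_mat A) y)"
      using y Ac by (intro tw_tw_transpose[symmetric]) (auto simp: triangular_def)
    ultimately show "y \<in> tw n A ` ?U" by (rule rev_image_eqI)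
  qed
qed

lemma antidiagonal_tw_diag:
  fixes A :: "'k :: field mat"
  assumes A: "antidiagonal n A"
  shows "tw n A ` diag_group n = diag_group n"
proof -
  have incl: "tw n A d \<in> diag_group n" if A: "antidiagonal n A" and d: "d \<in> diag_group n" for A d :: "'k mat"
  proof -
    have Ac: "A \<in> carrier (GL n)" using A by (simp add: antidiagonal_def)
    obtain f where f: "d = mat_diag n f" "\<forall>i<n. f i \<noteq> 0" using d by (rule diag_groupE)
    have dt: "transpose_mat (ginv n d) = mat_diag n (\<lambda>i. inverse (f i))"
      unfolding f(1) inv_mat_diag[OF f(2)] by (auto simp: mat_diag_def intro!: eq_matI)
    let ?d' = "mat_diag n (\<lambda>i. inverse (f (n - 1 - i)))"
    have d': "?d' \<in> carrier (GL n)" using f(2) by auto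
    have "A * mat_diag n (\<lambda>i. inverse (f i)) = ?d' * A"
    proof (rule eq_matI)
      fix i j assume "i < dim_row (?d' * A)" "j < dim_col (?d' * A)"
      then have ij: "i < n" "j < n" using Ac by (auto simp: carrier_GL mat_diag_def)
      then show "(A * mat_diag n (\<lambda>i. inverse (f i))) $$ (i, j) = (?d' * A) $$ (i, j)"
        using Ac antidiagonal_entry[OF A ij]
        by (cases "j = n - 1 - i")
           (auto simp: mat_diag_mult_left[of _ n n] mat_diag_mult_right[of _ n n] carrier_GL)
    qed (use Ac in \<open>auto simp: carrier_GL mat_diag_def\<close>)
    then have "tw n A d = ?d'" unfolding twisted_inv_transpose_def dt using Ac d' by simp
    then show ?thesis using f(2) by (auto intro!: diag_groupI)
  qed
  have Ac: "A \<in> carrier (GL n)" using A by (simp add: antidiagonal_def)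
  show ?thesis
  proof (intro equalityI subsetI)
    fix y assume "y \<in> tw n A ` diag_group n" then show "y \<in> diag_group n" using incl[OF A] by blast
  next
    fix y :: "'k mat" assume y: "y \<in> diag_group n"
    then have "tw n (transpose_mat A) y \<in> diag_group n" by (rule incl[OF antidiagonal_transpose[OF A]])
    moreover have "y = tw n A (tw n (transpose_mat A) y)"
      using subsetD[OF diag_group_carrier y] Ac by (intro tw_tw_transpose[symmetric])
    ultimately show "y \<in> tw n A ` diag_group n" by (rule rev_image_eqI)
  qed
qed


section \<open>Congruence classes of antidiagonal forms\<close>

definition ratio :: "nat \<Rightarrow> 'k :: field mat \<Rightarrow> nat \<Rightarrow> 'k" where
  "ratio n A i = A $$ (i, n - 1 - i) / A $$ (n - 1 - i, i)"

text \<open>The element \<open>hat x\<close> of \<open>khat\<close> for the square roots \<open>x\<close> of \<open>r\<close>, described without choosing one.\<close>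

definition square_class :: "'k :: field \<Rightarrow> 'k set" where
  "square_class r = {x. x ^ 2 = r \<or> x ^ 2 * r = 1}"

text \<open>The remaining positions are mirror images with inverse ratios, or the middle one with ratio \<open>1\<close>.\<close>

definition ratio_classes :: "nat \<Rightarrow> 'k :: field mat \<Rightarrow> 'k set multiset" where
  "ratio_classes n A = image_mset (\<lambda>i. square_class (ratio n A i)) (mset_set {..<n div 2})"

lemma hat_eq_square_class: "a \<noteq> 0 \<Longrightarrow> hat a = square_class (a ^ 2)"
proof -
  assume a: "a \<noteq> 0"
  have "x ^ 2 * a ^ 2 = 1 \<longleftrightarrow> x = inverse a \<or> x = - inverse a" for x
  proof -
    have "x ^ 2 * a ^ 2 = 1 \<longleftrightarrow> (x * a) ^ 2 = 1" by (simp add: power_mult_distrib)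
    also have "\<dots> \<longleftrightarrow> x * a = 1 \<or> x * a = - 1" by (rule power2_eq_1_iff)
    also have "\<dots> \<longleftrightarrow> x = inverse a \<or> x = - inverse a" using a by (auto simp: field_simps)
    finally show ?thesis .
  qed
  then show ?thesis by (auto simp: hat_def square_class_def power2_eq_iff)
qed

lemma square_class_eq_iff:
  fixes r :: "'k :: alg_closed_field"
  assumes "r \<noteq> 0"
  shows "square_class r = square_class r' \<longleftrightarrow> r = r' \<or> r * r' = 1"
proof
  assume eq: "square_class r = square_class r'"
  obtain x where x: "x ^ 2 = r" using nth_root_exists[of 2 r] by auto
  then have "x \<in> square_class r" by (simp add: square_class_def)
  then have "x \<in> square_class r'" using eq by simp
  with x show "r = r' \<or> r * r' = 1" by (auto simp: square_class_def)
next
  assume "r = r' \<or> r * r' = 1"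
  then show "square_class r = square_class r'"
  proof
    assume *: "r * r' = 1"
    have "x ^ 2 * r = 1 \<longleftrightarrow> x ^ 2 = r'" for x
      using * assms by (metis mult.commute mult_cancel_left)
    moreover have "x ^ 2 * r' = 1 \<longleftrightarrow> x ^ 2 = r" for x
      using * assms by (metis mult.commute mult_cancel_left mult_zero_left zero_neq_one)
    ultimately show ?thesis by (auto simp: square_class_def)
  qed simp
qed

lemma khat_square_class:
  "square_class (r :: 'k :: alg_closed_field) \<in> khat" if "r \<noteq> 0"
proof -
  obtain x where x: "x ^ 2 = r" using nth_root_exists[of 2 r] by auto
  then have "x \<noteq> 0" using that by auto
  with x hat_eq_square_class[of x] show ?thesis by (auto simp: khat_def intro!: image_eqI[of _ _ x])
qed

lemma khatE:
  assumes "c \<in> khat" obtains r where "r \<noteq> 0" "c = square_class r"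
proof -
  obtain a where "a \<noteq> 0" "c = hat a" using assms by (auto simp: khat_def)
  then show ?thesis using that[of "a ^ 2"] by (simp add: hat_eq_square_class)
qed

lemma hat_frob_square_class:
  assumes alg: "algebraic_closure_of_Fq p q TYPE('k :: alg_closed_field)"
  shows "hat_frob q (square_class r) = square_class ((r :: 'k) ^ q)"
proof (intro equalityI subsetI)
  fix x assume "x \<in> hat_frob q (square_class r)"
  then obtain y where y: "x = y ^ q" "y ^ 2 = r \<or> y ^ 2 * r = 1"
    by (auto simp: hat_frob_def square_class_def)
  have sq: "x ^ 2 = (y ^ 2) ^ q" unfolding y(1) by (simp add: power_mult[symmetric] mult.commute)
  have "x ^ 2 = r ^ q \<or> x ^ 2 * r ^ q = 1"
    unfolding sq using y(2) by (auto simp: power_mult_distrib[symmetric])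
  then show "x \<in> square_class (r ^ q)" by (simp add: square_class_def)
next
  fix x assume x: "x \<in> square_class (r ^ q)"
  have inj: "a = b" if "a ^ q = b ^ q" for a b :: 'k using power_q_inj[OF alg, of a 1 b] that by simp
  obtain y where y: "y ^ q = x" using nth_root_exists[of q x] closure_power(3)[OF alg] by auto
  have sq: "x ^ 2 = (y ^ 2) ^ q" unfolding y[symmetric] by (simp add: power_mult[symmetric] mult.commute)
  from x have "(y ^ 2) ^ q = r ^ q \<or> (y ^ 2 * r) ^ q = 1 ^ q"
    by (simp add: square_class_def sq power_mult_distrib)
  then have "y ^ 2 = r \<or> y ^ 2 * r = 1" using inj by blast
  then show "x \<in> hat_frob q (square_class r)"
    using y by (auto simp: hat_frob_def square_class_def)
qed

lemma antidiagonal_imp_GL: "antidiagonal n A \<Longrightarrow> A \<in> carrier (GL n)"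
  by (simp add: antidiagonal_def)

lemma ratio_nonzero:
  assumes "antidiagonal n A" "i < n"
  shows "ratio n A i \<noteq> 0"
  using antidiagonal_nonzero[OF assms] antidiagonal_nonzero[OF assms(1), of "n - 1 - i"] assms(2)
  by (simp add: ratio_def)

lemma ratio_mirror:
  assumes "antidiagonal n A" "i < n"
  shows "ratio n A i * ratio n A (n - 1 - i) = 1"
  using antidiagonal_nonzero[OF assms] antidiagonal_nonzero[OF assms(1), of "n - 1 - i"] assms(2)
  by (simp add: ratio_def)

lemma antidiagonal_asymmetry:
  assumes A: "antidiagonal n A"
  shows "A = mat_diag n (ratio n A) * transpose_mat A"
proof (rule eq_matI)
  have Ac: "A \<in> carrier_mat n n" using A by (auto dest: antidiagonal_imp_GL)
  fix i j assume "i < dim_row (mat_diag n (ratio n A) * transpose_mat A)"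
    "j < dim_col (mat_diag n (ratio n A) * transpose_mat A)"
  then have ij: "i < n" "j < n" using Ac by (auto simp: mat_diag_def)
  have "(mat_diag n (ratio n A) * transpose_mat A) $$ (i, j) = ratio n A i * A $$ (j, i)"
    using Ac ij by (simp add: mat_diag_mult_left[of _ n n])
  also have "\<dots> = A $$ (i, j)"
  proof (cases "j = n - 1 - i")
    case True
    have "A $$ (j, n - 1 - j) \<noteq> 0" by (rule antidiagonal_nonzero[OF A ij(2)])
    moreover have "n - 1 - j = i" using True ij by simp
    ultimately show ?thesis using True by (simp add: ratio_def)
  next
    case False
    then have "i \<noteq> n - 1 - j" using ij by auto
    then show ?thesis using antidiagonal_entry[OF A ij False] antidiagonal_entry[OF A ij(2,1)] by simp
  qed
  finally show "A $$ (i, j) = (mat_diag n (ratio n A) * transpose_mat A) $$ (i, j)" by simp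
qed (use A in \<open>auto simp: mat_diag_def antidiagonal_def carrier_GL\<close>)

lemma mirror_image_mset:
  fixes f :: "nat \<Rightarrow> 'b"
  assumes "\<And>i. i < n \<Longrightarrow> f (n - 1 - i) = f i"
  shows "image_mset f (mset_set {..<n}) = image_mset f (mset_set {..<n div 2}) +
    image_mset f (mset_set {..<n div 2}) + (if odd n then {#f (n div 2)#} else {#})"
proof -
  let ?m = "n div 2"
  let ?mid = "if odd n then {?m} else {}"
  have "{..<n} = {..<?m} \<union> (?mid \<union> {n - ?m..<n})" by (auto elim!: oddE evenE)
  moreover have "mset_set ({..<?m} \<union> (?mid \<union> {n - ?m..<n})) = mset_set {..<?m} + (mset_set ?mid + mset_set {n - ?m..<n})"
    by (subst mset_set_Union; (subst mset_set_Union)?) (auto elim!: oddE evenE)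
  moreover have "image_mset f (mset_set {n - ?m..<n}) = image_mset f (mset_set {..<?m})"
  proof -
    have "bij_betw (\<lambda>i. n - 1 - i) {..<?m} {n - ?m..<n}"
      by (intro bij_betwI[of _ _ _ "\<lambda>i. n - 1 - i"]) auto
    then have "mset_set {n - ?m..<n} = image_mset (\<lambda>i. n - 1 - i) (mset_set {..<?m})"
      by (metis bij_betw_def image_mset_mset_set)
    then have "image_mset f (mset_set {n - ?m..<n}) = image_mset (\<lambda>i. f (n - 1 - i)) (mset_set {..<?m})"
      by (simp add: multiset.map_comp o_def)
    also have "\<dots> = image_mset f (mset_set {..<?m})"
      using assms by (intro image_mset_cong) auto
    finally show ?thesis .
  qed
  ultimately show ?thesis by auto
qed

lemma all_ratio_classes:
  fixes A :: "'k :: alg_closed_field mat"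
  assumes A: "antidiagonal n A"
  shows "image_mset (\<lambda>i. square_class (ratio n A i)) (mset_set {..<n}) =
    ratio_classes n A + ratio_classes n A + (if odd n then {#square_class 1#} else {#})"
proof -
  have "square_class (ratio n A (n - 1 - i)) = square_class (ratio n A i)" if "i < n" for i
    using ratio_mirror[OF A that] ratio_nonzero[OF A, of "n - 1 - i"] that
    by (subst square_class_eq_iff) (auto simp: mult.commute)
  from mirror_image_mset[of n "\<lambda>i. square_class (ratio n A i)", OF this]
  have *: "image_mset (\<lambda>i. square_class (ratio n A i)) (mset_set {..<n}) = ratio_classes n A + ratio_classes n A +
      (if odd n then {#square_class (ratio n A (n div 2))#} else {#})"
    unfolding ratio_classes_def by simp
  have "ratio n A (n div 2) = 1" if "odd n"
  proof -
    have "n - 1 - n div 2 = n div 2" "n div 2 < n" using that by (auto elim!: oddE)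
    with antidiagonal_nonzero[OF A, of "n div 2"] show ?thesis by (simp add: ratio_def)
  qed
  then show ?thesis unfolding * by auto
qed

lemma det_nonzero_permutation:
  assumes "h \<in> carrier (GL n)"
  obtains w where "w permutes {..<n}" "\<And>i. i < n \<Longrightarrow> h $$ (i, w i) \<noteq> 0"
proof -
  have "det h \<noteq> 0" "h \<in> carrier_mat n n" using assms by (auto simp: carrier_GL)
  then have "(\<Sum>p\<in>{p. p permutes {0..<n}}. signof p * (\<Prod>i = 0..<n. h $$ (i, p i))) \<noteq> 0"
    by (simp add: det_def')
  then obtain p where p: "p permutes {0..<n}" "signof p * (\<Prod>i = 0..<n. h $$ (i, p i)) \<noteq> 0"
    by (metis (no_types, lifting) mem_Collect_eq sum.neutral)
  have "h $$ (i, p i) \<noteq> 0" if "i < n" for i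
    using p(2) that by (auto simp: prod_zero_iff)
  with p(1) that show ?thesis by (simp add: atLeast0LessThan)
qed

text \<open>From \<open>A = diag(r\<^sub>A) A\<^sup>T\<close> and \<open>B = h A h\<^sup>T\<close> one gets \<open>diag(r\<^sub>B) h = h diag(r\<^sub>A)\<close>. A nonzero term in the
  expansion of \<open>det h\<close> is a permutation that matches the two families of ratios. They contain every
  class of a pair twice, apart from the middle position.\<close>

lemma congruent_imp_ratio_classes_eq:
  fixes A B :: "'k :: alg_closed_field mat"
  assumes A: "antidiagonal n A" and B: "antidiagonal n B" and cong: "congruent_forms n A B"
  shows "ratio_classes n A = ratio_classes n B"
proof -
  obtain h where h: "h \<in> carrier (GL n)" "B = h * A * transpose_mat h"
    using cong by (auto simp: congruent_forms_def)
  note Ac = antidiagonal_imp_GL[OF A] and Bc = antidiagonal_imp_GL[OF B]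
  let ?DA = "mat_diag n (ratio n A)" and ?DB = "mat_diag n (ratio n B)"
  have D: "?DA \<in> carrier (GL n)" "?DB \<in> carrier (GL n)" using ratio_nonzero A B by auto
  let ?S = "transpose_mat A * transpose_mat h"
  have S: "?S \<in> carrier (GL n)" using h Ac by simp
  have "transpose_mat B = h * ?S"
    unfolding h(2) using h(1) Ac by (simp add: transpose_mult_GL[where n = n] GL_assoc[where n = n])
  then have "B = ?DB * (h * ?S)" using antidiagonal_asymmetry[OF B] by simp
  moreover have "B = h * (?DA * transpose_mat A) * transpose_mat h"
    using antidiagonal_asymmetry[OF A] h(2) by simp
  ultimately have "(?DB * h) * ?S = (h * ?DA) * ?S"
    using h(1) Ac D by (simp add: GL_assoc[where n = n])
  then have eq: "?DB * h = h * ?DA"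
    using h(1) D S by (metis GL.right_cancel GL.m_closed mult_GL)
  obtain w where w: "w permutes {..<n}" "\<And>i. i < n \<Longrightarrow> h $$ (i, w i) \<noteq> 0"
    using det_nonzero_permutation[OF h(1)] by blast
  have "ratio n B i = ratio n A (w i)" if i: "i < n" for i
  proof -
    have wi: "w i < n" using w(1) i by (metis lessThan_iff permutes_in_image)
    have hm: "h \<in> carrier_mat n n" using h(1) by auto
    have "(?DB * h) $$ (i, w i) = (h * ?DA) $$ (i, w i)" using eq by simp
    then have "ratio n B i * h $$ (i, w i) = h $$ (i, w i) * ratio n A (w i)"
      using hm i wi by (simp add: mat_diag_mult_left[of _ n n] mat_diag_mult_right[of _ n n])
    with w(2)[OF i] show ?thesis by simp
  qed
  then have "image_mset (\<lambda>i. square_class (ratio n B i)) (mset_set {..<n}) =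
      image_mset (\<lambda>i. square_class (ratio n A (w i))) (mset_set {..<n})"
    by (intro image_mset_cong) auto
  also have "\<dots> = image_mset (\<lambda>i. square_class (ratio n A i)) (image_mset w (mset_set {..<n}))"
    by (simp add: multiset.map_comp o_def)
  also have "image_mset w (mset_set {..<n}) = mset_set {..<n}"
    using w(1) by (simp add: image_mset_mset_set permutes_inj_on permutes_image)
  finally have "ratio_classes n A + ratio_classes n A = ratio_classes n B + ratio_classes n B"
    unfolding all_ratio_classes[OF A] all_ratio_classes[OF B] by simp
  then have "count (ratio_classes n A) x + count (ratio_classes n A) x =
      count (ratio_classes n B) x + count (ratio_classes n B) x" for x
    by (metis count_union)
  then show ?thesis by (intro multiset_eqI) (metis add_self_div_2)
qed

text \<open>A matching \<open>p\<close> of the classes in the first half of the positions is turned into a permutation \<open>w\<close>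
  of all positions that commutes with the reversal and matches the ratios, by passing to the mirror
  image of \<open>p i\<close> where the ratios are inverse to each other. The congruence is then by a monomial
  matrix. Its scalars \<open>x\<close> multiply the entries at \<open>i\<close> and at the mirror image of \<open>i\<close> by the same
  factor, which is enough because the ratios agree already; the middle entry is multiplied by a
  square.\<close>

lemma ratio_classes_eq_imp_congruent:
  fixes A B :: "'k :: alg_closed_field mat"
  assumes A: "antidiagonal n A" and B: "antidiagonal n B"
    and eq: "ratio_classes n A = ratio_classes n B"
  shows "congruent_forms n B A"
proof -
  let ?m = "n div 2" and ?v = "\<lambda>i. n - 1 - i"
  obtain p where p: "p permutes {..<?m}"
    and cls: "\<And>i. i < ?m \<Longrightarrow> square_class (ratio n A i) = square_class (ratio n B (p i))"
    using image_mset_eq_implies_permutes[OF finite_lessThan eq[unfolded ratio_classes_def]]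
    by (metis lessThan_iff)
  have mid: "ratio n A i = 1" "ratio n B i = 1" if "i < n" "?v i = i" for i
    using that antidiagonal_nonzero[OF A that(1)] antidiagonal_nonzero[OF B that(1)]
    by (simp_all add: ratio_def)
  have low: "i < ?m \<or> i < n \<and> ?v i = i" if "i < n" "i \<le> ?v i" for i using that by auto
  have p_low: "p i < n \<and> p i \<le> ?v (p i)" if "i < n" "i \<le> ?v i" for i
  proof (cases "i < ?m")
    case True
    then have "p i < ?m" using p by (metis lessThan_iff permutes_in_image)
    then show ?thesis by auto
  next
    case False
    then have "p i = i" using p by (simp add: permutes_not_in)
    with that show ?thesis by simp
  qed
  define w0 where "w0 = (\<lambda>i. if ratio n B (p i) = ratio n A i then p i else ?v (p i))"
  define w where "w = (\<lambda>i. if i \<le> ?v i then w0 i else ?v (w0 (?v i)))"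
  have vv: "?v (?v i) = i" if "i < n" for i using that by auto
  have w0n: "w0 i < n" if "i < n" "i \<le> ?v i" for i
    using p_low[OF that] by (auto simp: w0_def)
  have w0mid: "w0 i = i" if "i < n" "?v i = i" for i
  proof -
    have "\<not> i < ?m" using that by auto
    then have "p i = i" using p by (simp add: permutes_not_in)
    then show ?thesis using mid[OF that] by (simp add: w0_def)
  qed
  have wn: "w i < n" if "i < n" for i
    using that w0n[of i] w0n[of "?v i"] by (auto simp: w_def)
  have wv: "w (?v i) = ?v (w i)" if i: "i < n" for i
  proof -
    consider "i < ?v i" | "i = ?v i" | "?v i < i" by linarith
    then show ?thesis
    proof cases
      case 1
      then have "\<not> ?v i \<le> ?v (?v i)" using vv[OF i] by simp
      then show ?thesis using 1 vv[OF i] by (simp add: w_def)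
    next
      case 2
      then have "w i = i" using w0mid[OF i] by (simp add: w_def)
      then show ?thesis using 2 by simp
    next
      case 3
      then have *: "?v i \<le> ?v (?v i)" "\<not> i \<le> ?v i" using vv[OF i] by simp_all
      have "w0 (?v i) < n" using * i by (intro w0n) auto
      then show ?thesis using * vv by (simp add: w_def)
    qed
  qed
  have ratio_inv: "ratio n M (?v i) = inverse (ratio n M i)" if "antidiagonal n M" "i < n" for M :: "'k mat" and i
    using ratio_mirror[OF that] by (metis inverse_unique)
  have rw0: "ratio n B (w0 i) = ratio n A i" if i: "i < n" "i \<le> ?v i" for i
    using low[OF i]
  proof
    assume im: "i < ?m"
    have pn: "p i < n" using p_low[OF i] by simp
    have "ratio n A i = ratio n B (p i) \<or> ratio n A i * ratio n B (p i) = 1"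
      using cls[OF im] square_class_eq_iff[OF ratio_nonzero[OF A i(1)]] by blast
    then show ?thesis
    proof
      assume "ratio n A i * ratio n B (p i) = 1"
      then have "inverse (ratio n B (p i)) = ratio n A i" by (metis inverse_unique mult.commute)
      then show ?thesis using ratio_inv[OF B pn] by (simp add: w0_def)
    qed (simp add: w0_def)
  next
    assume "i < n \<and> ?v i = i"
    then show ?thesis using w0mid[of i] mid[of i] by simp
  qed
  have rw: "ratio n B (w i) = ratio n A i" if i: "i < n" for i
  proof (cases "i \<le> ?v i")
    case True then show ?thesis using rw0[OF i] by (simp add: w_def)
  next
    case False
    have l: "?v i < n" "?v i \<le> ?v (?v i)" using False i by auto
    have "ratio n B (w i) = inverse (ratio n B (w0 (?v i)))"
      using False ratio_inv[OF B w0n[OF l]] by (simp add: w_def)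
    also have "\<dots> = inverse (ratio n A (?v i))" using rw0[OF l] by simp
    also have "\<dots> = ratio n A i" using ratio_inv[OF A l(1)] vv[OF i] by simp
    finally show ?thesis .
  qed
  (* w acts on mirror pairs, represented by their smaller members, as p does *)
  have pair: "min (w i) (?v (w i)) = p (min i (?v i))" if i: "i < n" for i
  proof -
    have *: "min (w0 i) (?v (w0 i)) = p i" if i: "i < n" "i \<le> ?v i" for i
      using p_low[OF i] by (auto simp: w0_def)
    show ?thesis
    proof (cases "i \<le> ?v i")
      case True then show ?thesis using *[OF i] by (simp add: w_def)
    next
      case False
      have l: "?v i < n" "?v i \<le> ?v (?v i)" using False i by auto
      have "?v (?v (w0 (?v i))) = w0 (?v i)" using vv[OF w0n[OF l]] .
      then show ?thesis using *[OF l] False by (simp add: w_def min.commute)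
    qed
  qed
  have "inj_on w {..<n}"
  proof (rule inj_onI)
    fix i j assume ij: "i \<in> {..<n}" "j \<in> {..<n}" and wij: "w i = w j"
    then have n: "i < n" "j < n" by auto
    have "p (min i (?v i)) = p (min j (?v j))" using pair[OF n(1)] pair[OF n(2)] wij by simp
    then have "min i (?v i) = min j (?v j)" using p by (metis permutes_inj injD)
    then consider "i = j" | "j = ?v i" "i \<noteq> j" using n by (fastforce simp: min_def split: if_splits)
    then show "i = j"
    proof cases
      case 2
      then have "?v (w i) = w i" using wv[OF n(1)] wij by simp
      with pair[OF n(1)] have pw: "p (min i (?v i)) = w i" by simp
      have "\<not> w i < ?m" using \<open>?v (w i) = w i\<close> wn[OF n(1)] by auto
      moreover have "min i (?v i) < ?m" using 2 n by auto
      then have "p (min i (?v i)) < ?m" using p by (metis lessThan_iff permutes_in_image)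
      ultimately show ?thesis using pw by simp
    qed
  qed
  moreover have "w ` {..<n} \<subseteq> {..<n}" using wn by auto
  ultimately have bij: "bij_betw w {..<n} {..<n}" by (simp add: bij_betw_def endo_inj_surj)
  have "\<forall>c :: 'k. \<exists>y. y ^ 2 = c" by (intro allI nth_root_exists) simp
  then obtain sq :: "'k \<Rightarrow> 'k" where sq: "\<And>c. sq c ^ 2 = c" by metis
  define x where "x = (\<lambda>i. if i < ?v i then A $$ (i, ?v i) / B $$ (w i, ?v (w i))
    else if i = ?v i then sq (A $$ (i, i) / B $$ (i, i)) else 1)"
  have Anz: "A $$ (i, ?v i) \<noteq> 0" and Bnz: "B $$ (i, ?v i) \<noteq> 0" if "i < n" for i
    using antidiagonal_nonzero[OF A that] antidiagonal_nonzero[OF B that] by auto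
  have xnz: "x i \<noteq> 0" if i: "i < n" for i
  proof -
    have "sq (A $$ (i, i) / B $$ (i, i)) \<noteq> 0" if "i = ?v i"
    proof
      assume "sq (A $$ (i, i) / B $$ (i, i)) = 0"
      then have "A $$ (i, i) / B $$ (i, i) = 0" using sq[of "A $$ (i, i) / B $$ (i, i)"] by simp
      then show False using Anz[OF i] Bnz[OF i] that by simp
    qed
    then show ?thesis using Anz[OF i] Bnz[OF wn[OF i]] by (simp add: x_def)
  qed
  let ?h = "monomial n w x"
  have h: "?h \<in> carrier (GL n)" using bij xnz by (rule monomial_GL)
  have Bm: "B \<in> carrier_mat n n" and Am: "A \<in> carrier_mat n n"
    using A B by (auto dest: antidiagonal_imp_GL)
  have "A = ?h * B * transpose_mat ?h"
  proof (rule eq_matI)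
    fix i j assume "i < dim_row (?h * B * transpose_mat ?h)" "j < dim_col (?h * B * transpose_mat ?h)"
    then have ij: "i < n" "j < n" by (auto simp: monomial_def)
    have ent: "(?h * B * transpose_mat ?h) $$ (i, j) = x i * x j * B $$ (w i, w j)"
      by (rule monomial_congruence_entry[OF wn Bm ij])
    show "A $$ (i, j) = (?h * B * transpose_mat ?h) $$ (i, j)"
    proof (cases "j = ?v i")
      case False
      then have "w j \<noteq> w (?v i)" using bij ij by (auto simp: bij_betw_def inj_on_def)
      then have "B $$ (w i, w j) = 0" using wv[OF ij(1)] by (intro antidiagonal_entry[OF B wn wn] ij) simp
      then show ?thesis using ent antidiagonal_entry[OF A ij False] by simp
    next
      case True
      have wj: "w j = ?v (w i)" using True wv[OF ij(1)] by simp
      consider "i < ?v i" | "i = ?v i" | "?v i < i" by linarith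
      then have "x i * x (?v i) * B $$ (w i, ?v (w i)) = A $$ (i, ?v i)"
      proof cases
        case 1
        then have "x (?v i) = 1" using vv[OF ij(1)] by (simp add: x_def)
        then show ?thesis using 1 Bnz[OF wn[OF ij(1)]] by (simp add: x_def)
      next
        case 2
        then have wi: "w i = i" using w0mid[OF ij(1)] by (simp add: w_def)
        have "x i * x i = A $$ (i, i) / B $$ (i, i)"
          using 2 sq by (simp add: x_def power2_eq_square[symmetric])
        then show ?thesis using 2[symmetric] wi Bnz[OF ij(1)] by simp
      next
        case 3
        let ?j = "?v i"
        have jn: "?j < n" using ij by simp
        have vj: "?v ?j = i" by (rule vv[OF ij(1)])
        have wvj: "w i = ?v (w ?j)" using wv[OF jn] vj by simp
        have vw: "?v (w i) = w ?j" using wv[OF ij(1)] by simp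
        have "x i = 1" using 3 by (simp add: x_def)
        moreover have "x ?j = A $$ (?j, i) / B $$ (w ?j, w i)"
          using 3 vj wvj by (simp add: x_def)
        ultimately have "x i * x ?j * B $$ (w i, ?v (w i)) = A $$ (?j, i) * (B $$ (w i, w ?j) / B $$ (w ?j, w i))"
          using vw by simp
        also have "B $$ (w i, w ?j) / B $$ (w ?j, w i) = ratio n B (w i)"
          using vw by (simp add: ratio_def)
        also have "\<dots> = ratio n A i" by (rule rw[OF ij(1)])
        also have "A $$ (?j, i) * ratio n A i = A $$ (i, ?j)"
          using Anz[OF jn] vj by (simp add: ratio_def)
        finally show ?thesis .
      qed
      then show ?thesis using ent wj True by simp
    qed
  qed (use Am in \<open>auto simp: monomial_def\<close>)
  with h show ?thesis unfolding congruent_forms_def by blast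
qed

lemma exists_antidiagonal:
  fixes \<mu> :: "'k :: alg_closed_field set multiset"
  assumes "size \<mu> = n div 2" "set_mset \<mu> \<subseteq> khat"
  shows "\<exists>A. antidiagonal n A \<and> ratio_classes n A = \<mu>"
proof -
  let ?v = "\<lambda>i. n - 1 - i"
  obtain xs where xs: "mset xs = \<mu>" using ex_mset by blast
  then have len: "length xs = n div 2" using assms(1) by auto
  have "\<forall>i. \<exists>r. i < n div 2 \<longrightarrow> r \<noteq> 0 \<and> xs ! i = square_class r"
    using xs len assms(2) khatE by (metis nth_mem set_mset_mset subsetD)
  then obtain c where c: "\<And>i. i < n div 2 \<Longrightarrow> c i \<noteq> 0 \<and> xs ! i = square_class (c i)" by metis
  let ?A = "monomial n ?v (\<lambda>i. if i < n div 2 then c i else 1)"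
  have A: "antidiagonal n ?A" by (rule reversal_monomial_antidiagonal) (use c in simp)
  have "square_class (ratio n ?A i) = xs ! i" if i: "i \<in># mset_set {..<n div 2}" for i
  proof -
    have "ratio n ?A i = c i" using i by (auto simp: ratio_def monomial_def)
    then show ?thesis using c i by auto
  qed
  then have "ratio_classes n ?A = image_mset (\<lambda>i. xs ! i) (mset_set {..<n div 2})"
    unfolding ratio_classes_def by (rule image_mset_cong)
  also have "\<dots> = mset xs"
    using len by (metis map_nth mset_map mset_upt atLeast0LessThan)
  finally show ?thesis using A xs by blast
qed

lemma ratio_classes_Frobenius:
  fixes A :: "'k :: alg_closed_field mat"
  assumes alg: "algebraic_closure_of_Fq p q TYPE('k)" and A: "antidiagonal n A"
  shows "ratio_classes n (map_mat (\<lambda>a. a ^ q) A) = image_mset (hat_frob q) (ratio_classes n A)"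
proof -
  have Am: "A \<in> carrier_mat n n" using A by (auto dest: antidiagonal_imp_GL)
  have "ratio n (map_mat (\<lambda>a. a ^ q) A) i = ratio n A i ^ q" if "i < n" for i
    using Am that by (simp add: ratio_def power_divide)
  then show ?thesis
    unfolding ratio_classes_def
    by (auto simp: multiset.map_comp o_def hat_frob_square_class[OF alg] intro!: image_mset_cong)
qed

lemma ratio_classes_valid:
  fixes A :: "'k :: alg_closed_field mat"
  assumes A: "antidiagonal n A"
  shows "size (ratio_classes n A) = n div 2" "set_mset (ratio_classes n A) \<subseteq> khat"
  using ratio_nonzero[OF A] by (auto simp: ratio_classes_def intro!: khat_square_class)


section \<open>Frobenius orbits on \<open>khat\<close>\<close>

definition frob_orbit :: "nat \<Rightarrow> 'k :: field set \<Rightarrow> 'k set set" where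
  "frob_orbit q A = {(hat_frob q ^^ m) A | m. True}"

lemma hat_orbits_eq: "hat_orbits q = frob_orbit q ` khat"
  by (simp add: hat_orbits_def frob_orbit_def)

lemma frob_orbit_self: "A \<in> frob_orbit q A"
  by (auto simp: frob_orbit_def intro!: exI[of _ 0])

lemma hat_frob_power_square_class:
  assumes "algebraic_closure_of_Fq p q TYPE('k :: alg_closed_field)"
  shows "(hat_frob q ^^ m) (square_class (r :: 'k)) = square_class (r ^ (q ^ m))"
  by (induction m) (simp_all add: hat_frob_square_class[OF assms] power_mult[symmetric] mult.commute)

lemma hat_frob_power_khat:
  assumes "algebraic_closure_of_Fq p q TYPE('k :: alg_closed_field)" "(A :: 'k set) \<in> khat"
  shows "(hat_frob q ^^ m) A \<in> khat"
proof -
  obtain r where "r \<noteq> 0" "A = square_class r" using assms(2) by (rule khatE)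
  then show ?thesis by (simp add: hat_frob_power_square_class[OF assms(1)] khat_square_class)
qed

lemma hat_frob_periodic:
  assumes "algebraic_closure_of_Fq p q TYPE('k :: alg_closed_field)" "(A :: 'k set) \<in> khat"
  obtains N where "N > 0" "(hat_frob q ^^ N) A = A"
proof -
  obtain r where "r \<noteq> 0" "A = square_class r" using assms(2) by (rule khatE)
  moreover obtain N where "N > 0" "r ^ (q ^ N) = r" using exists_power_q_fixed[OF assms(1)] by blast
  ultimately show ?thesis using that by (simp add: hat_frob_power_square_class[OF assms(1)])
qed

lemma inj_hat_frob:
  assumes "algebraic_closure_of_Fq p q TYPE('k :: alg_closed_field)"
  shows "inj (hat_frob q :: 'k set \<Rightarrow> 'k set)"
proof -
  have "inj (\<lambda>a :: 'k. a ^ q)" using power_q_inj[OF assms, of _ 1] by (auto intro!: injI)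
  then show ?thesis unfolding hat_frob_def by (auto intro!: injI dest: inj_image_eq_iff)
qed

lemma frob_orbit_mono:
  assumes "B \<in> frob_orbit q A" shows "frob_orbit q B \<subseteq> frob_orbit q A"
proof
  fix C assume "C \<in> frob_orbit q B"
  with assms obtain l m where "C = (hat_frob q ^^ l) B" "B = (hat_frob q ^^ m) A"
    by (auto simp: frob_orbit_def)
  then have "C = (hat_frob q ^^ (l + m)) A" by (simp add: funpow_add)
  then show "C \<in> frob_orbit q A" unfolding frob_orbit_def by blast
qed

lemma frob_orbit_eq:
  assumes alg: "algebraic_closure_of_Fq p q TYPE('k :: alg_closed_field)" and A: "(A :: 'k set) \<in> khat"
    and B: "B \<in> frob_orbit q A"
  shows "frob_orbit q B = frob_orbit q A"
proof -
  obtain m where m: "B = (hat_frob q ^^ m) A" using B by (auto simp: frob_orbit_def)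
  obtain N where N: "N > 0" "(hat_frob q ^^ N) A = A" using hat_frob_periodic[OF alg A] .
  have NN: "(hat_frob q ^^ (N * l)) A = A" for l
    using N(2) by (induction l) (simp_all add: funpow_add)
  have "m \<le> N * m" using N(1) by simp
  then have "(hat_frob q ^^ (N * m - m)) B = A"
    unfolding m using NN[of m] by (metis comp_apply funpow_add le_add_diff_inverse2)
  then have "A \<in> frob_orbit q B" unfolding frob_orbit_def by blast
  with B show ?thesis using frob_orbit_mono by blast
qed

lemma hat_orbit_properties:
  assumes alg: "algebraic_closure_of_Fq p q TYPE('k :: alg_closed_field)"
    and O: "(O' :: 'k set set) \<in> hat_orbits q"
  shows "finite O'" "O' \<noteq> {}" "O' \<subseteq> khat" "\<And>B. B \<in> O' \<Longrightarrow> frob_orbit q B = O'"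
    "\<And>B. B \<in> khat \<Longrightarrow> B \<in> O' \<longleftrightarrow> hat_frob q B \<in> O'"
proof -
  obtain A where A: "A \<in> khat" "O' = frob_orbit q A" using O by (auto simp: hat_orbits_eq)
  obtain N where N: "N > 0" "(hat_frob q ^^ N) A = A" using hat_frob_periodic[OF alg A(1)] .
  have "O' \<subseteq> (\<lambda>m. (hat_frob q ^^ m) A) ` {..<N}"
  proof
    fix B assume "B \<in> O'"
    then obtain m where m: "B = (hat_frob q ^^ m) A" by (auto simp: A(2) frob_orbit_def)
    have "B = (hat_frob q ^^ (m mod N)) A" unfolding m using N(2) by (metis funpow_mod_eq)
    then show "B \<in> (\<lambda>m. (hat_frob q ^^ m) A) ` {..<N}" using N(1) by auto
  qed
  then show "finite O'" by (rule finite_subset) simp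
  show "O' \<noteq> {}" using frob_orbit_self[of A q] A(2) by auto
  show sub: "O' \<subseteq> khat" using hat_frob_power_khat[OF alg A(1)] by (auto simp: A(2) frob_orbit_def)
  show eq: "frob_orbit q B = O'" if "B \<in> O'" for B using frob_orbit_eq[OF alg A(1)] that A(2) by simp
  fix B :: "'k set" assume B: "B \<in> khat"
  have FB: "hat_frob q B \<in> frob_orbit q B" by (auto simp: frob_orbit_def intro!: exI[of _ 1])
  show "B \<in> O' \<longleftrightarrow> hat_frob q B \<in> O'"
  proof
    assume "B \<in> O'" then show "hat_frob q B \<in> O'" using FB eq by blast
  next
    assume "hat_frob q B \<in> O'"
    then have "frob_orbit q B = O'" using eq frob_orbit_eq[OF alg B FB] by simp
    then show "B \<in> O'" using frob_orbit_self by blast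
  qed
qed

section \<open>Stable multisets and the combinatorial data\<close>

definition stable_multisets :: "nat \<Rightarrow> nat \<Rightarrow> 'k :: field set multiset set" where
  "stable_multisets n q = {\<mu>. size \<mu> = n div 2 \<and> set_mset \<mu> \<subseteq> khat \<and> image_mset (hat_frob q) \<mu> = \<mu>}"

lemma count_image_mset_injective:
  assumes "inj f" shows "count (image_mset f \<mu>) (f x) = count \<mu> x"
  by (induction \<mu>) (use assms in \<open>auto dest: injD\<close>)

lemma stable_iff_count:
  fixes \<mu> :: "'k :: alg_closed_field set multiset"
  assumes alg: "algebraic_closure_of_Fq p q TYPE('k)" and sub: "set_mset \<mu> \<subseteq> khat"
  shows "image_mset (hat_frob q) \<mu> = \<mu> \<longleftrightarrow> (\<forall>A\<in>khat. count \<mu> (hat_frob q A) = count \<mu> A)"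
proof
  assume "image_mset (hat_frob q) \<mu> = \<mu>"
  then show "\<forall>A\<in>khat. count \<mu> (hat_frob q A) = count \<mu> A"
    using count_image_mset_injective[OF inj_hat_frob[OF alg]] by metis
next
  assume *: "\<forall>A\<in>khat. count \<mu> (hat_frob q A) = count \<mu> A"
  show "image_mset (hat_frob q) \<mu> = \<mu>"
  proof (rule multiset_eqI)
    fix B
    show "count (image_mset (hat_frob q) \<mu>) B = count \<mu> B"
    proof (cases "B \<in> khat")
      case True
      obtain N where N: "N > 0" "(hat_frob q ^^ N) B = B" using hat_frob_periodic[OF alg True] .
      let ?A = "(hat_frob q ^^ (N - 1)) B"
      have "hat_frob q ?A = B" using N by (cases N) auto
      moreover have "?A \<in> khat" by (rule hat_frob_power_khat[OF alg True])
      ultimately show ?thesis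
        using * count_image_mset_injective[OF inj_hat_frob[OF alg], of \<mu> ?A] by metis
    next
      case False
      have "B \<notin># image_mset (hat_frob q) \<mu>"
        using sub False hat_frob_power_khat[OF alg, of _ 1] by auto
      moreover have "B \<notin># \<mu>" using sub False by auto
      ultimately show ?thesis by (metis count_eq_zero_iff)
    qed
  qed
qed

text \<open>An element of the multiset stands for a pair of positions of an antidiagonal form, which is why
  \<open>n\<^sub>+\<close> and \<open>n\<^sub>-\<close> are halved. For odd \<open>n\<close> the middle position is counted in \<open>n\<^sub>+\<close>.\<close>

definition datum_multiset :: "'k :: field \<Rightarrow> 'k datum \<Rightarrow> 'k set multiset" where
  "datum_multiset \<iota> d = replicate_mset (n_plus d div 2) (hat 1) +
     replicate_mset (n_minus d div 2) (hat \<iota>) +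
     (\<Sum>i\<in>index_set d. repeat_mset (part d i) (mset_set (orb d i)))"

text \<open>The conditions under which the multiplicities of a datum can be read off from its multiset. The
  total weight is left out because, for a datum built from a multiset, it is computed from that
  multiset afterwards.\<close>

definition separated :: "nat \<Rightarrow> 'k :: field \<Rightarrow> 'k datum \<Rightarrow> bool" where
  "separated q \<iota> d \<longleftrightarrow> finite (index_set d) \<and> inj_on (orb d) (index_set d) \<and>
     (\<forall>i\<in>index_set d. orb d i \<in> hat_orbits q - {{hat 1}, {hat \<iota>}})"

lemma data_separated: "d \<in> data n q \<iota> \<Longrightarrow> separated q \<iota> d"
  by (simp add: data_def separated_def)

lemma even_of_sum:
  assumes "(a :: nat) mod 2 = n mod 2" "a + b + 2 * s = n"
  shows "even b"
proof -
  have "even (a + b + 2 * s) \<longleftrightarrow> even a" using assms by (metis even_iff_mod_2_eq_zero)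
  then show ?thesis by (cases "even a") simp_all
qed

lemma halve_sum:
  assumes "(a :: nat) mod 2 = n mod 2" "a + b + 2 * s = n"
  shows "a div 2 + b div 2 + s = n div 2"
proof -
  obtain c where "b = 2 * c" using even_of_sum[OF assms] by blast
  then have "n = a + 2 * (c + s)" "b div 2 = c" using assms(2) by auto
  then show ?thesis by simp
qed

lemma data_parity:
  assumes "d \<in> data n q \<iota>"
  shows "n_plus d mod 2 = n mod 2"
    "n_plus d + n_minus d + 2 * (\<Sum>i\<in>index_set d. part d i * card (orb d i)) = n"
  using assms by (simp_all add: data_def sum_distrib_left mult.assoc)

context
  fixes p q n :: nat and \<iota> :: "'k :: alg_closed_field"
  assumes alg: "algebraic_closure_of_Fq p q TYPE('k)" and odd_p: "odd p" and \<iota>: "\<iota> ^ 2 = -1"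
begin

lemma odd_q: "odd q"
  using alg odd_p by (auto simp: algebraic_closure_of_Fq_def)

lemma \<iota>_nonzero: "\<iota> \<noteq> 0"
  using \<iota> by auto

lemma hat_special: "hat 1 = square_class (1 :: 'k)" "hat \<iota> = square_class (-1)"
  using hat_eq_square_class[of "1 :: 'k"] hat_eq_square_class[OF \<iota>_nonzero] \<iota> by simp_all

lemma hat_special_neq: "hat \<iota> \<noteq> hat 1"
proof
  assume "hat \<iota> = hat 1"
  then have "(1 :: 'k) = -1 \<or> 1 * -1 = (1 :: 'k)"
    using square_class_eq_iff[of "1 :: 'k" "-1"] by (simp add: hat_special)
  then have "(1 :: 'k) = -1" by auto
  then have "(2 :: 'k) = 0" by (metis add.right_inverse one_add_one)
  with two_neq_zero[OF alg odd_p] show False by simp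
qed

lemma hat_special_orbit:
  "frob_orbit q (hat 1) = {hat (1 :: 'k)}" "frob_orbit q (hat \<iota>) = {hat \<iota>}"
  "hat (1 :: 'k) \<in> khat" "hat \<iota> \<in> khat"
proof -
  have "(hat_frob q ^^ m) (hat 1) = hat (1 :: 'k)" "(hat_frob q ^^ m) (hat \<iota>) = hat \<iota>" for m
    unfolding hat_special hat_frob_power_square_class[OF alg] using odd_q by simp_all
  then show "frob_orbit q (hat 1) = {hat (1 :: 'k)}" "frob_orbit q (hat \<iota>) = {hat \<iota>}"
    by (auto simp: frob_orbit_def)
  show "hat (1 :: 'k) \<in> khat" "hat \<iota> \<in> khat" using \<iota>_nonzero by (auto simp: khat_def)
qed

lemma special_notin_orbit:
  assumes "separated q \<iota> d" "i \<in> index_set d"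
  shows "hat 1 \<notin> orb d i" "hat \<iota> \<notin> orb d i"
proof -
  have O: "orb d i \<in> hat_orbits q" "orb d i \<noteq> {hat 1}" "orb d i \<noteq> {hat \<iota>}"
    using assms by (auto simp: separated_def)
  show "hat 1 \<notin> orb d i" "hat \<iota> \<notin> orb d i"
    using hat_orbit_properties(4)[OF alg O(1)] O(2,3) hat_special_orbit(1,2) by metis+
qed

lemma orbit_unique:
  assumes d: "separated q \<iota> d" and i: "i \<in> index_set d" "j \<in> index_set d"
    and A: "A \<in> orb d i" "A \<in> orb d j"
  shows "i = j"
proof -
  have "orb d i \<in> hat_orbits q" "orb d j \<in> hat_orbits q" using d i by (auto simp: separated_def)
  then have "orb d i = orb d j" using hat_orbit_properties(4)[OF alg] A by metis
  with d i show ?thesis by (auto simp: separated_def inj_on_def)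
qed

lemma count_datum_multiset:
  assumes d: "separated q \<iota> d"
  shows "count (datum_multiset \<iota> d) A = (if A = hat 1 then n_plus d div 2 else 0) +
    (if A = hat \<iota> then n_minus d div 2 else 0) + (\<Sum>i\<in>index_set d. if A \<in> orb d i then part d i else 0)"
proof -
  have "count (repeat_mset (part d i) (mset_set (orb d i))) A = (if A \<in> orb d i then part d i else 0)"
    if "i \<in> index_set d" for i
  proof -
    have "orb d i \<in> hat_orbits q" using d that by (auto simp: separated_def)
    then show ?thesis using hat_orbit_properties(1)[OF alg] by (simp add: count_mset_set')
  qed
  then show ?thesis unfolding datum_multiset_def by (auto simp: count_sum intro!: sum.cong)
qed

lemma count_datum_multiset_orbit:
  assumes d: "separated q \<iota> d" and i: "i \<in> index_set d" "A \<in> orb d i"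
  shows "count (datum_multiset \<iota> d) A = part d i"
proof -
  have fin: "finite (index_set d)" using d by (simp add: separated_def)
  have "A \<noteq> hat 1" "A \<noteq> hat \<iota>" using special_notin_orbit[OF d i(1)] i(2) by auto
  moreover have "(\<Sum>j\<in>index_set d. if A \<in> orb d j then part d j else 0) = (\<Sum>j\<in>index_set d. if j = i then part d i else 0)"
  proof (rule sum.cong[OF refl])
    fix j assume j: "j \<in> index_set d"
    have "A \<notin> orb d j" if "j \<noteq> i" using orbit_unique[OF d j i(1) _ i(2)] that by blast
    then show "(if A \<in> orb d j then part d j else 0) = (if j = i then part d i else 0)"
      using i(2) by simp
  qed
  ultimately show ?thesis using i fin unfolding count_datum_multiset[OF d] by simp
qed

lemma count_datum_multiset_special:
  assumes d: "separated q \<iota> d"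
  shows "count (datum_multiset \<iota> d) (hat 1) = n_plus d div 2"
    "count (datum_multiset \<iota> d) (hat \<iota>) = n_minus d div 2"
  using special_notin_orbit[OF d] hat_special_neq unfolding count_datum_multiset[OF d] by auto

lemma count_datum_multiset_pos:
  assumes d: "separated q \<iota> d" and A: "A \<in># datum_multiset \<iota> d" "A \<noteq> hat 1" "A \<noteq> hat \<iota>"
  obtains i where "i \<in> index_set d" "A \<in> orb d i"
proof -
  have "count (datum_multiset \<iota> d) A \<noteq> 0" using A by simp
  then have "(\<Sum>i\<in>index_set d. if A \<in> orb d i then part d i else 0) \<noteq> 0"
    using A unfolding count_datum_multiset[OF d] by simp
  then obtain i where "i \<in> index_set d" "(if A \<in> orb d i then part d i else 0) \<noteq> 0"
    by (rule sum.not_neutral_contains_not_neutral)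
  then show ?thesis using that by (auto split: if_splits)
qed

lemma size_datum_multiset:
  "size (datum_multiset \<iota> d) = n_plus d div 2 + n_minus d div 2 + (\<Sum>i\<in>index_set d. part d i * card (orb d i))"
  by (simp add: datum_multiset_def)

lemma datum_multiset_khat:
  assumes d: "separated q \<iota> d" shows "set_mset (datum_multiset \<iota> d) \<subseteq> khat"
proof
  fix A assume A: "A \<in># datum_multiset \<iota> d"
  show "A \<in> khat"
  proof (cases "A = hat 1 \<or> A = hat \<iota>")
    case False
    then obtain i where i: "i \<in> index_set d" "A \<in> orb d i" using count_datum_multiset_pos[OF d A] by blast
    then have "orb d i \<in> hat_orbits q" using d by (auto simp: separated_def)
    then show ?thesis using hat_orbit_properties(3)[OF alg] i(2) by blast
  qed (use hat_special_orbit in auto)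
qed

lemma datum_multiset_frob_stable:
  assumes d: "separated q \<iota> d"
  shows "image_mset (hat_frob q) (datum_multiset \<iota> d) = datum_multiset \<iota> d"
  unfolding stable_iff_count[OF alg datum_multiset_khat[OF d]]
proof
  fix A :: "'k set" assume A: "A \<in> khat"
  have fixed: "hat_frob q (hat 1) = hat (1 :: 'k)" "hat_frob q (hat \<iota>) = hat \<iota>"
    unfolding hat_special hat_frob_square_class[OF alg] using odd_q by simp_all
  then have "hat_frob q A = hat 1 \<longleftrightarrow> A = hat 1" "hat_frob q A = hat \<iota> \<longleftrightarrow> A = hat \<iota>"
    using injD[OF inj_hat_frob[OF alg], of A] by metis+
  moreover have "hat_frob q A \<in> orb d i \<longleftrightarrow> A \<in> orb d i" if "i \<in> index_set d" for i
    using hat_orbit_properties(5)[OF alg _ A, of "orb d i"] d that by (auto simp: separated_def)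
  ultimately show "count (datum_multiset \<iota> d) (hat_frob q A) = count (datum_multiset \<iota> d) A"
    unfolding count_datum_multiset[OF d] by (auto intro!: sum.cong)
qed

lemma datum_multiset_stable:
  assumes d: "d \<in> data n q \<iota>"
  shows "datum_multiset \<iota> d \<in> stable_multisets n q"
proof -
  note sep = data_separated[OF d]
  have "size (datum_multiset \<iota> d) = n div 2"
    unfolding size_datum_multiset using data_parity[OF d] by (intro halve_sum)
  with datum_multiset_khat[OF sep] datum_multiset_frob_stable[OF sep] show ?thesis
    by (simp add: stable_multisets_def)
qed

lemma datum_multiset_eq_imp_match:
  assumes d: "d \<in> data n q \<iota>" and e: "e \<in> data n q \<iota>"
    and eq: "datum_multiset \<iota> d = datum_multiset \<iota> e" and i: "i \<in> index_set d"
  shows "\<exists>j\<in>index_set e. part e j = part d i \<and> orb e j = orb d i"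
proof -
  note sd = data_separated[OF d] and se = data_separated[OF e]
  have O: "orb d i \<in> hat_orbits q" using sd i by (auto simp: separated_def)
  obtain A where A: "A \<in> orb d i" using hat_orbit_properties(2)[OF alg O] by blast
  have c: "count (datum_multiset \<iota> d) A = part d i" by (rule count_datum_multiset_orbit[OF sd i A])
  moreover have "part d i > 0" using d i by (auto simp: data_def)
  ultimately have "A \<in># datum_multiset \<iota> e" unfolding eq[symmetric] by (simp add: count_greater_zero_iff[symmetric])
  moreover have "A \<noteq> hat 1" "A \<noteq> hat \<iota>" using special_notin_orbit[OF sd i] A by auto
  ultimately obtain j where j: "j \<in> index_set e" "A \<in> orb e j" using count_datum_multiset_pos[OF se] by blast
  then have "orb e j \<in> hat_orbits q" using se by (auto simp: separated_def)
  then have "orb e j = orb d i"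
    using hat_orbit_properties(4)[OF alg O A] hat_orbit_properties(4)[OF alg _ j(2)] by simp
  moreover have "part e j = part d i"
    using count_datum_multiset_orbit[OF se j] c eq by simp
  ultimately show ?thesis using j(1) by blast
qed

lemma datum_multiset_eq_iff:
  assumes d: "d \<in> data n q \<iota>" and e: "e \<in> data n q \<iota>"
  shows "datum_multiset \<iota> d = datum_multiset \<iota> e \<longleftrightarrow> (d, e) \<in> datum_rel n q \<iota>"
proof
  assume eq: "datum_multiset \<iota> d = datum_multiset \<iota> e"
  note sd = data_separated[OF d] and se = data_separated[OF e]
  have "n_plus d div 2 = n_plus e div 2" "n_minus d div 2 = n_minus e div 2"
    using count_datum_multiset_special[OF sd] count_datum_multiset_special[OF se] eq by simp_all
  moreover have "n_plus d mod 2 = n_plus e mod 2" "even (n_minus d)" "even (n_minus e)"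
    using data_parity[OF d] data_parity[OF e] even_of_sum by (metis, metis, metis)
  ultimately have npm: "n_plus d = n_plus e" "n_minus d = n_minus e"
    by (metis mod_mult_div_eq, metis dvd_mult_div_cancel)
  have "\<forall>i\<in>index_set d. \<exists>j. j \<in> index_set e \<and> part e j = part d i \<and> orb e j = orb d i"
    using datum_multiset_eq_imp_match[OF d e eq] by blast
  then obtain f where f: "\<And>i. i \<in> index_set d \<Longrightarrow> f i \<in> index_set e \<and> part e (f i) = part d i \<and> orb e (f i) = orb d i"
    by metis
  have injd: "inj_on (orb d) (index_set d)" and inje: "inj_on (orb e) (index_set e)"
    using sd se by (auto simp: separated_def)
  have "inj_on f (index_set d)"
    using f injd unfolding inj_on_def by metis
  moreover have "f ` index_set d = index_set e"
  proof (intro equalityI subsetI)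
    fix j assume j: "j \<in> index_set e"
    then obtain i where i: "i \<in> index_set d" "orb d i = orb e j"
      using datum_multiset_eq_imp_match[OF e d eq[symmetric]] by blast
    then have "f i = j" using f[OF i(1)] j inje by (auto simp: inj_on_def)
    with i show "j \<in> f ` index_set d" by blast
  qed (use f in auto)
  ultimately have "bij_betw f (index_set d) (index_set e)" by (simp add: bij_betw_def)
  with f npm d e show "(d, e) \<in> datum_rel n q \<iota>" unfolding datum_rel_def by blast
next
  assume "(d, e) \<in> datum_rel n q \<iota>"
  then obtain f where f: "bij_betw f (index_set d) (index_set e)"
    "\<And>i. i \<in> index_set d \<Longrightarrow> part e (f i) = part d i \<and> orb e (f i) = orb d i"
    and n: "n_plus d = n_plus e" "n_minus d = n_minus e"
    by (auto simp: datum_rel_def)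
  have "(\<Sum>i\<in>index_set e. repeat_mset (part e i) (mset_set (orb e i))) =
      (\<Sum>i\<in>index_set d. repeat_mset (part e (f i)) (mset_set (orb e (f i))))"
    by (rule sum.reindex_bij_betw[OF f(1), symmetric])
  also have "\<dots> = (\<Sum>i\<in>index_set d. repeat_mset (part d i) (mset_set (orb d i)))"
    using f(2) by (intro sum.cong) auto
  finally show "datum_multiset \<iota> d = datum_multiset \<iota> e" by (simp add: datum_multiset_def n)
qed

lemma count_orbit_constant:
  assumes \<mu>: "set_mset \<mu> \<subseteq> khat" "image_mset (hat_frob q) \<mu> = (\<mu> :: 'k set multiset)"
    and A: "A \<in> khat" and B: "B \<in> frob_orbit q A"
  shows "count \<mu> B = count \<mu> A"
proof -
  obtain m where "B = (hat_frob q ^^ m) A" using B by (auto simp: frob_orbit_def)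
  moreover have "count \<mu> ((hat_frob q ^^ m) A) = count \<mu> A" for m
    by (induction m) (use \<mu> stable_iff_count[OF alg \<mu>(1)] hat_frob_power_khat[OF alg A] in auto)
  ultimately show ?thesis by simp
qed

text \<open>The orbits in the support, apart from the two special ones, are enumerated by natural numbers.\<close>

lemma datum_multiset_surj:
  assumes "\<mu> \<in> stable_multisets n q"
  shows "\<exists>d\<in>data n q \<iota>. datum_multiset \<iota> d = \<mu>"
proof -
  have \<mu>: "size \<mu> = n div 2" "set_mset \<mu> \<subseteq> khat" "image_mset (hat_frob q) \<mu> = \<mu>"
    using assms by (auto simp: stable_multisets_def)
  define Os where "Os = frob_orbit q ` set_mset \<mu> - {{hat 1}, {hat \<iota>}}"
  have "finite Os" by (simp add: Os_def)
  then obtain e where e: "bij_betw e {0..<card Os} Os" using ex_bij_betw_nat_finite by blast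
  have eOs: "e i \<in> Os" if "i < card Os" for i
    using bspec[OF bij_betwE[OF e], of i] that by simp
  then have mem: "\<exists>A. A \<in># \<mu> \<and> e i = frob_orbit q A" if "i < card Os" for i
    using that unfolding Os_def by blast
  define c where "c = (\<lambda>i. count \<mu> (SOME A. A \<in> e i))"
  have c: "c i = count \<mu> A" if i: "i < card Os" and A: "A \<in> e i" for i A
  proof -
    obtain B where B: "B \<in># \<mu>" "e i = frob_orbit q B" using mem[OF i] by blast
    have "(SOME A. A \<in> e i) \<in> e i" using A by (rule someI)
    then show ?thesis
      using count_orbit_constant[OF \<mu>(2,3)] B A \<mu>(2) unfolding c_def by (metis subsetD)
  qed
  define d where "d = Datum (2 * count \<mu> (hat 1) + n mod 2) (2 * count \<mu> (hat \<iota>)) {0..<card Os} c e"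
  have sep: "separated q \<iota> d"
  proof -
    have "Os \<subseteq> hat_orbits q - {{hat 1}, {hat \<iota>}}"
      using \<mu>(2) unfolding Os_def hat_orbits_eq by blast
    then have "e i \<in> hat_orbits q - {{hat 1}, {hat \<iota>}}" if "i < card Os" for i
      using eOs[OF that] by blast
    then show ?thesis using bij_betw_imp_inj_on[OF e] by (simp add: separated_def d_def)
  qed
  have eq: "datum_multiset \<iota> d = \<mu>"
  proof (rule multiset_eqI)
    fix A
    consider "A = hat 1" | "A = hat \<iota>" | i where "i \<in> index_set d" "A \<in> orb d i"
      | "A \<noteq> hat 1" "A \<noteq> hat \<iota>" "\<And>i. i \<in> index_set d \<Longrightarrow> A \<notin> orb d i" by blast
    then show "count (datum_multiset \<iota> d) A = count \<mu> A"
    proof cases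
      case 1 then show ?thesis using count_datum_multiset_special(1)[OF sep] by (simp add: d_def)
    next
      case 2 then show ?thesis using count_datum_multiset_special(2)[OF sep] by (simp add: d_def)
    next
      case 3 then show ?thesis using count_datum_multiset_orbit[OF sep 3] c[of i A] by (simp add: d_def)
    next
      case 4
      then have "A \<notin># datum_multiset \<iota> d" using count_datum_multiset_pos[OF sep] by blast
      moreover have "A \<notin># \<mu>"
      proof
        assume "A \<in># \<mu>"
        moreover have "frob_orbit q A \<noteq> {hat 1}" "frob_orbit q A \<noteq> {hat \<iota>}"
          using 4(1,2) frob_orbit_self[of A q] by auto
        ultimately have "frob_orbit q A \<in> Os" unfolding Os_def by blast
        then obtain i where "i \<in> {0..<card Os}" "e i = frob_orbit q A"
          using e unfolding bij_betw_def by (metis (no_types, lifting) imageE)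
        then show False using 4(3)[of i] frob_orbit_self[of A q] by (simp add: d_def)
      qed
      ultimately show ?thesis by (simp add: not_in_iff)
    qed
  qed
  have "(\<Sum>i\<in>index_set d. 2 * part d i * card (orb d i)) = 2 * (\<Sum>i\<in>index_set d. part d i * card (orb d i))"
    by (simp add: sum_distrib_left mult.assoc)
  moreover have "count \<mu> (hat 1) + count \<mu> (hat \<iota>) + (\<Sum>i\<in>index_set d. part d i * card (orb d i)) = n div 2"
    using size_datum_multiset[of d] \<mu>(1) unfolding eq by (simp add: d_def)
  moreover have "2 * (n div 2) + n mod 2 = n" by (rule mult_div_mod_eq)
  ultimately have tot: "n_plus d + n_minus d + (\<Sum>i\<in>index_set d. 2 * part d i * card (orb d i)) = n"
    unfolding d_def datum.sel by linarith
  have pos: "part d i > 0" if "i \<in> index_set d" for i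
  proof -
    have i: "i < card Os" using that by (simp add: d_def)
    then obtain A where A: "A \<in># \<mu>" "e i = frob_orbit q A" using mem by blast
    then have "c i = count \<mu> A" using c[OF i, of A] frob_orbit_self[of A q] by simp
    with A(1) show ?thesis by (simp add: d_def)
  qed
  have "d \<in> data n q \<iota>"
    unfolding data_def
  proof (intro CollectI conjI ballI)
    show "n_plus d mod 2 = n mod 2" by (simp add: d_def)
  qed (use sep tot pos in \<open>simp_all only: separated_def\<close>)
  with eq show ?thesis by blast
qed

lemma quotient_bij_betw:
  assumes r: "equiv X r" and surj: "f ` X = Y"
    and iff: "\<And>x y. x \<in> X \<Longrightarrow> y \<in> X \<Longrightarrow> f x = f y \<longleftrightarrow> (x, y) \<in> r"
  shows "bij_betw (\<lambda>c. f (SOME x. x \<in> c)) (X // r) Y"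
proof -
  have rep: "(SOME y. y \<in> r `` {x}) \<in> X \<and> f (SOME y. y \<in> r `` {x}) = f x" if x: "x \<in> X" for x
  proof -
    have "x \<in> r `` {x}" using equiv_class_self[OF r x] .
    then have "(SOME y. y \<in> r `` {x}) \<in> r `` {x}" by (rule someI)
    then have *: "(x, SOME y. y \<in> r `` {x}) \<in> r" by simp
    then have X: "(SOME y. y \<in> r `` {x}) \<in> X" using r by (auto simp: equiv_def)
    have "f x = f (SOME y. y \<in> r `` {x})" using iff[OF x X] * by (rule iffD2)
    with X show ?thesis by (simp only:)
  qed
  show ?thesis
  proof (rule bij_betwI')
    fix c c' assume "c \<in> X // r" "c' \<in> X // r"
    then obtain x x' where x: "x \<in> X" "c = r `` {x}" "x' \<in> X" "c' = r `` {x'}"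
      by (auto elim!: quotientE)
    have "f (SOME x. x \<in> c) = f (SOME x. x \<in> c') \<longleftrightarrow> f x = f x'" using rep x by simp
    also have "\<dots> \<longleftrightarrow> (x, x') \<in> r" using iff x by blast
    also have "\<dots> \<longleftrightarrow> c = c'" unfolding x using eq_equiv_class_iff[OF r x(1,3)] by simp
    finally show "f (SOME x. x \<in> c) = f (SOME x. x \<in> c') \<longleftrightarrow> c = c'" .
  next
    fix c assume "c \<in> X // r"
    then obtain x where "x \<in> X" "c = r `` {x}" by (auto elim!: quotientE)
    then show "f (SOME x. x \<in> c) \<in> Y" using rep surj by auto
  next
    fix y assume "y \<in> Y"
    then obtain x where "x \<in> X" "y = f x" using surj by auto
    then show "\<exists>c\<in>X // r. y = f (SOME x. x \<in> c)" using rep quotientI by metis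
  qed
qed

theorem data_classes_bij_stable_multisets:
  "\<exists>f. bij_betw f (T_C_s n q \<iota>) (stable_multisets n q :: 'k set multiset set)"
proof -
  have "datum_multiset \<iota> ` data n q \<iota> = stable_multisets n q"
    using datum_multiset_stable datum_multiset_surj by blast
  from quotient_bij_betw[OF equiv_datum_rel this]
  have "bij_betw (\<lambda>c. datum_multiset \<iota> (SOME x. x \<in> c)) (T_C_s n q \<iota>) (stable_multisets n q)"
    unfolding T_C_s_def using datum_multiset_eq_iff by blast
  then show ?thesis by blast
qed

end


section \<open>Conjugacy classes as congruence classes of forms\<close>

text \<open>In every case the automorphism comes from an antidiagonal matrix with entries \<open>\<plusminus>1\<close> that is
  symmetric or antisymmetric, so that \<open>ratio n J\<close> is constantly \<open>1\<close> or \<open>-1\<close>.\<close>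

lemma admissible_extension_form:
  assumes adm: "admissible_extension n \<tau> (s :: 'k :: alg_closed_field mat \<times> bool)" and q: "odd q"
  shows "\<exists>J s0 c. \<tau> = tw n J \<and> s = (s0, True) \<and> s0 \<in> carrier (GL n) \<and> antidiagonal n J \<and>
    (\<forall>i<n. ratio n J i = c) \<and> map_mat (\<lambda>a. a ^ q) J = J"
proof -
  have anti: "anti_id n = monomial n (\<lambda>i. n - 1 - i) (\<lambda>_. 1 :: 'k)"
    by (auto simp: anti_id_def monomial_def intro!: eq_matI)
  have tanti: "t0 n * anti_id n = monomial n (\<lambda>i. n - 1 - i) (\<lambda>i. if i < n div 2 then 1 else -1 :: 'k)"
    unfolding anti t0_def by (subst mat_diag_mult_left[of _ n n]) (auto simp: monomial_def intro!: eq_matI)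
  have q0: "q > 0" using q by (rule odd_pos)
  have frob: "map_mat (\<lambda>a. a ^ q) (monomial n w x) = monomial n w x"
    if x: "\<And>i. i < n \<Longrightarrow> x i = 1 \<or> x i = (-1 :: 'k)" for w x
  proof -
    have "x i ^ q = x i" if "i < n" for i using x[OF that] q by auto
    then show ?thesis using q0 by (intro eq_matI) (auto simp: monomial_def)
  qed
  have anti_case: "antidiagonal n (anti_id n :: 'k mat)" "\<forall>i<n. ratio n (anti_id n :: 'k mat) i = 1"
    "map_mat (\<lambda>a. a ^ q) (anti_id n) = (anti_id n :: 'k mat)"
  proof -
    show "antidiagonal n (anti_id n :: 'k mat)"
      unfolding anti by (rule reversal_monomial_antidiagonal) simp
    show "\<forall>i<n. ratio n (anti_id n :: 'k mat) i = 1"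
      unfolding anti by (auto simp: ratio_def monomial_def)
    show "map_mat (\<lambda>a. a ^ q) (anti_id n) = (anti_id n :: 'k mat)"
      unfolding anti by (rule frob) simp
  qed
  have t0: "t0 n \<in> carrier (GL n :: 'k mat monoid)" by (simp add: t0_def)
  from adm consider "odd n" "\<tau> = tw n (anti_id n)" "s = (1\<^sub>m n, True)"
    | "even n" "\<tau> = tw n (t0 n * anti_id n)" "s = (1\<^sub>m n, True)"
    | "even n" "\<tau> = tw n (anti_id n)" "s = (t0 n, True)"
    by (auto simp: admissible_extension_def \<sigma>_aut_def \<sigma>'_aut_def script_J_def split: if_splits)
  then show ?thesis
  proof cases
    case 1
    then show ?thesis using anti_case by (intro exI[of _ "anti_id n"] exI[of _ "1\<^sub>m n"] exI[of _ 1]) simp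
  next
    case 2
    have "\<forall>i<n. ratio n (t0 n * anti_id n :: 'k mat) i = -1"
      unfolding tanti using \<open>even n\<close> by (auto simp: ratio_def monomial_def elim!: evenE)
    moreover have "antidiagonal n (t0 n * anti_id n :: 'k mat)"
      unfolding tanti by (rule reversal_monomial_antidiagonal) simp
    moreover have "map_mat (\<lambda>a. a ^ q) (t0 n * anti_id n) = (t0 n * anti_id n :: 'k mat)"
      unfolding tanti by (rule frob) auto
    ultimately show ?thesis using 2
      by (intro exI[of _ "t0 n * anti_id n"] exI[of _ "1\<^sub>m n"] exI[of _ "-1"]) simp
  next
    case 3
    then show ?thesis using anti_case t0
      by (intro exI[of _ "anti_id n"] exI[of _ "t0 n"] exI[of _ 1]) simp
  qed
qed

lemma tw_one: "A \<in> carrier (GL n) \<Longrightarrow> tw n A (1\<^sub>m n) = 1\<^sub>m n"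
  by (simp add: twisted_inv_transpose_def)

lemma tw_inv:
  assumes "A \<in> carrier (GL n)" "X \<in> carrier (GL n)"
  shows "tw n A (ginv n X) = ginv n (tw n A X)"
  using assms by (intro GL_inv_eqI[symmetric]) (simp_all flip: tw_mult add: tw_one)

text \<open>\<open>J\<close> is a scalar multiple of \<open>J\<^sup>T\<close>, and scalars act trivially.\<close>

lemma tw_involution:
  assumes J: "antidiagonal n J" and c: "\<And>i. i < n \<Longrightarrow> ratio n J i = c" and X: "X \<in> carrier (GL n)"
  shows "tw n J (tw n J X) = X"
proof -
  let ?z = "mat_diag n (\<lambda>_. c)"
  have Jc: "J \<in> carrier (GL n)" by (rule antidiagonal_imp_GL[OF J])
  have z: "?z \<in> carrier (GL n)" using c ratio_nonzero[OF J] by auto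
  have "mat_diag n (ratio n J) = ?z" using c by (auto simp: mat_diag_def intro!: eq_matI)
  then have Jz: "J = ?z * transpose_mat J" using antidiagonal_asymmetry[OF J] by simp
  let ?W = "tw n (transpose_mat J) X"
  have W: "?W \<in> carrier (GL n)" using Jc X by simp
  have "?z * ?W = ?W * ?z"
    using W by (simp add: mat_diag_mult_left[of _ n n] mat_diag_mult_right[of _ n n] carrier_GL mult.commute)
  moreover have "tw n (?z * transpose_mat J) X = ?z * ?W * ginv n ?z"
    using Jc X z by (simp add: tw_simps[where n = n])
  ultimately have "tw n J X = ?W" using W z by (simp flip: Jz)
  then show ?thesis using tw_tw_transpose[OF Jc X] by simp
qed

lemma Gbar_mult: "(g, b) \<otimes>\<^bsub>Gbar n \<tau>\<^esub> (h, c) = (g * (if b then \<tau> h else h), b \<noteq> c)"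
  by (simp add: Gbar_def)

lemma Gbar_simps:
  "carrier (Gbar n \<tau>) = carrier (GL n) \<times> UNIV" "\<one>\<^bsub>Gbar n \<tau>\<^esub> = (1\<^sub>m n, False)"
  by (simp_all add: Gbar_def)

text \<open>The elements of the coset whose Gram matrices are congruent to \<open>A\<close>.\<close>

definition form_class :: "nat \<Rightarrow> 'k :: field mat \<Rightarrow> 'k mat \<Rightarrow> ('k mat \<times> bool) set" where
  "form_class n J A = (\<lambda>B. (B * ginv n J, True)) ` {B. congruent_forms n A B}"

lemma congruent_forms_GL: "A \<in> carrier (GL n) \<Longrightarrow> congruent_forms n A B \<Longrightarrow> B \<in> carrier (GL n)"
  by (auto simp: congruent_forms_def)

lemma congruent_forms_refl: "A \<in> carrier (GL n) \<Longrightarrow> congruent_forms n A A"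
  unfolding congruent_forms_def by (intro bexI[of _ "1\<^sub>m n"]) auto

lemma form_class_eq_iff:
  assumes "J \<in> carrier (GL n)" "A \<in> carrier (GL n)" "B \<in> carrier (GL n)"
  shows "form_class n J A = form_class n J B \<longleftrightarrow> congruent_forms n A B"
proof
  assume eq: "form_class n J A = form_class n J B"
  have "(B * ginv n J, True) \<in> form_class n J B"
    unfolding form_class_def using congruent_forms_refl[OF assms(3)] by blast
  then obtain B' where B': "congruent_forms n A B'" "B * ginv n J = B' * ginv n J"
    unfolding eq[symmetric] by (auto simp: form_class_def)
  then have "B * ginv n J * J = B' * ginv n J * J" by simp
  then have "B = B'" using assms congruent_forms_GL[OF assms(2) B'(1)] by simp
  with B' show "congruent_forms n A B" by simp
next
  assume AB: "congruent_forms n A B"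
  have "congruent_forms n A C \<longleftrightarrow> congruent_forms n B C" for C
    using congruent_forms_trans[OF assms(2) AB] congruent_forms_trans[OF assms(3) congruent_forms_sym[OF assms(2) AB]]
    by blast
  then show "form_class n J A = form_class n J B" by (simp add: form_class_def)
qed

context
  fixes p q n :: nat and J :: "'k :: alg_closed_field mat" and c :: 'k
  assumes alg: "algebraic_closure_of_Fq p q TYPE('k)" and odd_p: "odd p"
    and J: "antidiagonal n J" and J_ratio: "\<And>i. i < n \<Longrightarrow> ratio n J i = c"
    and J_frob: "map_mat (\<lambda>a. a ^ q) J = J"
begin

lemma J_GL: "J \<in> carrier (GL n)"
  by (rule antidiagonal_imp_GL[OF J])

lemma inv_Gbar_emb:
  assumes h: "h \<in> carrier (GL n)"
  shows "inv\<^bsub>Gbar n (tw n J)\<^esub> (emb h) = emb (ginv n h)"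
  unfolding m_inv_def[of "Gbar n (tw n J)"]
proof (rule the_equality)
  show "emb (ginv n h) \<in> carrier (Gbar n (tw n J)) \<and>
    emb h \<otimes>\<^bsub>Gbar n (tw n J)\<^esub> emb (ginv n h) = \<one>\<^bsub>Gbar n (tw n J)\<^esub> \<and>
    emb (ginv n h) \<otimes>\<^bsub>Gbar n (tw n J)\<^esub> emb h = \<one>\<^bsub>Gbar n (tw n J)\<^esub>"
    using h by (simp add: emb_def Gbar_mult Gbar_simps)
next
  fix y :: "'k mat \<times> bool" assume y: "y \<in> carrier (Gbar n (tw n J)) \<and> emb h \<otimes>\<^bsub>Gbar n (tw n J)\<^esub> y = \<one>\<^bsub>Gbar n (tw n J)\<^esub> \<and>
    y \<otimes>\<^bsub>Gbar n (tw n J)\<^esub> emb h = \<one>\<^bsub>Gbar n (tw n J)\<^esub>"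
  obtain b d where bd: "y = (b, d)" by (cases y)
  with y have "b \<in> carrier (GL n)" "h * b = 1\<^sub>m n" "\<not> d"
    by (auto simp: emb_def Gbar_mult Gbar_simps)
  with GL_inv_eqI[OF h] bd show "y = emb (ginv n h)" by (simp add: emb_def)
qed

lemma inv_Gbar_twisted:
  assumes g: "g \<in> carrier (GL n)"
  shows "inv\<^bsub>Gbar n (tw n J)\<^esub> (g, True) = (ginv n (tw n J g), True)"
  unfolding m_inv_def[of "Gbar n (tw n J)"]
proof (rule the_equality)
  have \<tau>g: "tw n J g \<in> carrier (GL n)" using J_GL g by simp
  have "tw n J (ginv n (tw n J g)) = ginv n g"
    using tw_inv[OF J_GL \<tau>g] tw_involution[OF J J_ratio g] by simp
  then show "(ginv n (tw n J g), True) \<in> carrier (Gbar n (tw n J)) \<and>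
    (g, True) \<otimes>\<^bsub>Gbar n (tw n J)\<^esub> (ginv n (tw n J g), True) = \<one>\<^bsub>Gbar n (tw n J)\<^esub> \<and>
    (ginv n (tw n J g), True) \<otimes>\<^bsub>Gbar n (tw n J)\<^esub> (g, True) = \<one>\<^bsub>Gbar n (tw n J)\<^esub>"
    using g \<tau>g by (simp add: Gbar_mult Gbar_simps)
  fix y :: "'k mat \<times> bool" assume y: "y \<in> carrier (Gbar n (tw n J)) \<and> (g, True) \<otimes>\<^bsub>Gbar n (tw n J)\<^esub> y = \<one>\<^bsub>Gbar n (tw n J)\<^esub> \<and>
    y \<otimes>\<^bsub>Gbar n (tw n J)\<^esub> (g, True) = \<one>\<^bsub>Gbar n (tw n J)\<^esub>"
  obtain b d where bd: "y = (b, d)" by (cases y)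
  with y have d: d and b: "b \<in> carrier (GL n)" "b * tw n J g = 1\<^sub>m n"
    by (auto simp: Gbar_mult Gbar_simps split: if_splits)
  have "ginv n (tw n J g) = b" using b \<tau>g by (intro GL.inv_equality) auto
  with bd d show "y = (ginv n (tw n J g), True)" by simp
qed

lemma conj_by_emb:
  assumes "h \<in> carrier (GL n)" "g \<in> carrier (GL n)"
  shows "conj_by n (tw n J) (emb h) (g, True) = (h * (g * J) * transpose_mat h * ginv n J, True)"
  unfolding conj_by_def inv_Gbar_emb[OF assms(1)]
  using assms J_GL by (simp add: emb_def Gbar_mult tw_simps[where n = n])

lemma conj_by_twisted:
  assumes "g \<in> carrier (GL n)" "X \<in> carrier (GL n)"
  shows "conj_by n (tw n J) (g, True) (emb X) = emb (tw n (g * J) X)"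
proof -
  have \<tau>g: "tw n J g \<in> carrier (GL n)" using J_GL assms by simp
  have "tw n J (ginv n (tw n J g)) = ginv n g"
    using tw_inv[OF J_GL \<tau>g] tw_involution[OF J J_ratio assms(1)] by simp
  moreover have "g * tw n J X * ginv n g = tw n (g * J) X"
    using assms J_GL by (simp add: tw_simps[where n = n])
  ultimately show ?thesis
    unfolding conj_by_def inv_Gbar_twisted[OF assms(1)] by (simp add: emb_def Gbar_mult)
qed

lemma G_class_eq_form_class:
  assumes g: "g \<in> carrier (GL n)"
  shows "G_class n (tw n J) (g, True) = form_class n J (g * J)"
proof -
  have "G_class n (tw n J) (g, True) =
      (\<lambda>h. (h * (g * J) * transpose_mat h * ginv n J, True)) ` carrier (GL n)"
    unfolding G_class_def using conj_by_emb[OF _ g] by force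
  also have "\<dots> = form_class n J (g * J)"
    unfolding form_class_def congruent_forms_def by blast
  finally show ?thesis .
qed

lemma conj_by_twisted_image:
  assumes "g \<in> carrier (GL n)" "S \<subseteq> carrier (GL n)"
  shows "conj_by n (tw n J) (g, True) ` emb ` S = emb ` S \<longleftrightarrow> tw n (g * J) ` S = S"
proof -
  have "conj_by n (tw n J) (g, True) ` emb ` S = emb ` tw n (g * J) ` S"
    unfolding image_image using conj_by_twisted[OF assms(1)] assms(2) by (intro image_cong) auto
  moreover have "inj (emb :: 'k mat \<Rightarrow> _)" by (auto simp: emb_def intro: injI)
  ultimately show ?thesis by (simp add: inj_image_eq_iff)
qed

lemma quasi_semisimple_imp_antidiagonal:
  assumes "quasi_semisimple n (tw n J) (g, True)"
  shows "g \<in> carrier (GL n)" "\<exists>A. congruent_forms n (g * J) A \<and> antidiagonal n A"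
proof -
  show g: "g \<in> carrier (GL n)" using assms by (auto simp: quasi_semisimple_def Gbar_simps)
  obtain T B where TB: "maximal_torus n T" "borel_subgroup n B" "T \<subseteq> B"
    "conj_by n (tw n J) (g, True) ` emb ` T = emb ` T" "conj_by n (tw n J) (g, True) ` emb ` B = emb ` B"
    using assms by (auto simp: quasi_semisimple_def)
  have "B \<subseteq> carrier (GL n)"
    using TB(2) by (auto simp: borel_subgroup_def connected_solvable_subgroup_def closed_subgroup_def
      dest: subgroup.subset)
  then have "tw n (g * J) ` T = T" "tw n (g * J) ` B = B"
    using TB(3-5) conj_by_twisted_image[OF g] by auto
  then show "\<exists>A. congruent_forms n (g * J) A \<and> antidiagonal n A"
    using normalizing_form_imp_antidiagonal[OF alg odd_p _ TB(1) _ TB(2,3)] g J_GL by simp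
qed

lemma antidiagonal_quasi_semisimple:
  assumes A: "antidiagonal n A"
  shows "quasi_semisimple n (tw n J) (A * ginv n J, True)"
  unfolding quasi_semisimple_def
proof (intro conjI exI)
  have Ac: "A \<in> carrier (GL n)" by (rule antidiagonal_imp_GL[OF A])
  then have g: "A * ginv n J \<in> carrier (GL n)" and gJ: "A * ginv n J * J = A"
    using J_GL by auto
  then show "(A * ginv n J, True) \<in> carrier (Gbar n (tw n J))" by (simp add: Gbar_simps)
  show "maximal_torus n (diag_group n :: 'k mat set)" by (rule maximal_torus_diag[OF alg odd_p])
  show "borel_subgroup n (triangular n (\<lambda>i. i) :: 'k mat set)" by (rule borel_triangular[OF alg odd_p])
  show "diag_group n \<subseteq> (triangular n (\<lambda>i. i) :: 'k mat set)" by (rule diag_group_triangular)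
  have tri: "triangular n (\<lambda>i. i) \<subseteq> (carrier (GL n) :: 'k mat set)" by (auto simp: triangular_def)
  show "conj_by n (tw n J) (A * ginv n J, True) ` emb ` triangular n (\<lambda>i. i) = emb ` triangular n (\<lambda>i. i)"
    unfolding conj_by_twisted_image[OF g tri] gJ by (rule antidiagonal_tw_triangular[OF alg A])
  show "conj_by n (tw n J) (A * ginv n J, True) ` emb ` diag_group n = emb ` diag_group n"
    unfolding conj_by_twisted_image[OF g diag_group_carrier] gJ by (rule antidiagonal_tw_diag[OF A])
qed

abbreviation fr :: "'k mat \<Rightarrow> 'k mat" where "fr \<equiv> map_mat (\<lambda>a. a ^ q)"

lemma power_q_hom: "field_hom (\<lambda>a :: 'k. a ^ q)"
  using power_q_add[OF alg, of _ _ 1] closure_power(3)[OF alg]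
  by unfold_locales (auto simp: power_mult_distrib)

lemma fr_facts:
  assumes "A \<in> carrier (GL n)" "B \<in> carrier (GL n)"
  shows "fr A \<in> carrier (GL n)" "fr (A * B) = fr A * fr B" "fr (transpose_mat A) = transpose_mat (fr A)"
    "fr (ginv n A) = ginv n (fr A)"
proof -
  interpret h: field_hom "\<lambda>a :: 'k. a ^ q" by (rule power_q_hom)
  have cl: "fr A \<in> carrier (GL n)" if "A \<in> carrier (GL n)" for A
    using that closure_power(3)[OF alg] by (auto simp: carrier_GL)
  then show "fr A \<in> carrier (GL n)" using assms by simp
  have mult: "fr (A * B) = fr A * fr B" if "A \<in> carrier (GL n)" "B \<in> carrier (GL n)" for A B
    using that by (intro h.mat_hom_mult[of _ n n _ n]) auto
  then show "fr (A * B) = fr A * fr B" using assms by simp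
  show "fr (transpose_mat A) = transpose_mat (fr A)" by (auto intro!: eq_matI)
  have "fr A * fr (ginv n A) = fr (1\<^sub>m n)" using assms mult[of A "ginv n A"] by simp
  also have "fr (1\<^sub>m n) = 1\<^sub>m n" by (rule h.mat_hom_one)
  finally show "fr (ginv n A) = ginv n (fr A)"
    using assms cl by (intro GL_inv_eqI[symmetric]) auto
qed

lemma fr_surj:
  assumes "h \<in> carrier (GL n)" shows "\<exists>h'\<in>carrier (GL n). fr h' = h"
proof -
  interpret h: field_hom "\<lambda>a :: 'k. a ^ q" by (rule power_q_hom)
  have q0: "q > 0" using closure_power(3)[OF alg] by simp
  then have "\<forall>a :: 'k. \<exists>b. b ^ q = a" by (intro allI nth_root_exists)
  then obtain rt :: "'k \<Rightarrow> 'k" where rt: "\<And>a. rt a ^ q = a" by metis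
  have hm: "h \<in> carrier_mat n n" "det h \<noteq> 0" using assms by (auto simp: carrier_GL)
  have "fr (map_mat rt h) = h" by (auto simp: rt intro!: eq_matI)
  moreover from this have "det (map_mat rt h) ^ q = det h" using h.hom_det[of "map_mat rt h"] by simp
  then have "map_mat rt h \<in> carrier (GL n)" using hm q0 by (auto simp: carrier_GL)
  ultimately show ?thesis by blast
qed

lemma Frob_form_class:
  assumes A: "A \<in> carrier (GL n)"
  shows "Frob q ` form_class n J A = form_class n J (fr A)"
proof -
  have frob: "Frob q (h * A * transpose_mat h * ginv n J, True) =
      (fr h * fr A * transpose_mat (fr h) * ginv n J, True)" if "h \<in> carrier (GL n)" for h
    using that A J_GL by (simp add: Frob_def fr_facts J_frob)
  have fc: "form_class n J A = (\<lambda>h. (h * A * transpose_mat h * ginv n J, True)) ` carrier (GL n)" for A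
    unfolding form_class_def congruent_forms_def by blast
  have "Frob q ` form_class n J A = (\<lambda>h. (fr h * fr A * transpose_mat (fr h) * ginv n J, True)) ` carrier (GL n)"
    unfolding fc image_image using frob by (intro image_cong) auto
  also have "\<dots> = (\<lambda>h. (h * fr A * transpose_mat h * ginv n J, True)) ` fr ` carrier (GL n)"
    by (simp add: image_image)
  also have "fr ` carrier (GL n) = carrier (GL n)"
  proof (intro equalityI subsetI)
    fix h :: "'k mat" assume "h \<in> carrier (GL n)" then show "h \<in> fr ` carrier (GL n)" using fr_surj by force
  qed (use fr_facts(1) in auto)
  finally show ?thesis unfolding fc .
qed

lemma fr_antidiagonal: "antidiagonal n A \<Longrightarrow> antidiagonal n (fr A)"
  using closure_power(3)[OF alg] fr_facts(1)
  by (auto simp: antidiagonal_def carrier_GL)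

text \<open>For the two choices of the automorphism and of \<open>\<sigma>\<close>, the coset consists of all pairs with second
  component \<open>True\<close>. It is the same set of Gram matrices in each case.\<close>

lemma stable_qss_classes_eq:
  assumes s: "s = (s0, True)" "s0 \<in> carrier (GL n)"
  shows "stable_qss_classes n q (tw n J) s =
    {form_class n J A | A. antidiagonal n A \<and> congruent_forms n A (fr A)}"
proof -
  have coset: "G_coset n (tw n J) s = carrier (GL n) \<times> {True}"
  proof (intro equalityI subsetI)
    fix x assume "x \<in> G_coset n (tw n J) s"
    then show "x \<in> carrier (GL n) \<times> {True}" using s by (auto simp: G_coset_def emb_def Gbar_mult)
  next
    fix x :: "'k mat \<times> bool" assume "x \<in> carrier (GL n) \<times> {True}"
    then obtain g where g: "x = (g, True)" "g \<in> carrier (GL n)" by auto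
    then have "x = emb (g * ginv n s0) \<otimes>\<^bsub>Gbar n (tw n J)\<^esub> s"
      using s by (simp add: emb_def Gbar_mult)
    moreover have "g * ginv n s0 \<in> carrier (GL n)" using g s by simp
    ultimately show "x \<in> G_coset n (tw n J) s" unfolding G_coset_def by blast
  qed
  have stable: "Frob q ` form_class n J A = form_class n J A \<longleftrightarrow> congruent_forms n A (fr A)"
    if A: "A \<in> carrier (GL n)" for A
    unfolding Frob_form_class[OF A] using form_class_eq_iff[OF J_GL A fr_facts(1)[OF A A]] by auto
  show ?thesis
  proof (intro equalityI subsetI)
    fix C assume "C \<in> stable_qss_classes n q (tw n J) s"
    then obtain x where x: "quasi_semisimple n (tw n J) x" "C = G_class n (tw n J) x"
      and C: "C \<subseteq> carrier (GL n) \<times> {True}" "Frob q ` C = C"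
      by (auto simp: stable_qss_classes_def coset)
    obtain g b where gb: "x = (g, b)" by (cases x)
    have g: "g \<in> carrier (GL n)" using x(1) gb by (auto simp: quasi_semisimple_def Gbar_simps)
    have "conj_by n (tw n J) (emb (1\<^sub>m n)) x \<in> C" unfolding x(2) G_class_def by auto
    then have "snd (conj_by n (tw n J) (emb (1\<^sub>m n)) x)" using C(1) by auto
    then have b: b
      using inv_Gbar_emb[of "1\<^sub>m n"] by (cases b) (auto simp: conj_by_def gb emb_def Gbar_mult)
    have xg: "x = (g, True)" using gb b by simp
    have gJ: "g * J \<in> carrier (GL n)" using g J_GL by simp
    obtain A where A: "congruent_forms n (g * J) A" "antidiagonal n A"
      using quasi_semisimple_imp_antidiagonal(2) x(1) xg by blast
    have Ac: "A \<in> carrier (GL n)" by (rule antidiagonal_imp_GL[OF A(2)])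
    have CA: "C = form_class n J A"
      using x(2) xg G_class_eq_form_class[OF g] form_class_eq_iff[OF J_GL gJ Ac] A(1) by simp
    then have "congruent_forms n A (fr A)" using stable[OF Ac] C(2) by simp
    with CA A(2) show "C \<in> {form_class n J A | A. antidiagonal n A \<and> congruent_forms n A (fr A)}" by blast
  next
    fix C assume "C \<in> {form_class n J A | A. antidiagonal n A \<and> congruent_forms n A (fr A)}"
    then obtain A where A: "C = form_class n J A" "antidiagonal n A" "congruent_forms n A (fr A)" by blast
    have Ac: "A \<in> carrier (GL n)" by (rule antidiagonal_imp_GL[OF A(2)])
    let ?g = "A * ginv n J"
    have "?g \<in> carrier (GL n)" "?g * J = A" using Ac J_GL by auto
    then have "C = G_class n (tw n J) (?g, True)" using G_class_eq_form_class[of ?g] A(1) by simp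
    moreover have "C \<subseteq> carrier (GL n) \<times> {True}"
      unfolding A(1) form_class_def using congruent_forms_GL[OF Ac] J_GL by auto
    moreover have "Frob q ` C = C" unfolding A(1) using stable[OF Ac] A(3) by simp
    ultimately show "C \<in> stable_qss_classes n q (tw n J) s"
      unfolding stable_qss_classes_def coset using antidiagonal_quasi_semisimple[OF A(2)] by blast
  qed
qed

theorem stable_classes_bij_stable_multisets:
  assumes s: "s = (s0, True)" "s0 \<in> carrier (GL n)"
  shows "\<exists>f. bij_betw f (stable_multisets n q :: 'k set multiset set) (stable_qss_classes n q (tw n J) s)"
proof -
  have congr: "congruent_forms n A B \<longleftrightarrow> ratio_classes n A = ratio_classes n B"
    if "antidiagonal n A" "antidiagonal n B" for A B :: "'k mat"
    using congruent_imp_ratio_classes_eq[OF that] ratio_classes_eq_imp_congruent[OF that(2,1)] by auto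
  have stable: "congruent_forms n A (fr A) \<longleftrightarrow> image_mset (hat_frob q) (ratio_classes n A) = ratio_classes n A"
    if "antidiagonal n A" for A
    using congr[OF that fr_antidiagonal[OF that]] ratio_classes_Frobenius[OF alg that] by auto
  have "\<forall>\<mu> :: 'k set multiset. \<exists>A. \<mu> \<in> stable_multisets n q \<longrightarrow> antidiagonal n A \<and> ratio_classes n A = \<mu>"
    using exists_antidiagonal by (auto simp: stable_multisets_def)
  then obtain a where a: "\<And>\<mu> :: 'k set multiset. \<mu> \<in> stable_multisets n q \<Longrightarrow>
      antidiagonal n (a \<mu>) \<and> ratio_classes n (a \<mu>) = \<mu>" by metis
  have "bij_betw (\<lambda>\<mu>. form_class n J (a \<mu>)) (stable_multisets n q) (stable_qss_classes n q (tw n J) s)"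
    unfolding stable_qss_classes_eq[OF s]
  proof (rule bij_betwI')
    fix \<mu> \<nu> :: "'k set multiset" assume "\<mu> \<in> stable_multisets n q" "\<nu> \<in> stable_multisets n q"
    then have "antidiagonal n (a \<mu>)" "ratio_classes n (a \<mu>) = \<mu>"
      "antidiagonal n (a \<nu>)" "ratio_classes n (a \<nu>) = \<nu>" using a by auto
    then show "form_class n J (a \<mu>) = form_class n J (a \<nu>) \<longleftrightarrow> \<mu> = \<nu>"
      using form_class_eq_iff[OF J_GL] congr antidiagonal_imp_GL by metis
  next
    fix \<mu> :: "'k set multiset" assume \<mu>: "\<mu> \<in> stable_multisets n q"
    then have "congruent_forms n (a \<mu>) (fr (a \<mu>))"
      using a[OF \<mu>] stable[of "a \<mu>"] by (simp add: stable_multisets_def)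
    then show "form_class n J (a \<mu>) \<in> {form_class n J A | A. antidiagonal n A \<and> congruent_forms n A (fr A)}"
      using a[OF \<mu>] by blast
  next
    fix C assume "C \<in> {form_class n J A | A. antidiagonal n A \<and> congruent_forms n A (fr A)}"
    then obtain A where A: "C = form_class n J A" "antidiagonal n A" "congruent_forms n A (fr A)" by blast
    let ?\<mu> = "ratio_classes n A"
    have \<mu>: "?\<mu> \<in> stable_multisets n q"
      using ratio_classes_valid[OF A(2)] stable[OF A(2)] A(3) by (simp add: stable_multisets_def)
    have "congruent_forms n A (a ?\<mu>)" using congr[OF A(2)] a[OF \<mu>] by metis
    then have "C = form_class n J (a ?\<mu>)"
      using A form_class_eq_iff[OF J_GL] a[OF \<mu>] antidiagonal_imp_GL by metis
    with \<mu> show "\<exists>\<mu>\<in>stable_multisets n q. C = form_class n J (a \<mu>)" by blast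
  qed
  then show ?thesis by blast
qed

end

theorem proposition6p1p3:
  fixes p q n :: nat and \<iota> :: "'k :: alg_closed_field"
    and \<tau> :: "'k mat \<Rightarrow> 'k mat" and s :: "'k mat \<times> bool"
  assumes "odd p" and "algebraic_closure_of_Fq p q TYPE('k)" and "q > n"
    and "\<iota> ^ 2 = -1"
    and "admissible_extension n \<tau> s"
  shows "\<exists>f. bij_betw f (stable_qss_classes n q \<tau> s) (T_C_s n q \<iota>)"
proof -
  have "odd q" using assms(1,2) by (auto simp: algebraic_closure_of_Fq_def)
  then obtain J s0 c where J: "\<tau> = tw n J" "s = (s0, True)" "s0 \<in> carrier (GL n)" "antidiagonal n J"
    "\<forall>i<n. ratio n J i = c" "map_mat (\<lambda>a. a ^ q) J = J"
    using admissible_extension_form[OF assms(5)] by blast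
  obtain f where f: "bij_betw f (stable_multisets n q :: 'k set multiset set) (stable_qss_classes n q \<tau> s)"
    using stable_classes_bij_stable_multisets[OF assms(2,1) J(4) _ J(6,2,3)] J(1,5) by blast
  obtain g where g: "bij_betw g (T_C_s n q \<iota>) (stable_multisets n q :: 'k set multiset set)"
    using data_classes_bij_stable_multisets[OF assms(2,1,4)] by blast
  show ?thesis
    using bij_betw_inv_into[OF bij_betw_trans[OF g f]] by blast
qed

end
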